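(* Let $c>1$ and let $\theta$ be a smooth admissable function with respect to $c$ and $\alpha=1$, with Fourier series $\theta(x)=\sum_{k=-\infty}^\infty c_ke^{ik\tilde cx}$, $\tilde c=\frac{2\pi}{\log c}$. Let $f\in L^1(\mathbb{R})$ be a bounded, differentiable function with $f'(y)=O(|y|^{-\beta})$ for some $\beta>0$ as $y\to-\infty$, such that $f^{(2)},f^{(3)}$ exist and $f^{(3)}\in L^1(\mathbb{R})$. Then for almost every $x\in\mathbb{R}$ $$\frac{\partial_{\mathcal Z}}{\partial_{c,\theta}x}f(x)=\lim_{h\downarrow0}\Bigg[\sum_{k=-\infty}^{\infty}\bigg(\omega_{k,1}\,h^{ik\tilde c-1}\sum_{j=0}^{\infty}\binom{1-ik\tilde c}{j}(-1)^jf(x-jh)+\omega_{k,2}f'(x)\bigg)-c_0\gamma f'(x)+c_0\sum_{j=1}^{\infty}\frac1j\left(f'(x)1_{[0,h^{-1}]}(j)-f'(x-jh)\right)\Bigg],$$ where $\gamma$ is the Euler-Mascheroni constant.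
   Context: Given $c>1$ and $\alpha\in(0,2)$, a function $\theta:\mathbb{R}\to(0,\infty)$ is called admissable (with respect to $c$ and $\alpha$) if it is $\log(c^{1/\alpha})$-periodic and satisfies $\theta(y+\delta)\le e^{\alpha\delta}\theta(y)$ for all $y\in\mathbb{R}$, $\delta\ge 0$. It is called smooth admissable if in addition it is continuous on $\mathbb{R}$ and piecewise continuously differentiable. Here $\alpha=1$. Let $\phi_1$ be the measure on $(0,\infty)$ with $\phi_1(r,\infty)=r^{-1}\theta(\log r)$ for all $r>0$. The positive Zolotarev semi-fractional derivative of order $\alpha=1$ with respect to $c,\theta$ is $$\frac{\partial_{\mathcal Z}}{\partial_{c,\theta}x}f(x)=\int_{0+}^\infty\left(f(x-y)-f(x)+f'(x)\sin y\right)d\phi_1(y).$$ The coefficients are $\omega_{k,1}=-c_k\Gamma(ik\tilde c)$ and $\omega_{k,2}=c_k\Gamma(ik\tilde c)\cos\left(\frac{\pi}{2}ik\tilde c\right)$ for $k\ne0$, and $\omega_{0,1}=\omega_{0,2}=0$. For $z\in\mathbb{C}$, $\binom{z}{j}=\frac{z(z-1)\cdots(z-j+1)}{j!}$. $1_{[0,h^{-1}]}$ is the indicator function of the interval $[0,h^{-1}]$. *)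

theory Defs
  imports "HOL-Analysis.Analysis" "HOL-Library.Landau_Symbols"
begin

definition admissable :: "real \<Rightarrow> real \<Rightarrow> (real \<Rightarrow> real) \<Rightarrow> bool" where
  "admissable c \<alpha> \<theta> \<longleftrightarrow>
     (\<forall>y. \<theta> y > 0) \<and>
     (\<forall>y. \<theta> (y + ln (c powr (1 / \<alpha>))) = \<theta> y) \<and>
     (\<forall>y \<delta>. \<delta> \<ge> 0 \<longrightarrow> \<theta> (y + \<delta>) \<le> exp (\<alpha> * \<delta>) * \<theta> y)"

text \<open>
  Every compact interval splits into finitely many closed pieces on each of which the function is
  continuously differentiable, with one-sided derivatives at the ends of the piece.  The library's
  \<^const>\<open>piecewise_C1_differentiable_on\<close> differs in two ways: on the whole line it would allow only
  finitely many break points, and it does not ask the derivative to have one-sided limits there.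
\<close>
definition piecewise_C1 :: "(real \<Rightarrow> real) \<Rightarrow> bool" where
  "piecewise_C1 g \<longleftrightarrow>
     (\<forall>a b. a < b \<longrightarrow>
       (\<exists>(n::nat) t. t 0 = a \<and> t n = b \<and>
         (\<forall>i<n. t i < t (Suc i) \<and>
           (\<exists>D. continuous_on {t i..t (Suc i)} D \<and>
             (\<forall>x\<in>{t i..t (Suc i)}.
               (g has_real_derivative D x) (at x within {t i..t (Suc i)}))))))"

definition smooth_admissable :: "real \<Rightarrow> real \<Rightarrow> (real \<Rightarrow> real) \<Rightarrow> bool" where
  "smooth_admissable c \<alpha> \<theta> \<longleftrightarrow>
     admissable c \<alpha> \<theta> \<and> continuous_on UNIV \<theta> \<and> piecewise_C1 \<theta>"

definition c_tilde :: "real \<Rightarrow> real" where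
  "c_tilde c = 2 * pi / ln c"

text \<open>The Fourier coefficients of a function with period \<open>ln c\<close> (the case \<open>\<alpha> = 1\<close>).\<close>
definition fourier_coeff :: "real \<Rightarrow> (real \<Rightarrow> real) \<Rightarrow> int \<Rightarrow> complex" where
  "fourier_coeff c \<theta> k =
     (LINT x:{0..ln c}|lborel.
        complex_of_real (\<theta> x) * exp (- \<i> * of_int k * of_real (c_tilde c) * of_real x))
     / of_real (ln c)"

text \<open>
  The measure for \<open>\<alpha> = 1\<close>. Its space is the open half-line \<open>(0,\<infinity>)\<close>, on which it is
  sigma-finite but infinite near \<open>0\<close>; the tails determine it uniquely. For a smooth admissable
  \<open>\<theta>\<close> it exists, because \<open>r \<mapsto> \<theta> (ln r) / r\<close> is continuous, nonincreasing and
  tends to \<open>0\<close> at infinity.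
\<close>
definition zolotarev_measure :: "(real \<Rightarrow> real) \<Rightarrow> real measure \<Rightarrow> bool" where
  "zolotarev_measure \<theta> \<phi> \<longleftrightarrow>
     sets \<phi> = sets (restrict_space borel {0<..}) \<and>
     (\<forall>r>0. emeasure \<phi> {r<..} = ennreal (inverse r * \<theta> (ln r)))"

definition zolotarev_integrand :: "(real \<Rightarrow> complex) \<Rightarrow> real \<Rightarrow> real \<Rightarrow> complex" where
  "zolotarev_integrand f x y =
     f (x - y) - f x + vector_derivative f (at x) * of_real (sin y)"

definition zolotarev_deriv :: "real measure \<Rightarrow> (real \<Rightarrow> complex) \<Rightarrow> real \<Rightarrow> complex" where
  "zolotarev_deriv \<phi> f x = (LINT y|\<phi>. zolotarev_integrand f x y)"

definition omega1 :: "real \<Rightarrow> (real \<Rightarrow> real) \<Rightarrow> int \<Rightarrow> complex" where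
  "omega1 c \<theta> k =
     (if k = 0 then 0
      else - fourier_coeff c \<theta> k * Gamma (\<i> * of_int k * of_real (c_tilde c)))"

definition omega2 :: "real \<Rightarrow> (real \<Rightarrow> real) \<Rightarrow> int \<Rightarrow> complex" where
  "omega2 c \<theta> k =
     (if k = 0 then 0
      else fourier_coeff c \<theta> k * Gamma (\<i> * of_int k * of_real (c_tilde c))
           * cos (of_real (pi / 2) * \<i> * of_int k * of_real (c_tilde c)))"

text \<open>
  \<open>GL_term\<close> is the \<open>j\<close>-th term of the inner series, \<open>semi_term\<close> the \<open>k\<close>-th term of the
  outer one. The third series, with terms \<open>log_term\<close>, starts at \<open>j = 1\<close>.
\<close>
definition GL_term :: "real \<Rightarrow> (real \<Rightarrow> complex) \<Rightarrow> real \<Rightarrow> real \<Rightarrow> int \<Rightarrow> nat \<Rightarrow> complex" where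
  "GL_term c f x h k j =
     ((1 - \<i> * of_int k * of_real (c_tilde c)) gchoose j) * (-1) ^ j * f (x - real j * h)"

definition semi_term ::
  "real \<Rightarrow> (real \<Rightarrow> real) \<Rightarrow> (real \<Rightarrow> complex) \<Rightarrow> real \<Rightarrow> real \<Rightarrow> int \<Rightarrow> complex" where
  "semi_term c \<theta> f x h k =
     omega1 c \<theta> k * of_real h powr (\<i> * of_int k * of_real (c_tilde c) - 1)
       * (\<Sum>j. GL_term c f x h k j)
     + omega2 c \<theta> k * vector_derivative f (at x)"

definition log_term :: "(real \<Rightarrow> complex) \<Rightarrow> real \<Rightarrow> real \<Rightarrow> nat \<Rightarrow> complex" where
  "log_term f x h j =
     1 / of_nat j * (vector_derivative f (at x) * indicator {0..inverse h} (real j)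
                     - vector_derivative f (at (x - real j * h)))"

end

theory Submission
  imports Defs
begin

text \<open>
  For \<open>y > 0\<close> let \<open>N\<close> be a Poisson variable of mean \<open>y / h\<close>.  Writing the Gamma function in the
  Gruenwald-Letnikov weights as an integral turns the sum over \<open>j\<close> into a Mellin transform in \<open>y\<close>
  of \<open>E f (x - h N)\<close>, suitably compensated at \<open>0\<close>.  Summing these transforms against the Fourier
  coefficients of \<open>\<theta>\<close> amounts to evaluating a periodic function at \<open>0\<close> through its Fourier series,
  and produces an integral against \<open>\<phi>\<close>; hence, up to \<open>O(h)\<close>, the outer series is the
  \<open>\<phi>\<close>-integral of a compensated version of \<open>E f (x - h N)\<close>, minus its missing term \<open>k = 0\<close>.
  The integrand is bounded by a multiple of \<open>min 1 (y\<^sup>2)\<close> uniformly in \<open>h\<close> and converges pointwise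
  to \<open>f (x - y) - f x + f' x * sin y\<close>.  The missing term is explicit, and summation by parts
  identifies it asymptotically with the logarithmic series.
\<close>

subsection \<open>Gamma integrals with a complex rate\<close>

lemma powr_of_real_continuous_on [continuous_intros]:
  "continuous_on {0<..} (\<lambda>t. complex_of_real t powr z)"
proof -
  have "continuous_on {0<..} (\<lambda>t. exp (z * of_real (ln t)))"
    by (intro continuous_intros) auto
  thus ?thesis
    by (rule continuous_on_eq) (auto simp: powr_def Ln_of_real)
qed

lemma Gamma_kernel_integrable:
  assumes "Re z > 0" "Re p > 0"
  shows "set_integrable lborel {0<..} (\<lambda>t. of_real t powr (z - 1) * exp (- (p * of_real t)))"
proof -
  have "set_integrable lebesgue {0<..} (\<lambda>t. complex_of_real t powr (z - 1) / of_real (exp (Re p * t)))"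
    using absolutely_integrable_Gamma_integral[OF assms] .
  hence "integrable lebesgue (\<lambda>t. indicator {0<..} t *\<^sub>R (complex_of_real t powr (z - 1) / of_real (exp (Re p * t))))"
    unfolding set_integrable_def .
  hence "integrable lborel (\<lambda>t. indicator {0<..} t *\<^sub>R (complex_of_real t powr (z - 1) / of_real (exp (Re p * t))))"
    by (subst (asm) integrable_completion) (auto intro!: borel_measurable_continuous_on_indicator continuous_intros)
  hence B: "integrable lborel (\<lambda>t. indicator {0<..} t *\<^sub>R (complex_of_real t powr (z - 1) / of_real (exp (Re p * t))))" .
  have "(\<lambda>t. indicator {0<..} t *\<^sub>R (complex_of_real t powr (z - 1) * exp (- (p * of_real t)))) \<in> borel_measurable borel"
    by (intro borel_measurable_continuous_on_indicator continuous_intros) auto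
  thus ?thesis unfolding set_integrable_def
    by (intro Bochner_Integration.integrable_bound[OF B])
       (auto intro!: AE_I2 simp: norm_mult norm_divide norm_exp_eq_Re exp_minus field_simps indicator_def)
qed

lemma Gamma_kernel_integral_1:
  assumes "Re z > 0"
  shows "(LINT t:{0<..}|lborel. of_real t powr (z - 1) * exp (- of_real t)) = Gamma z"
proof -
  have "set_integrable lborel {0<..} (\<lambda>t. of_real t powr (z - 1) * exp (- (1 * of_real t)))"
    by (rule Gamma_kernel_integrable) (use assms in auto)
  hence "(LINT t:{0<..}|lborel. of_real t powr (z - 1) * exp (- (1 * of_real t))) =
     integral {0<..} (\<lambda>t. of_real t powr (z - 1) * exp (- (1 * of_real t)))"
    by (rule set_borel_integral_eq_integral)
  also have "\<dots> = Gamma z"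
    using Gamma_integral_complex'[OF assms]
    by (intro integral_unique) (simp add: exp_minus exp_of_real divide_inverse)
  finally show ?thesis by simp
qed

lemma Gamma_pochhammer:
  fixes z :: complex
  assumes "Re z > 0"
  shows "Gamma (z + of_nat n) = Gamma z * pochhammer z n"
proof -
  have "z \<notin> \<int>\<^sub>\<le>\<^sub>0" using assms by (auto elim!: nonpos_Ints_cases)
  thus ?thesis by (simp add: pochhammer_Gamma Gamma_eq_zero_iff)
qed

lemma Gamma_kernel_integral_near_1:
  assumes z: "Re z > 0" and p: "norm (1 - p) < 1"
  shows "(LINT t:{0<..}|lborel. of_real t powr (z - 1) * exp (- (p * of_real t))) = Gamma z * p powr (- z)"
proof -
  define F where "F = (\<lambda>n t. indicator {0<..} t *\<^sub>R
    ((1 - p) ^ n / fact n * (of_real t powr (z + of_nat n - 1) * exp (- of_real t))) :: complex)"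
  have F_eq: "F n t = indicator {0<..} t *\<^sub>R (of_real t powr (z - 1) * exp (- of_real t) * ((1 - p) * of_real t) ^ n / fact n)" for n t
  proof (cases "t > 0")
    case True
    have "complex_of_real t powr (z + of_nat n - 1) = of_real t powr (z - 1) * of_real t powr of_nat n"
      by (subst powr_add[symmetric]) (simp add: algebra_simps)
    also have "complex_of_real t powr of_nat n = of_real t ^ n"
      using True by (simp add: powr_nat')
    finally show ?thesis by (simp add: F_def power_mult_distrib)
  qed (auto simp: F_def)
  have int0: "set_integrable lborel {0<..} (\<lambda>t. complex_of_real t powr (z + of_nat n - 1) * exp (- of_real t))" for n
    using Gamma_kernel_integrable[of "z + of_nat n" 1] z by (simp add: add_pos_nonneg)
  have int: "integrable lborel (F n)" for n
    using int0[of n] unfolding F_def set_integrable_def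
    by (subst mult_scaleR_right[symmetric]) (intro integrable_mult_right, simp)
  have F_int: "integral\<^sup>L lborel (F n) = Gamma z * ((- z gchoose n) * (p - 1) ^ n)" for n
  proof -
    have "integral\<^sup>L lborel (F n) = (1 - p) ^ n / fact n * (LINT t:{0<..}|lborel. complex_of_real t powr (z + of_nat n - 1) * exp (- of_real t))"
      unfolding F_def set_lebesgue_integral_def
      by (simp only: mult_scaleR_right[symmetric] integral_mult_right_zero)
    also have "\<dots> = (1 - p) ^ n / fact n * (Gamma z * pochhammer z n)"
      using z by (subst Gamma_kernel_integral_1) (auto simp: Gamma_pochhammer add_pos_nonneg)
    also have "\<dots> = Gamma z * ((- z gchoose n) * (p - 1) ^ n)"
      by (simp add: gbinomial_pochhammer) (simp add: power_mult_distrib[symmetric] mult_ac)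
    finally show ?thesis .
  qed
  have nF_int: "(LINT t|lborel. norm (F n t)) =
      Re (Gamma (of_real (Re z)) * ((- of_real (Re z) gchoose n) * (- of_real (norm (1 - p))) ^ n))" for n
  proof -
    define x where "x = complex_of_real (Re z)"
    have x: "Re x > 0" using z by (simp add: x_def)
    have "complex_of_real (LINT t|lborel. norm (F n t)) = (LINT t|lborel. complex_of_real (norm (F n t)))"
      by simp
    also have "\<dots> = (LINT t|lborel. of_real (norm (1 - p)) ^ n / fact n * (indicator {0<..} t *\<^sub>R
        (of_real t powr (x + of_nat n - 1) * exp (- of_real t))))"
    proof (rule Bochner_Integration.integral_cong)
      fix t :: real
      show "complex_of_real (norm (F n t)) = of_real (norm (1 - p)) ^ n / fact n * (indicator {0<..} t *\<^sub>R
        (of_real t powr (x + of_nat n - 1) * exp (- of_real t)))"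
      proof (cases "t > 0")
        case True
        have 1: "norm (complex_of_real t powr (z + of_nat n - 1)) = t powr (Re z + n - 1)"
          using True by (simp add: norm_powr_real_powr)
        have 2: "complex_of_real t powr (x + of_nat n - 1) = of_real (t powr (Re z + n - 1))"
          unfolding x_def using True by (subst powr_of_real[symmetric]) auto
        have "norm (F n t) = norm (1 - p) ^ n / fact n * (t powr (Re z + n - 1) * exp (- t))"
          unfolding F_def using True by (simp add: norm_mult norm_divide norm_power 1 norm_exp_eq_Re)
        hence "complex_of_real (norm (F n t)) = of_real (norm (1 - p)) ^ n / fact n * (of_real (t powr (Re z + n - 1)) * exp (- of_real t))"
          by (simp add: exp_of_real[symmetric])
        thus ?thesis using True 2 by simp
      qed (simp add: F_def)
    qed simp
    also have "\<dots> = of_real (norm (1 - p)) ^ n / fact n * (LINT t:{0<..}|lborel. of_real t powr (x + of_nat n - 1) * exp (- of_real t))"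
      unfolding set_lebesgue_integral_def by (rule integral_mult_right_zero)
    also have "\<dots> = of_real (norm (1 - p)) ^ n / fact n * (Gamma x * pochhammer x n)"
      using x by (subst Gamma_kernel_integral_1) (auto simp: Gamma_pochhammer add_pos_nonneg)
    also have "\<dots> = Gamma x * ((- x gchoose n) * (- of_real (norm (1 - p))) ^ n)"
      by (simp add: gbinomial_pochhammer) (simp add: power_mult_distrib[symmetric] mult_ac)
    finally show ?thesis unfolding x_def by (metis Re_complex_of_real)
  qed
  have summ: "summable (\<lambda>n. LINT t|lborel. norm (F n t))"
  proof -
    have "(\<lambda>n. (- complex_of_real (Re z) gchoose n) * (- of_real (norm (1 - p))) ^ n) sums
        (1 + (- of_real (norm (1 - p)))) powr (- of_real (Re z))"
      by (rule gen_binomial_complex) (use p in simp)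
    from sums_Re[OF sums_mult[OF this]] show ?thesis
      unfolding nF_int by (rule sums_summable)
  qed
  have sumF: "(\<Sum>n. F n t) = indicator {0<..} t *\<^sub>R (of_real t powr (z - 1) * exp (- (p * of_real t)))"
    and sumnF: "summable (\<lambda>n. norm (F n t))" for t
  proof -
    have "(\<lambda>n. indicator {0<..} t *\<^sub>R (of_real t powr (z - 1) * exp (- of_real t) * (((1 - p) * of_real t) ^ n /\<^sub>R fact n)))
      sums (indicator {0<..} t *\<^sub>R (of_real t powr (z - 1) * exp (- of_real t) * exp ((1 - p) * of_real t)))"
      by (intro sums_scaleR_right sums_mult exp_converges)
    also have "(\<lambda>n. indicator {0<..} t *\<^sub>R (of_real t powr (z - 1) * exp (- of_real t) * (((1 - p) * of_real t) ^ n /\<^sub>R fact n))) = (\<lambda>n. F n t)"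
      by (auto simp: F_eq scaleR_conv_of_real fun_eq_iff divide_inverse)
    also have "exp (- of_real t) * exp ((1 - p) * of_real t) = exp (- (p * of_real t))"
      by (simp add: exp_add[symmetric] algebra_simps)
    hence "of_real t powr (z - 1) * exp (- of_real t) * exp ((1 - p) * of_real t) = of_real t powr (z - 1) * exp (- (p * of_real t))"
      by (simp add: mult.assoc)
    finally show "(\<Sum>n. F n t) = indicator {0<..} t *\<^sub>R (of_real t powr (z - 1) * exp (- (p * of_real t)))"
      by (simp add: sums_iff)
    have "summable (\<lambda>n. norm (indicator {0<..} t *\<^sub>R (of_real t powr (z - 1) * exp (- complex_of_real t))) * (norm (((1 - p) * of_real t) ^ n /\<^sub>R fact n)))"
      by (intro summable_mult summable_norm_exp)
    also have "(\<lambda>n. norm (indicator {0<..} t *\<^sub>R (of_real t powr (z - 1) * exp (- complex_of_real t))) * (norm (((1 - p) * of_real t) ^ n /\<^sub>R fact n))) = (\<lambda>n. norm (F n t))"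
      by (auto simp: F_eq norm_mult norm_divide fun_eq_iff divide_inverse norm_inverse)
    finally show "summable (\<lambda>n. norm (F n t))" .
  qed
  have "(\<lambda>n. integral\<^sup>L lborel (F n)) sums (\<integral>t. (\<Sum>n. F n t) \<partial>lborel)"
    by (rule sums_integral[OF int _ summ]) (use sumnF in auto)
  hence "(\<lambda>n. Gamma z * ((- z gchoose n) * (p - 1) ^ n)) sums
      (LINT t:{0<..}|lborel. of_real t powr (z - 1) * exp (- (p * of_real t)))"
    by (simp add: F_int sumF set_lebesgue_integral_def)
  moreover have "(\<lambda>n. Gamma z * ((- z gchoose n) * (p - 1) ^ n)) sums (Gamma z * (1 + (p - 1)) powr (- z))"
    by (intro sums_mult gen_binomial_complex) (use p in \<open>simp add: norm_minus_commute\<close>)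
  ultimately show ?thesis by (simp add: sums_iff)
qed

lemma Gamma_kernel_integral:
  assumes z: "Re z > 0" and p: "Re p > 0"
  shows "(LINT t:{0<..}|lborel. of_real t powr (z - 1) * exp (- (p * of_real t))) = Gamma z * p powr (- z)"
proof -
  define r where "r = Re p / (norm p)\<^sup>2"
  have p0: "p \<noteq> 0" using p by auto
  have r: "r > 0" using p p0 by (simp add: r_def)
  have "(norm (1 - of_real r * p))\<^sup>2 = 1 - 2 * r * Re p + r\<^sup>2 * (norm p)\<^sup>2"
    unfolding cmod_power2 by (simp add: power2_eq_square algebra_simps)
  also have "\<dots> = 1 - (Re p)\<^sup>2 / (norm p)\<^sup>2"
    using p0 by (simp add: r_def power2_eq_square field_simps)
  also have "\<dots> < 1" using p p0 by simp
  finally have n1: "norm (1 - of_real r * p) < 1"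
    by (metis norm_ge_zero one_power2 power2_less_imp_less zero_le_one)
  have "(LINT t:{0<..}|lborel. of_real t powr (z - 1) * exp (- (p * of_real t))) =
     \<bar>r\<bar> *\<^sub>R (LINT t|lborel. indicator {0<..} (0 + r * t) *\<^sub>R (of_real (0 + r * t) powr (z - 1) * exp (- (p * of_real (0 + r * t)))))"
    unfolding set_lebesgue_integral_def by (rule lborel_integral_real_affine) (use r in simp)
  also have "(\<lambda>t. indicator {0<..} (0 + r * t) *\<^sub>R (of_real (0 + r * t) powr (z - 1) * exp (- (p * of_real (0 + r * t))))) =
     (\<lambda>t. of_real r powr (z - 1) * (indicator {0<..} t *\<^sub>R (of_real t powr (z - 1) * exp (- ((of_real r * p) * of_real t)))))"
  proof
    fix t :: real
    show "indicator {0<..} (0 + r * t) *\<^sub>R (of_real (0 + r * t) powr (z - 1) * exp (- (p * of_real (0 + r * t)))) =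
       of_real r powr (z - 1) * (indicator {0<..} t *\<^sub>R (of_real t powr (z - 1) * exp (- ((of_real r * p) * of_real t))))"
    proof (cases "t > 0")
      case True
      thus ?thesis using r by (simp add: powr_times_real algebra_simps)
    next
      case False
      hence "\<not> (r * t > 0)" using r by (simp add: zero_less_mult_iff)
      thus ?thesis using False by simp
    qed
  qed
  also have "\<bar>r\<bar> *\<^sub>R (LINT t|lborel. of_real r powr (z - 1) * (indicator {0<..} t *\<^sub>R (of_real t powr (z - 1) * exp (- ((of_real r * p) * of_real t))))) =
     of_real r * of_real r powr (z - 1) * (LINT t:{0<..}|lborel. of_real t powr (z - 1) * exp (- ((of_real r * p) * of_real t)))"
    using r by (simp add: set_lebesgue_integral_def scaleR_conv_of_real)
  also have "\<dots> = of_real r * of_real r powr (z - 1) * (Gamma z * (of_real r * p) powr (- z))"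
    by (subst Gamma_kernel_integral_near_1[OF z n1]) simp
  also have "of_real r * complex_of_real r powr (z - 1) = of_real r powr z"
    using r by (simp add: powr_diff)
  also have "(of_real r * p) powr (- z) = of_real r powr (- z) * p powr (- z)"
    using r by (simp add: powr_times_real_left)
  also have "of_real r powr z * (Gamma z * (of_real r powr (- z) * p powr (- z))) =
     (of_real r powr z * of_real r powr (- z)) * (Gamma z * p powr (- z))" by simp
  also have "of_real r powr z * complex_of_real r powr (- z) = 1"
    using r by (simp add: powr_minus)
  finally show ?thesis by simp
qed

lemma norm_exp_diff_le:
  fixes a b :: complex
  assumes "Re a \<le> M" "Re b \<le> M"
  shows "norm (exp a - exp b) \<le> exp M * norm (a - b)"
proof (rule field_differentiable_bound[where S = "{w. Re w \<le> M}" and f' = exp])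
  show "convex {w. Re w \<le> M}" by (rule convex_halfspace_Re_le)
qed (use assms in \<open>auto intro!: derivative_eq_intros\<close>)

lemma powr_exp_diff_bound:
  assumes "t > 0" "0 \<le> Re z" "Re z \<le> 1" "m \<le> Re p" "m \<le> Re q"
  shows "norm (of_real t powr (z - 1) * (exp (- (p * of_real t)) - exp (- (q * of_real t))))
    \<le> norm (p - q) * ((1 + t) * exp (- (m * t)))"
proof -
  have "t powr (Re z - 1) = t powr Re z / t"
    using assms by (simp add: powr_diff)
  also have "t powr Re z \<le> 1 + t"
  proof (cases "t \<le> 1")
    case True
    hence "t powr Re z \<le> 1" using assms by (simp add: powr_le1)
    thus ?thesis using assms by linarith
  next
    case False
    hence "t powr Re z \<le> t powr 1" using assms by (intro powr_mono) auto
    thus ?thesis using assms by simp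
  qed
  hence "t powr Re z / t \<le> (1 + t) / t" using assms by (simp add: divide_right_mono)
  finally have 1: "norm (complex_of_real t powr (z - 1)) \<le> (1 + t) / t"
    using assms by (simp add: norm_powr_real_powr)
  have "norm (exp (- (p * of_real t)) - exp (- (q * of_real t))) \<le> exp (- (m * t)) * norm (- (p * of_real t) - - (q * of_real t))"
    using assms by (intro norm_exp_diff_le) auto
  also have "norm (- (p * of_real t) - - (q * of_real t)) = norm (p - q) * t"
    using assms by (simp add: norm_mult norm_minus_commute flip: left_diff_distrib minus_diff_eq[of "p * of_real t"])
  finally have 2: "norm (exp (- (p * of_real t)) - exp (- (q * of_real t))) \<le> exp (- (m * t)) * (norm (p - q) * t)" .
  have "norm (of_real t powr (z - 1) * (exp (- (p * of_real t)) - exp (- (q * of_real t)))) \<le> (1 + t) / t * (exp (- (m * t)) * (norm (p - q) * t))"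
    unfolding norm_mult by (intro mult_mono 1 2) (use assms in auto)
  also have "\<dots> = norm (p - q) * ((1 + t) * exp (- (m * t)))" using assms by simp
  finally show ?thesis .
qed

lemma linear_exp_integrable:
  fixes m :: real
  assumes "m > 0"
  shows "integrable lborel (\<lambda>t. indicator {0<..} t * ((1 + t) * exp (- (m * t))))"
proof -
  have "integrable lborel (\<lambda>t. norm (indicator {0<..} t *\<^sub>R (complex_of_real t powr (1 - 1) * exp (- (of_real m * of_real t))))
     + norm (indicator {0<..} t *\<^sub>R (complex_of_real t powr (2 - 1) * exp (- (of_real m * of_real t)))))"
    using Gamma_kernel_integrable[of 1 "of_real m"] Gamma_kernel_integrable[of 2 "of_real m"] assms
    unfolding set_integrable_def by (intro Bochner_Integration.integrable_add integrable_norm) simp_all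
  also have "(\<lambda>t. norm (indicator {0<..} t *\<^sub>R (complex_of_real t powr (1 - 1) * exp (- (of_real m * of_real t))))
     + norm (indicator {0<..} t *\<^sub>R (complex_of_real t powr (2 - 1) * exp (- (of_real m * of_real t))))) =
     (\<lambda>t. indicator {0<..} t * ((1 + t) * exp (- (m * t))))"
    by (auto simp: fun_eq_iff indicator_def norm_mult algebra_simps norm_exp_eq_Re)
  finally show ?thesis .
qed

lemma
  fixes z p q :: complex
  assumes z: "Re z = 0" and p: "Re p > 0" and q: "Re q > 0"
  defines "F \<equiv> (\<lambda>t. of_real t powr (z - 1) * (exp (- (p * of_real t)) - exp (- (q * of_real t))))"
  shows exp_diff_kernel_integrable: "set_integrable lborel {0<..} F" (is ?A)
    and exp_diff_kernel_integral: "(LINT t:{0<..}|lborel. F t) =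
          (if z = 0 then Ln q - Ln p else Gamma z * (p powr (- z) - q powr (- z)))" (is ?B)
proof -
  define m where "m = min (Re p) (Re q)"
  have m: "m > 0" "m \<le> Re p" "m \<le> Re q" using p q by (auto simp: m_def)
  define \<delta> where "\<delta> = (\<lambda>n. inverse (real (Suc n)))"
  have \<delta>: "\<delta> n > 0" "\<delta> n \<le> 1" for n unfolding \<delta>_def by (auto simp: inverse_le_1_iff)
  have \<delta>_lim: "\<delta> \<longlonglongrightarrow> 0" unfolding \<delta>_def by (rule LIMSEQ_inverse_real_of_nat)
  define E where "E = (\<lambda>t::real. exp (- (p * of_real t)) - exp (- (q * of_real t)))"
  have F_eq: "F = (\<lambda>t. of_real t powr (z - 1) * E t)" by (simp add: F_def E_def)
  define w where "w = (\<lambda>t. indicator {0<..} t * (norm (p - q) * ((1 + t) * exp (- (m * t)))))"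
  have w: "integrable lborel w"
  proof -
    have "w = (\<lambda>t. norm (p - q) * (indicator {0<..} t * ((1 + t) * exp (- (m * t)))))"
      by (auto simp: w_def fun_eq_iff)
    thus ?thesis using linear_exp_integrable[OF m(1)] by simp
  qed
  have meas: "(\<lambda>t. indicator {0<..} t *\<^sub>R (of_real t powr y * E t)) \<in> borel_measurable borel" for y
    unfolding E_def by (intro borel_measurable_continuous_on_indicator continuous_intros) auto
  have conv: "(\<lambda>n. of_real t powr (z + of_real (\<delta> n) - 1) * E t) \<longlonglongrightarrow> of_real t powr (z - 1) * E t" if "t > 0" for t
  proof -
    have "(\<lambda>n. exp ((z + of_real (\<delta> n) - 1) * Ln (of_real t)) * E t) \<longlonglongrightarrow> exp ((z + of_real 0 - 1) * Ln (of_real t)) * E t"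
      by (intro tendsto_intros \<delta>_lim)
    thus ?thesis using that by (simp add: powr_def)
  qed
  have dom: "norm (indicator {0<..} t *\<^sub>R (of_real t powr (z + of_real (\<delta> n) - 1) * E t)) \<le> w t" for n t
    using powr_exp_diff_bound[of t "z + of_real (\<delta> n)" m p q] \<delta>[of n] z m
    by (cases "t > 0") (auto simp: w_def E_def)
  have conv': "AE t in lborel. (\<lambda>n. indicator {0<..} t *\<^sub>R (of_real t powr (z + of_real (\<delta> n) - 1) * E t))
      \<longlonglongrightarrow> indicator {0<..} t *\<^sub>R (of_real t powr (z - 1) * E t)"
    by (intro AE_I2) (auto simp: indicator_def conv)
  have dom': "AE t in lborel. norm (indicator {0<..} t *\<^sub>R (of_real t powr (z + of_real (\<delta> n) - 1) * E t)) \<le> w t" for n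
    using dom by simp
  have meas': "(\<lambda>t. indicator {0<..} t *\<^sub>R (of_real t powr y * E t)) \<in> borel_measurable lborel" for y
    using meas by simp
  show ?A
    unfolding set_integrable_def F_eq
    by (rule integrable_dominated_convergence[OF meas' meas' w conv' dom'])
  have lim1: "(\<lambda>n. integral\<^sup>L lborel (\<lambda>t. indicator {0<..} t *\<^sub>R (of_real t powr (z + of_real (\<delta> n) - 1) * E t)))
     \<longlonglongrightarrow> integral\<^sup>L lborel (\<lambda>t. indicator {0<..} t *\<^sub>R (of_real t powr (z - 1) * E t))"
    by (rule integral_dominated_convergence[OF meas' meas' w conv' dom'])
  have val: "integral\<^sup>L lborel (\<lambda>t. indicator {0<..} t *\<^sub>R (of_real t powr (z + of_real (\<delta> n) - 1) * E t)) =
     Gamma (z + of_real (\<delta> n)) * (p powr (- (z + of_real (\<delta> n))) - q powr (- (z + of_real (\<delta> n))))" for n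
  proof -
    have pos: "Re (z + of_real (\<delta> n)) > 0" using z \<delta> by simp
    have "integral\<^sup>L lborel (\<lambda>t. indicator {0<..} t *\<^sub>R (of_real t powr (z + of_real (\<delta> n) - 1) * E t)) =
      (LINT t:{0<..}|lborel. of_real t powr (z + of_real (\<delta> n) - 1) * exp (- (p * of_real t)) - of_real t powr (z + of_real (\<delta> n) - 1) * exp (- (q * of_real t)))"
      unfolding set_lebesgue_integral_def E_def by (simp only: right_diff_distrib)
    also have "\<dots> = Gamma (z + of_real (\<delta> n)) * p powr (- (z + of_real (\<delta> n))) - Gamma (z + of_real (\<delta> n)) * q powr (- (z + of_real (\<delta> n)))"
      by (subst set_integral_diff(2)[OF Gamma_kernel_integrable[OF pos p] Gamma_kernel_integrable[OF pos q]])
         (simp only: Gamma_kernel_integral[OF pos p] Gamma_kernel_integral[OF pos q])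
    finally show ?thesis by (simp only: right_diff_distrib)
  qed
  have nz: "p \<noteq> 0" "q \<noteq> 0" using p q by auto
  have \<delta>_lim': "(\<lambda>n. complex_of_real (\<delta> n)) \<longlonglongrightarrow> 0"
    using tendsto_of_real[OF \<delta>_lim] by simp
  have lim2: "(\<lambda>n. Gamma (z + of_real (\<delta> n)) * (p powr (- (z + of_real (\<delta> n))) - q powr (- (z + of_real (\<delta> n)))))
     \<longlonglongrightarrow> (if z = 0 then Ln q - Ln p else Gamma z * (p powr (- z) - q powr (- z)))"
  proof (cases "z = 0")
    case False
    have "z \<notin> \<int>\<^sub>\<le>\<^sub>0" using False z by (auto elim!: nonpos_Ints_cases simp: complex_eq_iff)
    hence "(\<lambda>n. Gamma (z + of_real (\<delta> n)) * (exp (- (z + of_real (\<delta> n)) * Ln p) - exp (- (z + of_real (\<delta> n)) * Ln q)))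
       \<longlonglongrightarrow> Gamma (z + 0) * (exp (- (z + 0) * Ln p) - exp (- (z + 0) * Ln q))"
      by (intro tendsto_intros \<delta>_lim') auto
    thus ?thesis using nz False by (simp add: powr_def)
  next
    case True
    define g where "g = (\<lambda>x::complex. exp (- x * Ln p) - exp (- x * Ln q))"
    have "(g has_field_derivative (Ln q - Ln p)) (at 0)"
      unfolding g_def by (auto intro!: derivative_eq_intros)
    hence "((\<lambda>h. g h / h) \<longlongrightarrow> (Ln q - Ln p)) (at 0)"
      by (simp add: DERIV_def g_def)
    moreover have "filterlim (\<lambda>n. complex_of_real (\<delta> n)) (at 0) sequentially"
      using \<delta>_lim' \<delta> by (intro filterlim_atI) (auto simp: less_imp_neq[OF \<delta>(1), symmetric])
    ultimately have "(\<lambda>n. g (of_real (\<delta> n)) / of_real (\<delta> n)) \<longlonglongrightarrow> (Ln q - Ln p)"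
      by (rule filterlim_compose)
    moreover have "(\<lambda>n. Gamma (of_real (\<delta> n) + 1)) \<longlonglongrightarrow> Gamma (0 + 1 :: complex)"
      by (intro tendsto_intros \<delta>_lim') (auto simp: )
    ultimately have "(\<lambda>n. Gamma (of_real (\<delta> n) + 1) * (g (of_real (\<delta> n)) / of_real (\<delta> n))) \<longlonglongrightarrow> Gamma (0 + 1) * (Ln q - Ln p)"
      by (intro tendsto_mult)
    moreover have "Gamma (of_real (\<delta> n) + 1) * (g (of_real (\<delta> n)) / of_real (\<delta> n)) =
       Gamma (z + of_real (\<delta> n)) * (p powr (- (z + of_real (\<delta> n))) - q powr (- (z + of_real (\<delta> n))))" for n
    proof -
      have "complex_of_real (\<delta> n) \<notin> \<int>\<^sub>\<le>\<^sub>0" using \<delta>(1)[of n] by (auto elim!: nonpos_Ints_cases simp: complex_eq_iff)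
      hence "Gamma (complex_of_real (\<delta> n) + 1) = of_real (\<delta> n) * Gamma (of_real (\<delta> n))"
        by (rule Gamma_plus1)
      thus ?thesis using \<delta>(1)[of n] nz True by (simp add: g_def powr_def)
    qed
    ultimately show ?thesis using True by simp
  qed
  show ?B
    unfolding set_lebesgue_integral_def F_eq
    using LIMSEQ_unique[OF lim1[unfolded val] lim2] .
qed

subsection \<open>Fourier series at a point\<close>

lemma has_sum_int_nat:
  fixes a :: "int \<Rightarrow> 'a::banach"
  assumes "(\<lambda>k. norm (a k)) summable_on UNIV"
  shows "(\<lambda>n. a (int n) + a (- 1 - int n)) sums infsum a UNIV"
proof -
  have a: "a summable_on UNIV" using assms by (rule abs_summable_summable)
  have inj1: "inj int" and inj2: "inj (\<lambda>n. - 1 - int n)" by (auto simp: inj_on_def)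
  have U: "(UNIV :: int set) = range int \<union> range (\<lambda>n. - 1 - int n)"
  proof (intro equalityI subsetI)
    fix k :: int
    show "k \<in> range int \<union> range (\<lambda>n. - 1 - int n)"
    proof (cases "k \<ge> 0")
      case True
      hence "k = int (nat k)" by simp
      thus ?thesis by blast
    next
      case False
      hence "k = - 1 - int (nat (- k - 1))" by simp
      thus ?thesis by blast
    qed
  qed auto
  have D: "range int \<inter> range (\<lambda>n. - 1 - int n) = {}" by auto
  have s1: "((\<lambda>n. a (int n)) has_sum infsum a (range int)) UNIV"
    using has_sum_infsum[OF summable_on_subset_banach[OF a, of "range int"]] has_sum_reindex[OF inj1] by (auto simp: o_def)
  have s2: "((\<lambda>n. a (- 1 - int n)) has_sum infsum a (range (\<lambda>n. - 1 - int n))) UNIV"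
    using has_sum_infsum[OF summable_on_subset_banach[OF a, of "range (\<lambda>n. - 1 - int n)"]] has_sum_reindex[OF inj2] by (auto simp: o_def)
  have "infsum a UNIV = infsum a (range int) + infsum a (range (\<lambda>n. - 1 - int n))"
    by (subst U, rule infsum_Un_disjoint[OF _ _ D]) (auto intro: summable_on_subset_banach[OF a])
  thus ?thesis
    using sums_add[OF has_sum_imp_sums[OF s1] has_sum_imp_sums[OF s2]] by simp
qed

context
  fixes L :: real
  assumes L: "L > 0"
begin

definition unit_circ :: "real \<Rightarrow> complex" where
  "unit_circ v = exp (\<i> * of_real (2 * pi / L) * of_real v)"

definition fcoeff :: "(real \<Rightarrow> complex) \<Rightarrow> int \<Rightarrow> complex" where
  "fcoeff D k = (LINT v:{0..L}|lborel. D v * exp (- \<i> * of_int k * of_real (2 * pi / L) * of_real v)) / of_real L"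

definition poisson_kernel :: "real \<Rightarrow> real \<Rightarrow> complex" where
  "poisson_kernel r v = of_real ((1 - r\<^sup>2) / (norm (1 - of_real r * unit_circ v))\<^sup>2)"

lemma norm_unit_circ [simp]: "norm (unit_circ v) = 1"
  by (simp add: unit_circ_def norm_exp_eq_Re)

lemma continuous_on_unit_circ: "continuous_on A unit_circ"
  unfolding unit_circ_def by (intro continuous_intros)

lemma exp_eq_unit_circ:
  "exp (- \<i> * of_int (int n) * of_real (2 * pi / L) * of_real v) = cnj (unit_circ v) ^ n"
  "exp (- \<i> * of_int (- 1 - int n) * of_real (2 * pi / L) * of_real v) = unit_circ v ^ Suc n"
proof -
  have "cnj (unit_circ v) = exp (- \<i> * of_real (2 * pi / L) * of_real v)"
    unfolding unit_circ_def exp_cnj by simp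
  hence "cnj (unit_circ v) ^ n = exp (of_nat n * (- \<i> * of_real (2 * pi / L) * of_real v))"
    by (simp only: exp_of_nat_mult)
  thus "exp (- \<i> * of_int (int n) * of_real (2 * pi / L) * of_real v) = cnj (unit_circ v) ^ n"
    by (simp add: mult_ac)
  show "exp (- \<i> * of_int (- 1 - int n) * of_real (2 * pi / L) * of_real v) = unit_circ v ^ Suc n"
    unfolding unit_circ_def exp_of_nat_mult[symmetric] by (simp add: algebra_simps)
qed

lemma poisson_kernel_sums:
  assumes r: "0 \<le> r" "r < 1"
  shows "(\<lambda>n. of_real r ^ n * cnj (unit_circ v) ^ n + of_real r ^ Suc n * unit_circ v ^ Suc n) sums poisson_kernel r v"
proof -
  define e where "e = unit_circ v"
  have e: "norm e = 1" by (simp add: e_def)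
  have ee: "e * cnj e = 1" using e by (simp add: complex_norm_square[symmetric])
  have n: "norm (of_real r * e) < 1" "norm (of_real r * cnj e) < 1" using r e by (auto simp: norm_mult)
  have nz: "1 - of_real r * e \<noteq> 0" "1 - of_real r * cnj e \<noteq> 0" using n by auto
  have "(\<lambda>n. (of_real r * cnj e) ^ n + of_real r * e * (of_real r * e) ^ n) sums
      (1 / (1 - of_real r * cnj e) + of_real r * e * (1 / (1 - of_real r * e)))"
    by (intro sums_add sums_mult geometric_sums n)
  also have "1 / (1 - of_real r * cnj e) + of_real r * e * (1 / (1 - of_real r * e)) =
     (1 - of_real r ^ 2 * (e * cnj e)) / ((1 - of_real r * e) * cnj (1 - of_real r * e))"
  proof -
    have "1 / (1 - y) + x * (1 / (1 - x)) = (1 - x * y) / ((1 - x) * (1 - y))" if "1 - x \<noteq> 0" "1 - y \<noteq> 0" for x y :: complex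
      using that by (simp add: field_simps)
    moreover have "of_real r * e * (of_real r * cnj e) = of_real r ^ 2 * (e * cnj e)"
      by (simp only: power2_eq_square mult_ac)
    moreover have "cnj (1 - of_real r * e) = 1 - of_real r * cnj e" by simp
    ultimately show ?thesis using nz by metis
  qed
  also have "\<dots> = poisson_kernel r v"
    unfolding ee poisson_kernel_def e_def[symmetric] complex_norm_square[symmetric] by (simp add: e)
  finally show ?thesis by (simp add: e_def power_mult_distrib mult_ac)
qed

lemma continuous_on_poisson_kernel:
  assumes r: "0 \<le> r" "r < 1"
  shows "continuous_on A (poisson_kernel r)"
proof -
  have "1 - of_real r * unit_circ v \<noteq> 0" for v
  proof
    assume "1 - of_real r * unit_circ v = 0"
    hence "norm (of_real r * unit_circ v) = 1" by (metis norm_one right_minus_eq)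
    thus False using r by (simp add: norm_mult)
  qed
  thus ?thesis unfolding poisson_kernel_def
    by (intro continuous_intros continuous_on_unit_circ) auto
qed

lemma abel_mean_fcoeff:
  assumes D: "continuous_on {0..L} D" and r: "0 \<le> r" "r < 1"
  shows "(\<lambda>n. of_real r ^ n * fcoeff D (int n) + of_real r ^ Suc n * fcoeff D (- 1 - int n)) sums
     ((LINT v:{0..L}|lborel. D v * poisson_kernel r v) / of_real L)"
proof -
  have "\<exists>B. \<forall>v\<in>{0..L}. norm (D v) \<le> B"
    using compact_imp_bounded[OF compact_continuous_image[OF D compact_Icc]] unfolding bounded_iff by auto
  then obtain B where B: "\<And>v. v \<in> {0..L} \<Longrightarrow> norm (D v) \<le> B" by blast
  define F where "F = (\<lambda>n v. indicator {0..L} v *\<^sub>R (D v * (of_real r ^ n * cnj (unit_circ v) ^ n + of_real r ^ Suc n * unit_circ v ^ Suc n)))"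
  have int_gen: "set_integrable lborel {0..L} (\<lambda>v. D v * g v)" if "continuous_on {0..L} g" for g :: "real \<Rightarrow> complex"
    by (intro borel_integrable_atLeastAtMost' continuous_intros D that)
  have int: "integrable lborel (F n)" for n
    using int_gen[of "\<lambda>v. of_real r ^ n * cnj (unit_circ v) ^ n + of_real r ^ Suc n * unit_circ v ^ Suc n"]
    unfolding F_def set_integrable_def by (simp add: continuous_intros continuous_on_unit_circ)
  have bound: "norm (F n v) \<le> indicator {0..L} v * (2 * B * r ^ n)" for n v
  proof (cases "v \<in> {0..L}")
    case True
    have B0: "B \<ge> 0" using norm_ge_zero[of "D v"] B[OF True] by linarith
    have "norm (of_real r ^ n * cnj (unit_circ v) ^ n + of_real r ^ Suc n * unit_circ v ^ Suc n) \<le> r ^ n + r ^ Suc n"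
      using r by (intro norm_triangle_le) (auto simp: norm_mult norm_power)
    also have "\<dots> \<le> 2 * r ^ n"
      using r mult_right_mono[of r 1 "r ^ n"] by simp
    finally have "norm (F n v) \<le> B * (2 * r ^ n)"
      using True B[OF True] B0 unfolding F_def by (simp add: norm_mult mult_mono)
    thus ?thesis using True by simp
  qed (simp add: F_def)
  have summ: "summable (\<lambda>n. LINT v|lborel. norm (F n v))"
  proof (rule summable_comparison_test_ev[OF always_eventually])
    show "\<forall>n. norm (LINT v|lborel. norm (F n v)) \<le> 2 * B * L * r ^ n"
    proof
      fix n
      have "(LINT v|lborel. norm (F n v)) \<le> (LINT v|lborel. indicator {0..L} v * (2 * B * r ^ n))"
        by (intro integral_mono integrable_norm int bound) (intro integrable_mult_left integrable_real_indicator, auto simp: emeasure_lborel_Icc_eq)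
      also have "\<dots> = 2 * B * L * r ^ n" using L by simp
      finally show "norm (LINT v|lborel. norm (F n v)) \<le> 2 * B * L * r ^ n"
        by (simp add: integral_nonneg_AE)
    qed
    show "summable (\<lambda>n. 2 * B * L * r ^ n)" using r by (intro summable_mult summable_geometric) auto
  qed
  have sumF: "(\<lambda>n. F n v) sums (indicator {0..L} v *\<^sub>R (D v * poisson_kernel r v))" for v
    unfolding F_def by (intro sums_scaleR_right sums_mult poisson_kernel_sums r)
  have sumnF: "summable (\<lambda>n. norm (F n v))" for v
    by (rule summable_comparison_test_ev[OF always_eventually, of _ "\<lambda>n. indicator {0..L} v * (2 * B * r ^ n)"])
       (use bound r in \<open>auto intro!: summable_mult summable_geometric\<close>)
  have "(\<lambda>n. integral\<^sup>L lborel (F n)) sums (\<integral>v. (\<Sum>n. F n v) \<partial>lborel)"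
    by (rule sums_integral[OF int _ summ]) (use sumnF in auto)
  hence *: "(\<lambda>n. integral\<^sup>L lborel (F n) / of_real L) sums ((LINT v:{0..L}|lborel. D v * poisson_kernel r v) / of_real L)"
    unfolding set_lebesgue_integral_def by (intro sums_divide) (simp add: sums_unique[OF sumF, symmetric])
  have "integral\<^sup>L lborel (F n) / of_real L = of_real r ^ n * fcoeff D (int n) + of_real r ^ Suc n * fcoeff D (- 1 - int n)" for n
  proof -
    have "integral\<^sup>L lborel (F n) = (LINT v:{0..L}|lborel. of_real r ^ n * (D v * cnj (unit_circ v) ^ n) + of_real r ^ Suc n * (D v * unit_circ v ^ Suc n))"
      unfolding set_lebesgue_integral_def F_def by (simp add: algebra_simps)
    also have "\<dots> = of_real r ^ n * (LINT v:{0..L}|lborel. D v * cnj (unit_circ v) ^ n) + of_real r ^ Suc n * (LINT v:{0..L}|lborel. D v * unit_circ v ^ Suc n)"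
      by (subst set_integral_add(2))
         (auto intro!: set_integrable_mult_right int_gen continuous_intros continuous_on_unit_circ simp del: power_Suc)
    finally show ?thesis
      unfolding fcoeff_def exp_eq_unit_circ by (simp add: add_divide_distrib)
  qed
  with * show ?thesis by simp
qed

lemma fcoeff_1: "fcoeff (\<lambda>_. 1) k = (if k = 0 then 1 else 0)"
proof (cases "k = 0")
  case True
  thus ?thesis using L unfolding fcoeff_def set_lebesgue_integral_def by (simp add: scaleR_conv_of_real)
next
  case False
  define w where "w = - \<i> * of_int k * of_real (2 * pi / L)"
  have w: "w \<noteq> 0" using False L by (simp add: w_def)
  have "((\<lambda>v. exp (w * of_real v)) has_integral (exp (w * of_real L) / w - exp (w * of_real 0) / w)) {0..L}"
  proof (rule fundamental_theorem_of_calculus)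
    fix x
    have "((\<lambda>z. exp (w * z) / w) has_field_derivative exp (w * of_real x)) (at (of_real x))"
      using w by (auto intro!: derivative_eq_intros)
    hence "((\<lambda>v. exp (w * of_real v) / w) has_vector_derivative exp (w * of_real x)) (at x)"
      by (rule has_vector_derivative_real_field)
    thus "((\<lambda>v. exp (w * of_real v) / w) has_vector_derivative exp (w * of_real x)) (at x within {0..L})"
      by (rule has_vector_derivative_at_within)
  qed (use L in auto)
  moreover have "exp (w * of_real L) = 1"
  proof -
    have "w * of_real L = - (of_int k * (of_real (2 * pi) * \<i>))" using L by (simp add: w_def)
    thus ?thesis by (auto simp: exp_eq_1 intro!: exI[of _ "- k"])
  qed
  ultimately have "integral {0..L} (\<lambda>v. exp (w * of_real v)) = 0"
    by (intro integral_unique) simp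
  moreover have "set_integrable lborel {0..L} (\<lambda>v. exp (w * of_real v))"
    by (intro borel_integrable_atLeastAtMost' continuous_intros)
  ultimately have "(LINT v:{0..L}|lborel. exp (w * of_real v)) = 0"
    by (simp add: set_borel_integral_eq_integral)
  thus ?thesis using False unfolding fcoeff_def w_def by simp
qed

lemma poisson_kernel_integral:
  assumes r: "0 \<le> r" "r < 1"
  shows "(LINT v:{0..L}|lborel. poisson_kernel r v) = of_real L"
proof -
  have "(\<lambda>n. of_real r ^ n * fcoeff (\<lambda>_. 1) (int n) + of_real r ^ Suc n * fcoeff (\<lambda>_. 1) (- 1 - int n)) sums
     ((LINT v:{0..L}|lborel. 1 * poisson_kernel r v) / of_real L)"
    by (rule abel_mean_fcoeff) (use r in auto)
  moreover have "(\<lambda>n. of_real r ^ n * fcoeff (\<lambda>_. 1) (int n) + of_real r ^ Suc n * fcoeff (\<lambda>_. 1) (- 1 - int n)) = (\<lambda>n. if n = 0 then 1 else 0)"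
    by (auto simp: fcoeff_1 fun_eq_iff)
  moreover have "(\<lambda>n. if n = 0 then 1 else 0) sums (1::complex)"
    using sums_single[of 0 "\<lambda>_. 1::complex"] by simp
  ultimately have "(LINT v:{0..L}|lborel. poisson_kernel r v) / of_real L = 1"
    by (simp add: sums_iff)
  thus ?thesis using L by simp
qed

lemma modulus_bound:
  fixes D :: "real \<Rightarrow> complex"
  assumes D: "continuous_on {0..L} D" "D L = D 0" and \<epsilon>: "\<epsilon> > 0"
  obtains C where "C \<ge> 0" "\<And>v. v \<in> {0..L} \<Longrightarrow> norm (D v - D 0) \<le> \<epsilon> + C * (norm (1 - unit_circ v))\<^sup>2"
proof -
  have "\<exists>B. \<forall>v\<in>{0..L}. norm (D v) \<le> B"
    using compact_imp_bounded[OF compact_continuous_image[OF D(1) compact_Icc]] unfolding bounded_iff by auto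
  then obtain B where B: "\<And>v. v \<in> {0..L} \<Longrightarrow> norm (D v) \<le> B" by blast
  obtain \<delta>1 where \<delta>1: "\<delta>1 > 0" "\<And>v. v \<in> {0..L} \<Longrightarrow> dist v 0 < \<delta>1 \<Longrightarrow> dist (D v) (D 0) < \<epsilon>"
    using D(1) \<epsilon> L unfolding continuous_on_iff by (metis atLeastAtMost_iff less_eq_real_def order_refl)
  obtain \<delta>2 where \<delta>2: "\<delta>2 > 0" "\<And>v. v \<in> {0..L} \<Longrightarrow> dist v L < \<delta>2 \<Longrightarrow> dist (D v) (D L) < \<epsilon>"
    using D(1) \<epsilon> L unfolding continuous_on_iff by (metis atLeastAtMost_iff less_eq_real_def order_refl)
  define K where "K = {min \<delta>1 \<delta>2..L - min \<delta>1 \<delta>2}"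
  have pos: "norm (1 - unit_circ v) > 0" if "v \<in> K" for v
  proof -
    have v: "0 < v" "v < L" using that \<delta>1(1) \<delta>2(1) by (auto simp: K_def)
    have "unit_circ v \<noteq> 1"
    proof
      assume "unit_circ v = 1"
      hence "exp (\<i> * of_real (2 * pi / L * v)) = 1" by (simp add: unit_circ_def mult.assoc)
      then obtain n :: int where "2 * pi / L * v = of_int (2 * n) * pi" by (auto simp: exp_eq_1)
      hence "v = of_int n * L" using L by (simp add: field_simps)
      hence "0 < of_int n * L" "of_int n * L < 1 * L" using v by auto
      hence "0 < n" "n < 1" using L by (auto simp: zero_less_mult_iff)
      thus False by simp
    qed
    thus ?thesis by simp
  qed
  have ex: "\<exists>m>0. \<forall>v\<in>K. m \<le> (norm (1 - unit_circ v))\<^sup>2"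
  proof (cases "K = {}")
    case False
    have "compact K" by (simp add: K_def)
    moreover have "continuous_on K (\<lambda>v. (norm (1 - unit_circ v))\<^sup>2)"
      by (intro continuous_intros continuous_on_unit_circ)
    ultimately obtain v0 where "v0 \<in> K" "\<And>v. v \<in> K \<Longrightarrow> (norm (1 - unit_circ v0))\<^sup>2 \<le> (norm (1 - unit_circ v))\<^sup>2"
      using continuous_attains_inf[of K] False by blast
    thus ?thesis using pos by (intro exI[of _ "(norm (1 - unit_circ v0))\<^sup>2"]) auto
  qed (auto intro: exI[of _ 1])
  then obtain m where m: "m > 0" "\<And>v. v \<in> K \<Longrightarrow> m \<le> (norm (1 - unit_circ v))\<^sup>2" by auto
  have B0: "B \<ge> 0" using order_trans[OF norm_ge_zero B[of 0]] L by simp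
  show ?thesis
  proof (rule that[of "2 * B / m"])
    show "2 * B / m \<ge> 0" using B0 m by simp
    fix v assume v: "v \<in> {0..L}"
    have C0: "2 * B / m * (norm (1 - unit_circ v))\<^sup>2 \<ge> 0" using B0 m by simp
    show "norm (D v - D 0) \<le> \<epsilon> + 2 * B / m * (norm (1 - unit_circ v))\<^sup>2"
    proof (cases "v \<in> K")
      case True
      have "norm (D v - D 0) \<le> 2 * B" using norm_triangle_ineq4[of "D v" "D 0"] B[OF v] B[of 0] L by simp
      also have "\<dots> = 2 * B / m * m" using m by simp
      also have "\<dots> \<le> 2 * B / m * (norm (1 - unit_circ v))\<^sup>2"
        using m True B0 by (intro mult_left_mono) auto
      finally show ?thesis using \<epsilon> by simp
    next
      case False
      hence "dist v 0 < \<delta>1 \<or> dist v L < \<delta>2" using v by (auto simp: K_def dist_real_def)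
      hence "dist (D v) (D 0) < \<epsilon>" using \<delta>1(2)[OF v] \<delta>2(2)[OF v] D(2) by auto
      thus ?thesis using C0 by (simp add: dist_norm)
    qed
  qed
qed

lemma poisson_mean_tendsto:
  assumes D: "continuous_on {0..L} D" "D L = D 0"
    and \<rho>: "\<And>n. 0 \<le> \<rho> n" "\<And>n. \<rho> n < 1" "\<rho> \<longlonglongrightarrow> 1"
  shows "(\<lambda>n. (LINT v:{0..L}|lborel. D v * poisson_kernel (\<rho> n) v) / of_real L) \<longlonglongrightarrow> D 0"
proof (rule LIMSEQ_I)
  fix \<epsilon> :: real assume \<epsilon>: "\<epsilon> > 0"
  obtain C where C: "C \<ge> 0" "\<And>v. v \<in> {0..L} \<Longrightarrow> norm (D v - D 0) \<le> \<epsilon> / 2 + C * (norm (1 - unit_circ v))\<^sup>2"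
    using modulus_bound[OF D, of "\<epsilon> / 2"] \<epsilon> by auto
  have bound: "norm ((LINT v:{0..L}|lborel. D v * poisson_kernel r v) / of_real L - D 0) \<le> \<epsilon> / 2 + 4 * C * (1 - r\<^sup>2)"
    if r: "0 \<le> r" "r < 1" for r
  proof -
    have r2: "1 - r\<^sup>2 > 0" using r by (simp add: abs_square_less_1)
    have i1: "set_integrable lborel {0..L} (\<lambda>v. g v * poisson_kernel r v)" if "continuous_on {0..L} g" for g
      by (intro borel_integrable_atLeastAtMost' continuous_intros continuous_on_poisson_kernel r that)
    have i2: "set_integrable lborel {0..L} (poisson_kernel r)"
      by (intro borel_integrable_atLeastAtMost' continuous_on_poisson_kernel r)
    have Pn: "norm (poisson_kernel r v) = (1 - r\<^sup>2) / (norm (1 - of_real r * unit_circ v))\<^sup>2" for v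
    proof -
      have "0 \<le> (1 - r\<^sup>2) / (norm (1 - of_real r * unit_circ v))\<^sup>2"
        by (intro divide_nonneg_nonneg) (use r2 in auto)
      thus ?thesis by (simp only: poisson_kernel_def norm_of_real abs_of_nonneg)
    qed
    have Pr: "of_real (norm (poisson_kernel r v)) = poisson_kernel r v" for v
    proof -
      have "0 \<le> (1 - r\<^sup>2) / (norm (1 - of_real r * unit_circ v))\<^sup>2"
        by (intro divide_nonneg_nonneg) (use r2 in auto)
      thus ?thesis by (simp only: poisson_kernel_def norm_of_real abs_of_nonneg)
    qed
    have nPint: "(LINT v:{0..L}|lborel. norm (poisson_kernel r v)) = L"
    proof -
      have "complex_of_real (LINT v:{0..L}|lborel. norm (poisson_kernel r v)) = (LINT v:{0..L}|lborel. of_real (norm (poisson_kernel r v)))"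
        by (rule set_integral_complex_of_real[symmetric])
      also have "\<dots> = of_real L" unfolding Pr by (rule poisson_kernel_integral[OF r])
      finally show ?thesis by (simp only: of_real_eq_iff)
    qed
    have key: "(norm (1 - unit_circ v))\<^sup>2 * norm (poisson_kernel r v) \<le> 4 * (1 - r\<^sup>2)" for v
    proof -
      have "norm (1 - unit_circ v) \<le> norm (1 - of_real r * unit_circ v) + norm (of_real r * unit_circ v - unit_circ v)"
        using norm_triangle_ineq[of "1 - of_real r * unit_circ v" "of_real r * unit_circ v - unit_circ v"] by simp
      also have "norm (of_real r * unit_circ v - unit_circ v) = norm ((of_real r - 1) * unit_circ v)" by (simp add: algebra_simps)
      also have "\<dots> = norm (complex_of_real (r - 1)) * 1" by (simp only: norm_mult norm_unit_circ of_real_diff of_real_1)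
      also have "\<dots> = 1 - r" using r by (simp only: norm_of_real) simp
      also have "1 - r \<le> norm (1 - of_real r * unit_circ v)"
        using norm_triangle_ineq2[of 1 "of_real r * unit_circ v"] r by (simp add: norm_mult)
      finally have "norm (1 - unit_circ v) \<le> 2 * norm (1 - of_real r * unit_circ v)" by simp
      hence "(norm (1 - unit_circ v))\<^sup>2 \<le> (2 * norm (1 - of_real r * unit_circ v))\<^sup>2" by (intro power_mono) auto
      hence le: "(norm (1 - unit_circ v))\<^sup>2 \<le> 4 * (norm (1 - of_real r * unit_circ v))\<^sup>2" by (simp add: power_mult_distrib)
      have "norm (1 - of_real r * unit_circ v) > 0"
      proof -
        have "1 - r \<le> norm (1 - of_real r * unit_circ v)"
          using norm_triangle_ineq2[of 1 "of_real r * unit_circ v"] r by (simp add: norm_mult)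
        with r show ?thesis by linarith
      qed
      hence p: "(norm (1 - of_real r * unit_circ v))\<^sup>2 > 0" by simp
      have "(norm (1 - unit_circ v))\<^sup>2 * norm (poisson_kernel r v) \<le> 4 * (norm (1 - of_real r * unit_circ v))\<^sup>2 * ((1 - r\<^sup>2) / (norm (1 - of_real r * unit_circ v))\<^sup>2)"
        unfolding Pn by (intro mult_right_mono le) (use r2 in auto)
      also have "\<dots> = 4 * (1 - r\<^sup>2)" using p by simp
      finally show ?thesis .
    qed
    have "(LINT v:{0..L}|lborel. D v * poisson_kernel r v) / of_real L - D 0 =
      ((LINT v:{0..L}|lborel. D v * poisson_kernel r v) - (LINT v:{0..L}|lborel. D 0 * poisson_kernel r v)) / of_real L"
      using poisson_kernel_integral[OF r] L by (simp add: diff_divide_distrib)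
    also have "(LINT v:{0..L}|lborel. D v * poisson_kernel r v) - (LINT v:{0..L}|lborel. D 0 * poisson_kernel r v) =
      (LINT v:{0..L}|lborel. D v * poisson_kernel r v - D 0 * poisson_kernel r v)"
      by (rule set_integral_diff(2)[symmetric]) (auto intro!: i1 D)
    also have "(\<lambda>v. D v * poisson_kernel r v - D 0 * poisson_kernel r v) = (\<lambda>v. (D v - D 0) * poisson_kernel r v)"
      by (simp add: algebra_simps)
    also have "norm ((LINT v:{0..L}|lborel. (D v - D 0) * poisson_kernel r v) / of_real L) \<le>
       (LINT v:{0..L}|lborel. \<epsilon> / 2 * norm (poisson_kernel r v) + C * (4 * (1 - r\<^sup>2))) / L"
      unfolding norm_divide norm_of_real abs_of_pos[OF L]
    proof (intro divide_right_mono)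
      have "norm (LINT v:{0..L}|lborel. (D v - D 0) * poisson_kernel r v) \<le> (LINT v:{0..L}|lborel. norm ((D v - D 0) * poisson_kernel r v))"
        by (intro set_integral_norm_bound i1 continuous_intros D)
      also have "\<dots> \<le> (LINT v:{0..L}|lborel. \<epsilon> / 2 * norm (poisson_kernel r v) + C * (4 * (1 - r\<^sup>2)))"
      proof (intro set_integral_mono)
        show "set_integrable lborel {0..L} (\<lambda>v. norm ((D v - D 0) * poisson_kernel r v))"
          by (intro borel_integrable_atLeastAtMost' continuous_intros continuous_on_poisson_kernel r D)
        show "set_integrable lborel {0..L} (\<lambda>v. \<epsilon> / 2 * norm (poisson_kernel r v) + C * (4 * (1 - r\<^sup>2)))"
          by (intro borel_integrable_atLeastAtMost' continuous_intros continuous_on_poisson_kernel r)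
        fix v assume v: "v \<in> {0..L}"
        have "norm ((D v - D 0) * poisson_kernel r v) \<le> (\<epsilon> / 2 + C * (norm (1 - unit_circ v))\<^sup>2) * norm (poisson_kernel r v)"
          unfolding norm_mult by (intro mult_right_mono C v) auto
        also have "\<dots> = \<epsilon> / 2 * norm (poisson_kernel r v) + C * ((norm (1 - unit_circ v))\<^sup>2 * norm (poisson_kernel r v))"
          by (simp add: algebra_simps)
        also have "\<dots> \<le> \<epsilon> / 2 * norm (poisson_kernel r v) + C * (4 * (1 - r\<^sup>2))"
          by (intro add_left_mono mult_left_mono key C)
        finally show "norm ((D v - D 0) * poisson_kernel r v) \<le> \<epsilon> / 2 * norm (poisson_kernel r v) + C * (4 * (1 - r\<^sup>2))" .
      qed
      finally show "norm (LINT v:{0..L}|lborel. (D v - D 0) * poisson_kernel r v) \<le> (LINT v:{0..L}|lborel. \<epsilon> / 2 * norm (poisson_kernel r v) + C * (4 * (1 - r\<^sup>2)))" .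
    qed (use L in auto)
    also have "(LINT v:{0..L}|lborel. \<epsilon> / 2 * norm (poisson_kernel r v) + C * (4 * (1 - r\<^sup>2))) =
       \<epsilon> / 2 * L + (LINT v:{0..L}|lborel. C * (4 * (1 - r\<^sup>2)))"
      by (subst set_integral_add(2))
         (auto intro!: borel_integrable_atLeastAtMost' continuous_intros continuous_on_poisson_kernel r simp: nPint)
    also have "(LINT v:{0..L}|lborel. C * (4 * (1 - r\<^sup>2))) = L * (C * (4 * (1 - r\<^sup>2)))"
      using L by (simp add: set_lebesgue_integral_def)
    also have "(\<epsilon> / 2 * L + L * (C * (4 * (1 - r\<^sup>2)))) / L = \<epsilon> / 2 + 4 * C * (1 - r\<^sup>2)"
      using L by (simp add: field_simps)
    finally show ?thesis .
  qed
  have "(\<lambda>n. \<epsilon> / 2 + 4 * C * (1 - (\<rho> n)\<^sup>2)) \<longlonglongrightarrow> \<epsilon> / 2 + 4 * C * (1 - 1\<^sup>2)"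
    by (intro tendsto_intros \<rho>)
  hence "eventually (\<lambda>n. \<epsilon> / 2 + 4 * C * (1 - (\<rho> n)\<^sup>2) < \<epsilon>) sequentially"
    by (rule order_tendstoD(2)) (use \<epsilon> in auto)
  then obtain n0 where "\<And>n. n \<ge> n0 \<Longrightarrow> \<epsilon> / 2 + 4 * C * (1 - (\<rho> n)\<^sup>2) < \<epsilon>"
    unfolding eventually_sequentially by auto
  thus "\<exists>no. \<forall>n\<ge>no. norm ((LINT v:{0..L}|lborel. D v * poisson_kernel (\<rho> n) v) / of_real L - D 0) < \<epsilon>"
    using bound[OF \<rho>(1,2)] by (meson order_le_less_trans)
qed

theorem fourier_series_at_0:
  assumes D: "continuous_on {0..L} D" "D L = D 0"
    and summ: "(\<lambda>k. norm (fcoeff D k)) summable_on UNIV"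
  shows "(fcoeff D has_sum D 0) UNIV"
proof -
  define \<rho> where "\<rho> = (\<lambda>n. 1 - inverse (real (Suc n)))"
  have \<rho>: "0 \<le> \<rho> n" "\<rho> n < 1" for n by (auto simp: \<rho>_def inverse_le_1_iff)
  have \<rho>_lim: "\<rho> \<longlonglongrightarrow> 1"
    unfolding \<rho>_def using tendsto_diff[OF tendsto_const LIMSEQ_inverse_real_of_nat, of 1] by simp
  have summ': "summable (\<lambda>n. norm (fcoeff D (int n)) + norm (fcoeff D (- 1 - int n)))"
    using sums_summable[OF has_sum_int_nat, of "\<lambda>k. norm (fcoeff D k)"] summ by simp
  have "(\<lambda>m. \<Sum>n. of_real (\<rho> m) ^ n * fcoeff D (int n) + of_real (\<rho> m) ^ Suc n * fcoeff D (- 1 - int n))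
     \<longlonglongrightarrow> (\<Sum>n. fcoeff D (int n) + fcoeff D (- 1 - int n))"
  proof (rule tannerys_theorem[THEN conjunct2, THEN conjunct2, OF _ _ summ'])
    show "(\<lambda>m. of_real (\<rho> m) ^ n * fcoeff D (int n) + of_real (\<rho> m) ^ Suc n * fcoeff D (- 1 - int n))
       \<longlonglongrightarrow> fcoeff D (int n) + fcoeff D (- 1 - int n)" for n
    proof -
      have "(\<lambda>m. of_real (\<rho> m) ^ n * fcoeff D (int n) + of_real (\<rho> m) ^ Suc n * fcoeff D (- 1 - int n))
       \<longlonglongrightarrow> of_real 1 ^ n * fcoeff D (int n) + of_real 1 ^ Suc n * fcoeff D (- 1 - int n)"
        by (intro tendsto_intros \<rho>_lim)
      thus ?thesis by simp
    qed
    have "norm (of_real (\<rho> m) ^ n * fcoeff D (int n) + of_real (\<rho> m) ^ Suc n * fcoeff D (- 1 - int n))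
       \<le> norm (fcoeff D (int n)) + norm (fcoeff D (- 1 - int n))" for m n
      unfolding norm_mult norm_power
      by (intro norm_triangle_le add_mono)
         (use \<rho>[of m] in \<open>auto simp: norm_mult norm_power power_le_one mult_le_one intro!: mult_left_le_one_le\<close>)
    thus "\<forall>\<^sub>F (n, m) in sequentially \<times>\<^sub>F sequentially. norm (of_real (\<rho> m) ^ n * fcoeff D (int n) + of_real (\<rho> m) ^ Suc n * fcoeff D (- 1 - int n))
       \<le> norm (fcoeff D (int n)) + norm (fcoeff D (- 1 - int n))"
      by (intro always_eventually) auto
  qed auto
  moreover have "(\<Sum>n. of_real (\<rho> m) ^ n * fcoeff D (int n) + of_real (\<rho> m) ^ Suc n * fcoeff D (- 1 - int n)) =
     (LINT v:{0..L}|lborel. D v * poisson_kernel (\<rho> m) v) / of_real L" for m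
    using abel_mean_fcoeff[OF D(1) \<rho>[of m]] by (simp add: sums_iff)
  ultimately have "(\<Sum>n. fcoeff D (int n) + fcoeff D (- 1 - int n)) = D 0"
    using LIMSEQ_unique[OF _ poisson_mean_tendsto[OF D \<rho> \<rho>_lim]] by simp
  hence "infsum (fcoeff D) UNIV = D 0"
    using has_sum_int_nat[OF summ] by (simp add: sums_iff)
  thus ?thesis
    using has_sum_infsum[OF abs_summable_summable[OF summ]] by simp
qed

end

subsection \<open>The Zolotarev measure and Mellin transforms\<close>

lemma periodic_int:
  fixes F :: "real \<Rightarrow> 'a" and L :: real
  assumes "\<And>x. F (x + L) = F x"
  shows "F (x + of_int n * L) = F x"
proof -
  have *: "F (x + of_nat m * L) = F x" for x and m :: nat
  proof (induction m)
    case (Suc m)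
    have "F (x + of_nat (Suc m) * L) = F (x + of_nat m * L + L)" by (simp add: algebra_simps)
    thus ?case using assms Suc by simp
  qed simp
  show ?thesis
  proof (cases "n \<ge> 0")
    case True
    thus ?thesis using *[of x "nat n"] by simp
  next
    case False
    thus ?thesis using *[of "x + of_int n * L" "nat (- n)"] by simp
  qed
qed

lemma periodic_integral_shift:
  fixes F :: "real \<Rightarrow> 'a::euclidean_space"
  assumes F: "continuous_on UNIV F" "\<And>x. F (x + L) = F x" and L: "L > 0"
  shows "(LINT v:{0..L}|lborel. F (v + a)) = (LINT v:{0..L}|lborel. F v)"
proof -
  have c: "continuous_on S F" for S using F(1) continuous_on_subset by blast
  have cs: "continuous_on S (\<lambda>v. F (v + b))" for S b
    by (rule continuous_on_compose2[OF F(1)]) (auto intro!: continuous_intros)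
  define n where "n = \<lfloor>a / L\<rfloor>"
  define b where "b = a - of_int n * L"
  have b: "0 \<le> b" "b < L"
    using floor_divide_lower[OF L, of a] floor_divide_upper[OF L, of a] unfolding b_def n_def by (auto simp: algebra_simps)
  have Fb: "F (v + a) = F (v + b)" for v
    using periodic_int[of F L "v + b" n] F(2) by (simp add: b_def algebra_simps)
  have I: "F integrable_on {x..y}" for x y by (intro integrable_continuous_interval c)
  have "integral {0..L} (\<lambda>v. F (v + b)) = integral {b..L + b} F"
    using integral_shift[of 0 b L F] c by (simp add: o_def)
  also have "\<dots> = integral {b..L} F + integral {L..L + b} F"
    using b by (intro Henstock_Kurzweil_Integration.integral_combine[symmetric] I) auto
  also have "integral {L..L + b} F = integral {0..b} (\<lambda>v. F (v + L))"
    using integral_shift[of 0 L b F] c by (simp add: o_def add.commute)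
  also have "\<dots> = integral {0..b} F" by (simp add: F(2))
  also have "integral {b..L} F + integral {0..b} F = integral {0..L} F"
    using b Henstock_Kurzweil_Integration.integral_combine[of 0 b L F] I by (simp add: add.commute)
  finally have "integral {0..L} (\<lambda>v. F (v + b)) = integral {0..L} F" .
  moreover have "set_integrable lborel {0..L} (\<lambda>v. F (v + b))" "set_integrable lborel {0..L} F"
    by (intro borel_integrable_atLeastAtMost' c cs)+
  ultimately show ?thesis by (simp add: Fb set_borel_integral_eq_integral)
qed

definition mellin :: "(real \<Rightarrow> complex) \<Rightarrow> complex \<Rightarrow> complex" where
  "mellin g z = (LINT y:{0<..}|lborel. of_real y powr (z - 1) * g y)"

locale zolotarev_data =
  fixes c :: real and \<theta> :: "real \<Rightarrow> real" and \<phi> :: "real measure"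
  assumes c: "c > 1" and adm: "smooth_admissable c 1 \<theta>" and zol: "zolotarev_measure \<theta> \<phi>"
begin

abbreviation L :: real where "L \<equiv> ln c"

abbreviation s :: "int \<Rightarrow> complex" where "s k \<equiv> \<i> * of_int k * of_real (c_tilde c)"

abbreviation ck :: "int \<Rightarrow> complex" where "ck \<equiv> fourier_coeff c \<theta>"

abbreviation char :: "int \<Rightarrow> real \<Rightarrow> complex" where
  "char k v \<equiv> exp (- \<i> * of_int k * of_real (c_tilde c) * of_real v)"

lemma L_pos: "L > 0" using c by simp

lemma \<theta>_pos: "\<theta> y > 0" and \<theta>_per: "\<theta> (y + L) = \<theta> y"
  and \<theta>_growth: "\<delta> \<ge> 0 \<Longrightarrow> \<theta> (y + \<delta>) \<le> exp \<delta> * \<theta> y"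
  and \<theta>_cont: "continuous_on UNIV \<theta>"
  using adm c by (auto simp: smooth_admissable_def admissable_def)

lemma \<theta>_cont': "continuous_on S \<theta>" "continuous_on S f \<Longrightarrow> continuous_on S (\<lambda>x. \<theta> (f x))"
  using \<theta>_cont continuous_on_subset continuous_on_compose2[OF \<theta>_cont] by blast+

lemma \<theta>_measurable [measurable]: "\<theta> \<in> borel_measurable borel"
  using \<theta>_cont by (simp add: borel_measurable_continuous_onI)

lemma \<theta>_bdd: "\<theta> y \<le> c * \<theta> 0"
proof -
  define n where "n = \<lfloor>y / L\<rfloor>"
  define b where "b = y - of_int n * L"
  have b: "0 \<le> b" "b < L"
    using floor_divide_lower[OF L_pos, of y] floor_divide_upper[OF L_pos, of y] unfolding b_def n_def by (auto simp: algebra_simps)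
  have "\<theta> y = \<theta> b"
    using periodic_int[of \<theta> L b n] \<theta>_per by (simp add: b_def algebra_simps)
  also have "\<dots> \<le> exp b * \<theta> 0" using \<theta>_growth[OF b(1), of 0] by simp
  also have "exp b \<le> exp L" using b by simp
  also have "exp L = c" using c by simp
  finally show ?thesis using \<theta>_pos[of 0] by (simp add: mult_right_mono)
qed

lemma sets_\<phi>: "sets \<phi> = sets (restrict_space borel {0<..})"
  and emeasure_\<phi>: "r > 0 \<Longrightarrow> emeasure \<phi> {r<..} = ennreal (\<theta> (ln r) / r)"
  using zol by (auto simp: zolotarev_measure_def divide_inverse mult.commute)

lemma space_\<phi>: "space \<phi> = {0<..}"
  using sets_eq_imp_space_eq[OF sets_\<phi>] by (simp add: space_restrict_space)

lemma \<phi>_measurable: "f \<in> borel_measurable borel \<Longrightarrow> f \<in> borel_measurable \<phi>"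
  unfolding measurable_cong_sets[OF sets_\<phi> refl] by (rule measurable_restrict_space1)

lemma sets_\<phi>_greaterThan: "r > 0 \<Longrightarrow> {r<..} \<in> sets \<phi>"
  unfolding sets_\<phi> sets_restrict_space by (auto intro!: image_eqI[of _ _ "{r<..}"])

lemma sigma_finite_\<phi>: "sigma_finite_measure \<phi>"
proof
  show "\<exists>A. countable A \<and> A \<subseteq> sets \<phi> \<and> \<Union> A = space \<phi> \<and> (\<forall>a\<in>A. emeasure \<phi> a \<noteq> \<infinity>)"
  proof (intro exI[of _ "range (\<lambda>n. {inverse (real (Suc n))<..})"] conjI)
    show "\<Union> (range (\<lambda>n. {inverse (real (Suc n))<..})) = space \<phi>"
    proof (intro equalityI subsetI)
      fix x assume "x \<in> space \<phi>"
      hence "x > 0" by (simp add: space_\<phi>)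
      then obtain n where "inverse (real (Suc n)) < x" using reals_Archimedean by blast
      thus "x \<in> \<Union> (range (\<lambda>n. {inverse (real (Suc n))<..}))" by auto
    next
      fix x assume "x \<in> \<Union> (range (\<lambda>n. {inverse (real (Suc n))<..}))"
      then obtain n where "x > inverse (real (Suc n))" by auto
      moreover have "inverse (real (Suc n)) > 0" by simp
      ultimately show "x \<in> space \<phi>" unfolding space_\<phi> greaterThan_iff by linarith
    qed
  qed (auto simp: sets_\<phi>_greaterThan emeasure_\<phi>)
qed

lemma
  fixes G g :: "real \<Rightarrow> complex"
  assumes deriv: "\<And>y. (G has_vector_derivative g y) (at y)"
    and cont: "continuous_on UNIV g" and G0: "G 0 = 0"
    and int: "set_integrable lborel {0<..} (\<lambda>w. g w / of_real w)"
  shows \<phi>_integrable_tail: "integrable \<phi> G"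
    and \<phi>_integral_tail: "integral\<^sup>L \<phi> G = (LINT w:{0<..}|lborel. of_real (\<theta> (ln w)) * (g w / of_real w))"
proof -
  interpret P: pair_sigma_finite lborel \<phi>
    using sigma_finite_\<phi> sigma_finite_lborel by (intro pair_sigma_finite.intro)
  have [measurable]: "g \<in> borel_measurable borel" using cont by (rule borel_measurable_continuous_onI)
  define H where "H = (\<lambda>w y. if 0 < w \<and> w < y then g w else 0)"
  have snd_m [measurable]: "(\<lambda>x. snd x) \<in> borel_measurable (lborel \<Otimes>\<^sub>M \<phi>)"
    by (rule measurable_compose[OF measurable_snd \<phi>_measurable]) simp
  have fst_m [measurable]: "(\<lambda>x. fst x) \<in> borel_measurable (lborel \<Otimes>\<^sub>M \<phi>)"
    by (rule measurable_compose[OF measurable_fst]) simp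
  have H_m [measurable]: "(\<lambda>x. H (fst x) (snd x)) \<in> borel_measurable (lborel \<Otimes>\<^sub>M \<phi>)"
    unfolding H_def by measurable
  have Hw: "H w = (\<lambda>y. indicator {w<..} y *\<^sub>R g w)" if "w > 0" for w
    using that by (auto simp: H_def fun_eq_iff)
  have Hw0: "H w = (\<lambda>y. 0)" if "\<not> w > 0" for w
    using that by (auto simp: H_def fun_eq_iff)
  have fin: "emeasure \<phi> {w<..} < \<infinity>" if "w > 0" for w using that by (simp add: emeasure_\<phi>)
  have meas: "measure \<phi> {w<..} = \<theta> (ln w) / w" if "w > 0" for w
    using that \<theta>_pos[of "ln w"] by (simp add: measure_def emeasure_\<phi>)
  have i1: "integrable \<phi> (H w)" for w
  proof (cases "w > 0")
    case True
    show ?thesis unfolding Hw[OF True]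
      by (intro integrable_scaleR_left integrable_real_indicator sets_\<phi>_greaterThan fin True)
  qed (simp add: Hw0)
  have int_norm: "integrable lborel (\<lambda>w. norm (indicator {0<..} w *\<^sub>R (g w / of_real w)) * (c * \<theta> 0))"
    using int unfolding set_integrable_def by (intro integrable_mult_left integrable_norm)
  have i2: "integrable lborel (\<lambda>w. LINT y|\<phi>. norm (H w y))"
  proof (rule Bochner_Integration.integrable_bound[OF int_norm])
    show "(\<lambda>w. LINT y|\<phi>. norm (H w y)) \<in> borel_measurable lborel"
      using H_m by (intro P.M2.borel_measurable_lebesgue_integral) (simp add: split_beta')
    have "norm (LINT y|\<phi>. norm (H w y)) \<le> norm (norm (indicator {0<..} w *\<^sub>R (g w / complex_of_real w)) * (c * \<theta> 0))" for w
    proof (cases "w > 0")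
      case True
      have "(LINT y|\<phi>. norm (H w y)) = (LINT y|\<phi>. indicator {w<..} y * norm (g w))"
        by (simp add: Hw[OF True])
      also have "\<dots> = \<theta> (ln w) / w * norm (g w)"
        using True by (simp add: meas sets_\<phi>_greaterThan space_\<phi> Int_absorb2)
      finally have "norm (LINT y|\<phi>. norm (H w y)) = \<theta> (ln w) / w * norm (g w)"
        using True \<theta>_pos[of "ln w"] by simp
      also have "\<dots> \<le> (c * \<theta> 0) / w * norm (g w)"
        using True \<theta>_bdd by (intro mult_right_mono divide_right_mono) auto
      also have "\<dots> = norm (norm (indicator {0<..} w *\<^sub>R (g w / complex_of_real w)) * (c * \<theta> 0))"
        using True \<theta>_pos[of 0] c by (simp add: norm_divide abs_mult)
      finally show ?thesis .
    qed (simp add: Hw0)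
    thus "AE w in lborel. norm (LINT y|\<phi>. norm (H w y)) \<le> norm (norm (indicator {0<..} w *\<^sub>R (g w / complex_of_real w)) * (c * \<theta> 0))"
      by simp
  qed
  have intH: "integrable (lborel \<Otimes>\<^sub>M \<phi>) (case_prod H)"
    by (rule P.Fubini_integrable) (use H_m i1 i2 in \<open>auto simp: split_beta'\<close>)
  have G_eq: "(LINT w|lborel. H w y) = G y" if "y > 0" for y
  proof -
    have "(g has_integral (G y - G 0)) {0..y}"
      by (rule fundamental_theorem_of_calculus) (use that deriv in \<open>auto intro: has_vector_derivative_at_within\<close>)
    moreover have "set_integrable lborel {0..y} g"
      by (intro borel_integrable_atLeastAtMost' continuous_on_subset[OF cont]) auto
    ultimately have "(LINT w:{0..y}|lborel. g w) = G y"
      using G0 by (simp add: set_borel_integral_eq_integral integral_unique)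
    moreover have "(LINT w:{0..y}|lborel. g w) = (LINT w|lborel. H w y)"
      unfolding set_lebesgue_integral_def
    proof (rule integral_cong_AE)
      have "AE w in lborel. w \<noteq> 0 \<and> w \<noteq> y"
        by (intro AE_conjI AE_lborel_singleton)
      thus "AE w in lborel. indicator {0..y} w *\<^sub>R g w = H w y"
        by eventually_elim (auto simp: H_def indicator_def)
    qed (auto simp: H_def)
    ultimately show ?thesis by simp
  qed
  have "integrable \<phi> (\<lambda>y. LINT w|lborel. H w y)" using intH by (rule P.integrable_snd)
  moreover have "integrable \<phi> (\<lambda>y. LINT w|lborel. H w y) \<longleftrightarrow> integrable \<phi> G"
    by (rule Bochner_Integration.integrable_cong) (simp_all add: space_\<phi> G_eq)
  ultimately show "integrable \<phi> G" by blast
  have "integral\<^sup>L \<phi> G = (LINT y|\<phi>. (LINT w|lborel. H w y))"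
    by (rule Bochner_Integration.integral_cong) (auto simp: space_\<phi> G_eq)
  also have "\<dots> = (LINT w|lborel. (LINT y|\<phi>. H w y))" by (rule P.Fubini_integral[OF intH])
  also have "\<dots> = (LINT w:{0<..}|lborel. of_real (\<theta> (ln w)) * (g w / of_real w))"
    unfolding set_lebesgue_integral_def
  proof (rule Bochner_Integration.integral_cong)
    fix w :: real
    show "(LINT y|\<phi>. H w y) = indicator {0<..} w *\<^sub>R (of_real (\<theta> (ln w)) * (g w / of_real w))"
    proof (cases "w > 0")
      case True
      thus ?thesis
        by (simp add: Hw meas sets_\<phi>_greaterThan space_\<phi> Int_absorb2 scaleR_conv_of_real fin)
    qed (simp add: Hw0)
  qed simp
  finally show "integral\<^sup>L \<phi> G = (LINT w:{0<..}|lborel. of_real (\<theta> (ln w)) * (g w / of_real w))" .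
qed

lemma exp_periodic: "char k (x + L) = char k x"
proof -
  have "- \<i> * of_int k * of_real (c_tilde c) * of_real (x + L) =
    - \<i> * of_int k * of_real (c_tilde c) * of_real x + of_int (- k) * (of_real (2 * pi) * \<i>)"
    using L_pos by (simp add: c_tilde_def field_simps)
  moreover have "exp (of_int (- k) * (of_real (2 * pi) * \<i>)) = 1"
    by (auto simp: exp_eq_1 intro!: exI[of _ "- k"])
  ultimately show ?thesis by (simp only: exp_add mult_1_right)
qed

lemma ck_shift:
  "(LINT v:{0..L}|lborel. of_real (\<theta> (v + a)) * char k v) =
     of_real L * ck k * exp (s k * of_real a)"
proof -
  define F where "F = (\<lambda>x. of_real (\<theta> x) * char k x)"
  have "(LINT v:{0..L}|lborel. F (v + a)) = (LINT v:{0..L}|lborel. F v)"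
    by (rule periodic_integral_shift)
       (unfold F_def exp_periodic \<theta>_per, auto intro!: continuous_intros \<theta>_cont L_pos)
  also have "\<dots> = of_real L * ck k" using L_pos by (simp add: fourier_coeff_def F_def)
  finally have *: "(LINT v:{0..L}|lborel. F (v + a)) = of_real L * ck k" .
  have "of_real (\<theta> (v + a)) * char k v = F (v + a) * exp (s k * of_real a)" for v
    by (simp add: F_def algebra_simps flip: exp_add)
  hence "(LINT v:{0..L}|lborel. of_real (\<theta> (v + a)) * char k v) =
     (LINT v:{0..L}|lborel. F (v + a)) * exp (s k * of_real a)"
    by simp
  thus ?thesis using * by simp
qed

text \<open>
  Shifting by half a period of the exponential turns \<open>ck k\<close> into the coefficient of an increment of
  \<open>\<theta>\<close>, whose integral over a period vanishes; so only its positive part matters, and the growth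
  condition in admissibility controls that.
\<close>
lemma ck_bound: "\<exists>C>0. \<forall>k. norm (ck k) \<le> C / (1 + \<bar>real_of_int k\<bar>)"
proof -
  define B where "B = c * \<theta> 0"
  have B: "B > 0" using c \<theta>_pos by (simp add: B_def)
  define C where "C = B * L * exp L"
  have C: "C > 0" using B L_pos by (simp add: C_def)
  have int_\<theta>: "(LINT x:{0..L}|lborel. \<theta> x) \<le> B * L"
  proof -
    have "(LINT x:{0..L}|lborel. \<theta> x) \<le> (LINT x:{0..L}|lborel. B)"
      by (intro set_integral_mono borel_integrable_atLeastAtMost' continuous_intros \<theta>_cont')
         (auto simp: B_def \<theta>_bdd)
    also have "\<dots> = B * L" using L_pos by (simp add: set_lebesgue_integral_def)
    finally show ?thesis .
  qed
  have k0: "norm (ck k) \<le> C / \<bar>real_of_int k\<bar>" if k: "k \<noteq> 0" for k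
  proof -
    define \<delta> where "\<delta> = L / (2 * \<bar>real_of_int k\<bar>)"
    have k1: "\<bar>real_of_int k\<bar> \<ge> 1" using k by linarith
    have \<delta>: "\<delta> > 0" "\<delta> \<le> L" using L_pos k1 by (auto simp: \<delta>_def field_simps)
    have "exp (s k * of_real \<delta>) = - 1"
    proof -
      have e: "s k * of_real \<delta> = of_real (sgn (real_of_int k)) * (\<i> * of_real pi)"
        using k L_pos by (simp add: \<delta>_def c_tilde_def sgn_if field_simps)
      show ?thesis unfolding e using k by (simp add: sgn_if exp_minus)
    qed
    hence 1: "(LINT v:{0..L}|lborel. of_real (\<theta> (v + \<delta>)) * char k v) = - (of_real L * ck k)"
      unfolding ck_shift by simp
    have 2: "(LINT v:{0..L}|lborel. of_real (\<theta> v) * char k v) = of_real L * ck k"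
      using ck_shift[of 0 k] by simp
    have eq: "2 * (of_real L * ck k) = (LINT v:{0..L}|lborel. of_real (\<theta> v) * char k v
       - of_real (\<theta> (v + \<delta>)) * char k v)"
    proof -
      have "(LINT v:{0..L}|lborel. of_real (\<theta> v) * char k v
         - of_real (\<theta> (v + \<delta>)) * char k v) =
         (LINT v:{0..L}|lborel. of_real (\<theta> v) * char k v)
         - (LINT v:{0..L}|lborel. of_real (\<theta> (v + \<delta>)) * char k v)"
        by (intro set_integral_diff(2) borel_integrable_atLeastAtMost' continuous_intros \<theta>_cont')
      also have "\<dots> = of_real L * ck k - - (of_real L * ck k)" by (simp only: 1 2)
      finally show ?thesis by simp
    qed
    have "norm (2 * (of_real L * ck k)) \<le> (LINT v:{0..L}|lborel. norm (of_real (\<theta> v) * char k v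
       - of_real (\<theta> (v + \<delta>)) * char k v))"
      unfolding eq by (intro set_integral_norm_bound borel_integrable_atLeastAtMost' continuous_intros \<theta>_cont')
    also have "(\<lambda>v. norm (of_real (\<theta> v) * char k v
       - of_real (\<theta> (v + \<delta>)) * char k v)) = (\<lambda>v. \<bar>\<theta> v - \<theta> (v + \<delta>)\<bar>)"
    proof
      fix v
      have "norm (of_real (\<theta> v) * char k v
       - of_real (\<theta> (v + \<delta>)) * char k v) =
         norm (of_real (\<theta> v - \<theta> (v + \<delta>)) * char k v)"
        by (simp add: left_diff_distrib)
      also have "\<dots> = \<bar>\<theta> v - \<theta> (v + \<delta>)\<bar>"
        unfolding norm_mult norm_of_real by (simp add: norm_exp_eq_Re)
      finally show "norm (of_real (\<theta> v) * char k v
       - of_real (\<theta> (v + \<delta>)) * char k v) = \<bar>\<theta> v - \<theta> (v + \<delta>)\<bar>" .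
    qed
    also have "(LINT v:{0..L}|lborel. \<bar>\<theta> v - \<theta> (v + \<delta>)\<bar>) \<le> (LINT v:{0..L}|lborel. (2 * (exp \<delta> - 1) + 1) * \<theta> v - \<theta> (v + \<delta>))"
    proof (rule set_integral_mono)
      show "set_integrable lborel {0..L} (\<lambda>v. \<bar>\<theta> v - \<theta> (v + \<delta>)\<bar>)"
        by (intro borel_integrable_atLeastAtMost' continuous_intros \<theta>_cont')
      show "set_integrable lborel {0..L} (\<lambda>v. (2 * (exp \<delta> - 1) + 1) * \<theta> v - \<theta> (v + \<delta>))"
        by (intro borel_integrable_atLeastAtMost' continuous_intros \<theta>_cont')
      fix v
      have "exp \<delta> * \<theta> v \<ge> 1 * \<theta> v" using \<delta> \<theta>_pos[of v] by (intro mult_right_mono) auto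
      thus "\<bar>\<theta> v - \<theta> (v + \<delta>)\<bar> \<le> (2 * (exp \<delta> - 1) + 1) * \<theta> v - \<theta> (v + \<delta>)"
        using \<theta>_growth[of \<delta> v] \<delta> by (simp add: algebra_simps abs_if)
    qed
    also have "\<dots> = (2 * (exp \<delta> - 1) + 1) * (LINT v:{0..L}|lborel. \<theta> v) - (LINT v:{0..L}|lborel. \<theta> (v + \<delta>))"
      by (subst set_integral_diff(2)) (auto intro!: borel_integrable_atLeastAtMost' continuous_intros \<theta>_cont')
    also have "(LINT v:{0..L}|lborel. \<theta> (v + \<delta>)) = (LINT v:{0..L}|lborel. \<theta> v)"
      by (rule periodic_integral_shift[OF \<theta>_cont \<theta>_per L_pos])
    also have "(2 * (exp \<delta> - 1) + 1) * (LINT v:{0..L}|lborel. \<theta> v) - (LINT v:{0..L}|lborel. \<theta> v) = 2 * (exp \<delta> - 1) * (LINT v:{0..L}|lborel. \<theta> v)"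
      by (simp add: algebra_simps)
    also have "\<dots> \<le> 2 * (exp \<delta> - 1) * (B * L)"
      using int_\<theta> \<delta> by (intro mult_left_mono) auto
    also have "\<dots> \<le> 2 * (\<delta> * exp L) * (B * L)"
    proof -
      have "1 - \<delta> \<le> exp (- \<delta>)" using exp_ge_add_one_self[of "- \<delta>"] by simp
      hence "exp \<delta> * (1 - \<delta>) \<le> exp \<delta> * exp (- \<delta>)" by (intro mult_left_mono) auto
      hence "exp \<delta> - 1 \<le> \<delta> * exp \<delta>" by (simp add: algebra_simps flip: exp_add)
      also have "\<dots> \<le> \<delta> * exp L" using \<delta> by (intro mult_left_mono) auto
      finally show ?thesis using B L_pos by (intro mult_right_mono mult_left_mono) auto
    qed
    finally have "2 * L * norm (ck k) \<le> 2 * (\<delta> * exp L) * (B * L)"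
      using L_pos by (simp add: norm_mult)
    hence "2 * L * norm (ck k) \<le> 2 * L * (\<delta> * exp L * B)" by (simp add: mult_ac)
    hence "norm (ck k) \<le> \<delta> * exp L * B" using L_pos by simp
    also have "\<dots> = C / (2 * \<bar>real_of_int k\<bar>)" by (simp add: \<delta>_def C_def)
    also have "\<dots> \<le> C / \<bar>real_of_int k\<bar>" using C k1 by (intro divide_left_mono) auto
    finally show ?thesis .
  qed
  show ?thesis
  proof (intro exI[of _ "2 * C + norm (ck 0) + 1"] conjI allI)
    show "2 * C + norm (ck 0) + 1 > 0" using C by (simp add: add_pos_nonneg)
    fix k
    show "norm (ck k) \<le> (2 * C + norm (ck 0) + 1) / (1 + \<bar>real_of_int k\<bar>)"
    proof (cases "k = 0")
      case True
      thus ?thesis using C by simp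
    next
      case False
      hence k1: "\<bar>real_of_int k\<bar> \<ge> 1" by linarith
      have "norm (ck k) \<le> C / \<bar>real_of_int k\<bar>" by (rule k0[OF False])
      also have "\<dots> \<le> (2 * C) / (1 + \<bar>real_of_int k\<bar>)" using k1 C by (simp add: field_simps)
      also have "\<dots> \<le> (2 * C + norm (ck 0) + 1) / (1 + \<bar>real_of_int k\<bar>)"
        by (intro divide_right_mono) auto
      finally show ?thesis .
    qed
  qed
qed

lemma \<phi>_integral_mellin_series:
  fixes G g :: "real \<Rightarrow> complex"
  assumes deriv: "\<And>y. (G has_vector_derivative g y) (at y)"
    and cont: "continuous_on UNIV g" and G0: "G 0 = 0"
    and int: "set_integrable lborel {0<..} (\<lambda>w. g w / of_real w)"
    and summ: "(\<lambda>k. norm (ck k * mellin g (s k))) summable_on UNIV"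
  shows "((\<lambda>k. ck k * mellin g (s k)) has_sum integral\<^sup>L \<phi> G) UNIV"
proof -
  have [measurable]: "g \<in> borel_measurable borel" using cont by (rule borel_measurable_continuous_onI)
  define D where "D = (\<lambda>v. LINT w:{0<..}|lborel. of_real (\<theta> (ln w + v)) * (g w / of_real w))"
  define q where "q = (\<lambda>w. indicator {0<..} w *\<^sub>R (g w / of_real w))"
  have q_int: "integrable lborel q" using int by (simp add: q_def set_integrable_def)
  have q_m [measurable]: "q \<in> borel_measurable borel" unfolding q_def by measurable
  have D_eq: "D v = (LINT w|lborel. of_real (\<theta> (ln w + v)) * q w)" for v
    unfolding D_def q_def set_lebesgue_integral_def by (simp add: scaleR_conv_of_real mult_ac)
  have q_dom: "norm (of_real (\<theta> (ln w + v)) * q w) \<le> c * \<theta> 0 * norm (q w)" for w v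
    using \<theta>_bdd[of "ln w + v"] \<theta>_pos[of "ln w + v"] by (simp add: norm_mult mult_right_mono)
  have q_int': "integrable lborel (\<lambda>w. c * \<theta> 0 * norm (q w))"
    using q_int by (intro integrable_mult_right integrable_norm)
  have D_cont: "continuous_on UNIV D"
  proof (rule continuous_on_sequentiallyI)
    fix u :: "nat \<Rightarrow> real" and a assume u: "u \<longlonglongrightarrow> a"
    show "(\<lambda>n. D (u n)) \<longlonglongrightarrow> D a"
      unfolding D_eq
    proof (rule integral_dominated_convergence[where w = "\<lambda>w. c * \<theta> 0 * norm (q w)"])
      have "(\<lambda>n. \<theta> (ln w + u n)) \<longlonglongrightarrow> \<theta> (ln w + a)" for w
        by (rule continuous_on_tendsto_compose[OF \<theta>_cont]) (auto intro!: tendsto_intros u)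
      thus "AE w in lborel. (\<lambda>n. of_real (\<theta> (ln w + u n)) * q w) \<longlonglongrightarrow> of_real (\<theta> (ln w + a)) * q w"
        by (intro AE_I2 tendsto_mult tendsto_of_real tendsto_const)
    qed (use q_int' q_dom in auto)
  qed
  have D_L: "D L = D 0" unfolding D_eq using \<theta>_per by simp
  have coeff: "fcoeff L D k = ck k * mellin g (s k)" for k
  proof -
    define e where "e = (\<lambda>v::real. char k v)"
    have e_m [measurable]: "e \<in> borel_measurable borel" unfolding e_def by measurable
    have ne: "norm (e v) = 1" for v unfolding e_def by (simp add: norm_exp_eq_Re)
    define H where "H = (\<lambda>w v. of_real (\<theta> (ln w + v)) * q w * (indicator {0..L} v *\<^sub>R e v))"
    have H_m [measurable]: "(\<lambda>x. H (fst x) (snd x)) \<in> borel_measurable (lborel \<Otimes>\<^sub>M lborel)"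
      unfolding H_def by measurable
    have H_dom: "norm (H w v) \<le> c * \<theta> 0 * norm (q w) * indicator {0..L} v" for w v
    proof -
      have "norm (H w v) = norm (of_real (\<theta> (ln w + v)) * q w) * indicator {0..L} v"
        by (simp add: H_def norm_mult ne)
      also have "\<dots> \<le> c * \<theta> 0 * norm (q w) * indicator {0..L} v"
        by (rule mult_right_mono[OF q_dom]) simp
      finally show ?thesis .
    qed
    have i0: "integrable lborel (\<lambda>v. c * \<theta> 0 * norm (q w) * indicator {0..L} v)" for w
      by (intro integrable_mult_right integrable_real_indicator) (auto simp: emeasure_lborel_Icc_eq)
    have i1: "integrable lborel (H w)" for w
      by (rule Bochner_Integration.integrable_bound[OF i0[of w]])
         (use H_dom[of w] in \<open>auto intro!: AE_I2 simp: H_def intro: order_trans[OF _ abs_ge_self]\<close>)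
    have i2: "integrable lborel (\<lambda>w. LINT v|lborel. norm (H w v))"
    proof (rule Bochner_Integration.integrable_bound)
      show "integrable lborel (\<lambda>w. c * \<theta> 0 * norm (q w) * L)" by (intro integrable_mult_left q_int')
      show "(\<lambda>w. LINT v|lborel. norm (H w v)) \<in> borel_measurable lborel"
        using H_m by (intro lborel.borel_measurable_lebesgue_integral) (simp add: split_beta')
      have "norm (LINT v|lborel. norm (H w v)) \<le> norm (c * \<theta> 0 * norm (q w) * L)" for w
      proof -
        have "(LINT v|lborel. norm (H w v)) \<le> (LINT v|lborel. c * \<theta> 0 * norm (q w) * indicator {0..L} v)"
          by (intro integral_mono integrable_norm i1 i0 H_dom)
        also have "\<dots> = c * \<theta> 0 * norm (q w) * L" using L_pos by simp
        finally have "(LINT v|lborel. norm (H w v)) \<le> c * \<theta> 0 * norm (q w) * L" .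
        moreover have "(LINT v|lborel. norm (H w v)) \<ge> 0" by (rule integral_nonneg_AE) simp
        ultimately show ?thesis by simp
      qed
      thus "AE w in lborel. norm (LINT v|lborel. norm (H w v)) \<le> norm (c * \<theta> 0 * norm (q w) * L)" by simp
    qed
    have intH: "integrable (lborel \<Otimes>\<^sub>M lborel) (case_prod H)"
      by (rule lborel_pair.Fubini_integrable) (use H_m i1 i2 in \<open>auto simp: split_beta'\<close>)
    have "of_real L * fcoeff L D k = (LINT v:{0..L}|lborel. D v * e v)"
      using L_pos by (simp add: fcoeff_def[OF L_pos] e_def c_tilde_def)
    also have "\<dots> = (LINT v|lborel. (LINT w|lborel. H w v))"
      unfolding set_lebesgue_integral_def D_eq H_def by (simp add: mult_ac)
    also have "\<dots> = (LINT w|lborel. (LINT v|lborel. H w v))" by (rule lborel_pair.Fubini_integral[OF intH])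
    also have "\<dots> = (LINT w|lborel. of_real L * ck k * (indicator {0<..} w *\<^sub>R (of_real w powr (s k - 1) * g w)))"
    proof (rule Bochner_Integration.integral_cong)
      fix w :: real
      show "(LINT v|lborel. H w v) = of_real L * ck k * (indicator {0<..} w *\<^sub>R (of_real w powr (s k - 1) * g w))"
      proof (cases "w > 0")
        case True
        have "(LINT v|lborel. H w v) = (LINT v|lborel. q w * (indicator {0..L} v *\<^sub>R (of_real (\<theta> (v + ln w)) * e v)))"
          unfolding H_def by (simp add: mult_ac add.commute)
        also have "\<dots> = q w * (LINT v:{0..L}|lborel. of_real (\<theta> (v + ln w)) * e v)"
          unfolding set_lebesgue_integral_def by (rule integral_mult_right_zero)
        also have "\<dots> = q w * (of_real L * ck k * exp (s k * of_real (ln w)))"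
          unfolding e_def ck_shift ..
        also have "exp (s k * of_real (ln w)) = of_real w powr (s k)"
          using True by (simp add: powr_def Ln_of_real)
        also have "of_real w powr s k = of_real w powr (s k - 1) * of_real w"
          using True by (simp add: powr_diff)
        finally show ?thesis using True by (simp add: q_def)
      qed (simp add: H_def q_def)
    qed simp
    also have "\<dots> = of_real L * (ck k * mellin g (s k))"
      unfolding mellin_def set_lebesgue_integral_def by (simp only: integral_mult_right_zero mult.assoc)
    finally show ?thesis using L_pos by simp
  qed
  have "(fcoeff L D has_sum D 0) UNIV"
    by (rule fourier_series_at_0[OF L_pos continuous_on_subset[OF D_cont] D_L]) (use summ coeff in auto)
  moreover have "D 0 = integral\<^sup>L \<phi> G"
    unfolding \<phi>_integral_tail[OF deriv cont G0 int] D_def by simp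
  moreover have "fcoeff L D = (\<lambda>k. ck k * mellin g (s k))" by (rule ext) (rule coeff)
  ultimately show ?thesis by (simp only:)
qed

end

subsection \<open>Decay of the Gamma function on vertical lines\<close>

lemma norm_Gamma_le:
  assumes "Re z > 0"
  shows "norm (Gamma z) \<le> Gamma (Re z)"
proof -
  have "norm (Gamma z) \<le> (LINT t:{0<..}|lborel. norm (of_real t powr (z - 1) * exp (- complex_of_real t)))"
    unfolding Gamma_kernel_integral_1[OF assms, symmetric]
    by (rule set_integral_norm_bound) (use Gamma_kernel_integrable[OF assms, of 1] in simp)
  moreover have "complex_of_real (LINT t:{0<..}|lborel. norm (of_real t powr (z - 1) * exp (- complex_of_real t))) =
      complex_of_real (Gamma (Re z))"
  proof -
    have "complex_of_real (LINT t:{0<..}|lborel. norm (of_real t powr (z - 1) * exp (- complex_of_real t))) =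
      (LINT t:{0<..}|lborel. complex_of_real (norm (of_real t powr (z - 1) * exp (- complex_of_real t))))"
      by (rule set_integral_complex_of_real[symmetric])
    also have "\<dots> = (LINT t:{0<..}|lborel. of_real t powr (of_real (Re z) - 1) * exp (- complex_of_real t))"
    proof (rule set_lebesgue_integral_cong)
      have "complex_of_real (norm (of_real t powr (z - 1) * exp (- complex_of_real t))) =
          of_real t powr (of_real (Re z) - 1) * exp (- complex_of_real t)" if "t > 0" for t
      proof -
        have "complex_of_real t powr (of_real (Re z) - 1) = of_real (t powr (Re z - 1))"
          using that by (subst powr_of_real[symmetric]) auto
        moreover have "exp (- complex_of_real t) = of_real (exp (- t))" by (simp flip: exp_of_real)
        moreover have "norm (of_real t powr (z - 1) * exp (- complex_of_real t)) = t powr (Re z - 1) * exp (- t)"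
          using that by (simp add: norm_mult norm_powr_real_powr norm_exp_eq_Re)
        ultimately show ?thesis by simp
      qed
      thus "\<forall>t. t \<in> {0<..} \<longrightarrow> complex_of_real (norm (of_real t powr (z - 1) * exp (- complex_of_real t))) =
          of_real t powr (of_real (Re z) - 1) * exp (- complex_of_real t)" by simp
    qed simp
    also have "\<dots> = Gamma (of_real (Re z))" by (rule Gamma_kernel_integral_1) (use assms in simp)
    finally show ?thesis by (simp only: Gamma_complex_of_real)
  qed
  ultimately show ?thesis by (simp only: of_real_eq_iff)
qed

text \<open>
  The decay in \<open>y\<close> comes from comparing with \<open>Gamma (3 m + \<i> y)\<close> through the recurrence: each of
  the \<open>2 m\<close> factors gains \<open>sqrt (1 + y\<^sup>2 / (9 m\<^sup>2))\<close>, and Bernoulli's inequality applies.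
\<close>
lemma norm_Gamma_vertical_le:
  fixes y :: real and m :: nat
  assumes m: "m > 0"
  shows "norm (Gamma (of_nat m + \<i> * of_real y)) * (1 + y\<^sup>2 / (9 * real m)) \<le> Gamma (real m)"
proof -
  define z where "z = of_nat m + \<i> * complex_of_real y"
  have z: "Re z = real m" "Im z = y" by (auto simp: z_def)
  have zp: "Re z > 0" using m z by simp
  define u where "u = 1 + y\<^sup>2 / (9 * (real m)\<^sup>2)"
  have u: "u \<ge> 1" by (simp add: u_def)
  have "norm (Gamma z) * norm (pochhammer z (2 * m)) = norm (Gamma (z + of_nat (2 * m)))"
    by (simp only: Gamma_pochhammer[OF zp] norm_mult)
  also have "\<dots> \<le> Gamma (Re (z + of_nat (2 * m)))" by (rule norm_Gamma_le) (use zp in auto)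
  also have "Re (z + of_nat (2 * m)) = real m + of_nat (2 * m)" using z by simp
  also have "Gamma (real m + of_nat (2 * m)) = Gamma (real m) * pochhammer (real m) (2 * m)"
  proof -
    have "real m \<notin> \<int>\<^sub>\<le>\<^sub>0" using m by (auto elim!: nonpos_Ints_cases)
    thus ?thesis by (simp add: pochhammer_Gamma Gamma_eq_zero_iff)
  qed
  finally have 1: "norm (Gamma z) * norm (pochhammer z (2 * m)) \<le> Gamma (real m) * pochhammer (real m) (2 * m)" .
  have "pochhammer (real m) (2 * m) * sqrt u ^ (2 * m) = (\<Prod>i<2*m. (real m + real i) * sqrt u)"
    by (simp add: pochhammer_prod prod.distrib atLeast0LessThan)
  also have "\<dots> \<le> (\<Prod>i<2*m. norm (z + of_nat i))"
  proof (rule prod_mono, safe)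
    fix i assume i: "i < 2 * m"
    show "0 \<le> (real m + real i) * sqrt u" using u by simp
    have "((real m + real i) * sqrt u)\<^sup>2 = (real m + real i)\<^sup>2 * u"
      using u by (simp add: power_mult_distrib)
    also have "\<dots> = (real m + real i)\<^sup>2 + y\<^sup>2 * ((real m + real i)\<^sup>2 / (3 * real m)\<^sup>2)"
      by (simp add: u_def power_mult_distrib distrib_left mult_ac)
    also have "\<dots> \<le> (real m + real i)\<^sup>2 + y\<^sup>2 * 1"
    proof -
      have "(real m + real i)\<^sup>2 \<le> (3 * real m)\<^sup>2" using i by (intro power_mono) auto
      hence "(real m + real i)\<^sup>2 / (3 * real m)\<^sup>2 \<le> 1" using m by simp
      thus ?thesis by (intro add_left_mono mult_left_mono) auto
    qed
    also have "\<dots> = (norm (z + of_nat i))\<^sup>2" by (simp add: cmod_power2 z)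
    finally show "(real m + real i) * sqrt u \<le> norm (z + of_nat i)" by (rule power2_le_imp_le) simp
  qed
  also have "\<dots> = norm (pochhammer z (2 * m))"
    by (simp add: pochhammer_prod prod_norm atLeast0LessThan)
  finally have 2: "pochhammer (real m) (2 * m) * u ^ m \<le> norm (pochhammer z (2 * m))"
    using u by (simp add: power_mult)
  have 3: "1 + y\<^sup>2 / (9 * real m) \<le> u ^ m"
  proof -
    have "1 + y\<^sup>2 / (9 * real m) = 1 + real m * (y\<^sup>2 / (9 * (real m)\<^sup>2))"
      using m by (simp add: power2_eq_square)
    also have "\<dots> \<le> u ^ m" unfolding u_def by (rule Bernoulli_inequality) (simp add: order_trans[of _ 0])
    finally show ?thesis .
  qed
  have pp: "pochhammer (real m) (2 * m) > 0" using m by (intro pochhammer_pos) auto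
  have "norm (Gamma z) * (1 + y\<^sup>2 / (9 * real m)) * pochhammer (real m) (2 * m) \<le> norm (Gamma z) * (u ^ m * pochhammer (real m) (2 * m))"
    unfolding mult.assoc by (intro mult_left_mono mult_right_mono 3) (use pp in auto)
  also have "\<dots> \<le> norm (Gamma z) * norm (pochhammer z (2 * m))"
    using 2 by (intro mult_left_mono) (auto simp: mult.commute)
  also have "\<dots> \<le> Gamma (real m) * pochhammer (real m) (2 * m)" by (rule 1)
  finally show ?thesis using pp by (simp add: z_def)
qed

lemma norm_Gamma_imaginary:
  fixes y :: real
  assumes y: "y \<noteq> 0"
  shows "(norm (Gamma (\<i> * of_real y)))\<^sup>2 * (\<bar>y\<bar> * (exp (pi * \<bar>y\<bar>) - exp (- (pi * \<bar>y\<bar>)))) = 2 * pi"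
proof -
  define z where "z = \<i> * complex_of_real y"
  have "- z \<notin> \<int>\<^sub>\<le>\<^sub>0" using y by (auto elim!: nonpos_Ints_cases simp: z_def complex_eq_iff)
  hence "Gamma (1 - z) = - z * Gamma (- z)" using Gamma_plus1[of "- z"] by (simp add: add.commute)
  moreover have "Gamma (- z) = cnj (Gamma z)" by (simp add: cnj_Gamma z_def)
  ultimately have "norm (Gamma z * Gamma (1 - z)) = (norm (Gamma z))\<^sup>2 * \<bar>y\<bar>"
    by (simp add: norm_mult power2_eq_square z_def)
  moreover have "norm (Gamma z * Gamma (1 - z)) = pi / norm (sin (of_real pi * z))"
    unfolding Gamma_reflection_complex by (simp add: norm_divide)
  moreover have "norm (sin (of_real pi * z)) = (exp (pi * \<bar>y\<bar>) - exp (- (pi * \<bar>y\<bar>))) / 2"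
  proof -
    have "sin (of_real pi * z) = (exp (- of_real (pi * y)) - exp (of_real (pi * y))) / (2 * \<i>)"
      by (simp add: sin_exp_eq z_def mult_ac)
    also have "\<dots> = of_real (exp (- (pi * y)) - exp (pi * y)) / (2 * \<i>)"
      by (simp only: of_real_diff of_real_minus[symmetric] exp_of_real)
    finally have "norm (sin (of_real pi * z)) = \<bar>exp (- (pi * y)) - exp (pi * y)\<bar> / 2"
      by (simp add: norm_divide norm_mult del: of_real_diff)
    thus ?thesis by (cases "y > 0") (auto simp: abs_if mult_less_0_iff zero_less_mult_iff)
  qed
  ultimately have eq: "(norm (Gamma z))\<^sup>2 * \<bar>y\<bar> = pi / ((exp (pi * \<bar>y\<bar>) - exp (- (pi * \<bar>y\<bar>))) / 2)" by simp
  have "exp (pi * \<bar>y\<bar>) - exp (- (pi * \<bar>y\<bar>)) > 0" using y by simp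
  moreover have "q * (a * S) = 2 * pi" if "q * a = pi / (S / 2)" "S > 0" for q a S :: real
    using that by (simp add: field_simps)
  ultimately show ?thesis using eq unfolding z_def by blast
qed

lemma summable_on_int:
  fixes f :: "int \<Rightarrow> real"
  assumes "\<And>k. f k \<ge> 0" "summable (\<lambda>n. f (int n))" "summable (\<lambda>n. f (- int n))"
  shows "f summable_on UNIV"
proof -
  have "(\<lambda>n. f (int n)) summable_on UNIV" "(\<lambda>n. f (- int n)) summable_on UNIV"
    using assms by (auto intro!: norm_summable_imp_summable_on)
  hence "f summable_on range int" "f summable_on range (\<lambda>n. - int n)"
    by (subst summable_on_reindex; simp add: inj_on_def o_def)+
  hence "f summable_on (range int \<union> range (\<lambda>n. - int n))"
    by (rule summable_on_union)
  moreover have "range int \<union> range (\<lambda>n. - int n) = UNIV"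
    by (auto intro: int_cases)
  ultimately show ?thesis by simp
qed

lemma int_weight_summable: "(\<lambda>k::int. (1 + \<bar>real_of_int k\<bar>) powr (- 3 / 2)) summable_on UNIV"
proof -
  have "summable (\<lambda>n. real n powr (- 3 / 2))" by (simp add: summable_real_powr_iff)
  hence "summable (\<lambda>n. real (Suc n) powr (- 3 / 2))" by (subst summable_Suc_iff)
  thus ?thesis by (intro summable_on_int) (simp_all add: add.commute)
qed

lemma nat_weight_summable: "summable (\<lambda>j. real (j + 1) powr (- 5 / 4))"
proof -
  have "summable (\<lambda>n. real n powr (- 5 / 4))" by (simp add: summable_real_powr_iff)
  hence "summable (\<lambda>n. real (Suc n) powr (- 5 / 4))" by (subst summable_Suc_iff)
  thus ?thesis by simp
qed

context zolotarev_data
begin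

definition wt :: "int \<Rightarrow> real" where "wt k = (1 + \<bar>real_of_int k\<bar>) powr (- 3 / 2)"

lemma wt_pos: "wt k > 0" by (simp add: wt_def)

lemma wt_summable: "wt summable_on UNIV" unfolding wt_def by (rule int_weight_summable)

lemma \<tau>_pos: "c_tilde c > 0" using L_pos by (simp add: c_tilde_def)

lemma norm_1_minus_s: "norm (1 - s k) \<le> (1 + c_tilde c) * (1 + \<bar>real_of_int k\<bar>)"
proof -
  have "norm (1 - s k) \<le> 1 + \<bar>real_of_int k\<bar> * c_tilde c"
    using norm_triangle_ineq4[of 1 "s k"] \<tau>_pos by (simp add: norm_mult)
  also have "\<dots> \<le> (1 + c_tilde c) * (1 + \<bar>real_of_int k\<bar>)" using \<tau>_pos by (simp add: algebra_simps)
  finally show ?thesis .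
qed

lemma norm_ck_1_minus_s: "\<exists>C>0. \<forall>k. norm (ck k * (1 - s k)) \<le> C"
proof -
  obtain C where C: "C > 0" "\<And>k. norm (ck k) \<le> C / (1 + \<bar>real_of_int k\<bar>)" using ck_bound by auto
  have "norm (ck k * (1 - s k)) \<le> C * (1 + c_tilde c)" for k
  proof -
    have "norm (ck k * (1 - s k)) \<le> C / (1 + \<bar>real_of_int k\<bar>) * ((1 + c_tilde c) * (1 + \<bar>real_of_int k\<bar>))"
      unfolding norm_mult[of "ck k"] by (intro mult_mono C norm_1_minus_s) (use C(1) in auto)
    also have "\<dots> = C * (1 + c_tilde c)" by simp
    finally show ?thesis .
  qed
  thus ?thesis using C(1) \<tau>_pos by (intro exI[of _ "C * (1 + c_tilde c)"]) auto
qed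

lemma norm_Gamma_shift_bound:
  "\<exists>C>0. \<forall>k m. m > 0 \<longrightarrow> norm (Gamma (of_nat m + s k)) \<le> C * wt k * real m powr (3 / 4) * Gamma (real m)"
proof -
  define \<kappa> where "\<kappa> = min 1 ((c_tilde c)\<^sup>2 / 9) / 2"
  have \<kappa>: "\<kappa> > 0" "2 * \<kappa> \<le> 1" "2 * \<kappa> \<le> (c_tilde c)\<^sup>2 / 9" using \<tau>_pos by (auto simp: \<kappa>_def)
  have "norm (Gamma (of_nat m + s k)) \<le> \<kappa> powr (- (3 / 4)) * wt k * real m powr (3 / 4) * Gamma (real m)" if m: "m > 0" for k m
  proof -
    define K where "K = 1 + \<bar>real_of_int k\<bar>"
    define y where "y = of_int k * c_tilde c"
    define v where "v = 1 + y\<^sup>2 / (9 * real m)"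
    define x where "x = \<kappa> * K\<^sup>2 / real m"
    have K: "K \<ge> 1" by (simp add: K_def)
    have x0: "x > 0" using \<kappa> K m by (simp add: x_def)
    have v1: "v \<ge> 1" by (simp add: v_def)
    have "\<kappa> * K\<^sup>2 \<le> real m * v"
    proof -
      have "K\<^sup>2 \<le> 2 * (1 + (real_of_int k)\<^sup>2)"
        using sum_squares_ge_zero[of "1 - \<bar>real_of_int k\<bar>" 0]
        by (simp add: K_def power2_eq_square algebra_simps)
      hence "\<kappa> * K\<^sup>2 \<le> \<kappa> * (2 * (1 + (real_of_int k)\<^sup>2))" using \<kappa> by (intro mult_left_mono) auto
      also have "\<dots> = 2 * \<kappa> + 2 * \<kappa> * (real_of_int k)\<^sup>2" by (simp add: algebra_simps)
      also have "\<dots> \<le> 1 + (c_tilde c)\<^sup>2 / 9 * (real_of_int k)\<^sup>2"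
        using \<kappa> by (intro add_mono mult_right_mono) auto
      also have "\<dots> \<le> real m + (c_tilde c)\<^sup>2 / 9 * (real_of_int k)\<^sup>2" using m by simp
      also have "\<dots> = real m * v" using m by (simp add: v_def y_def field_simps power2_eq_square)
      finally show ?thesis .
    qed
    hence xv: "x \<le> v" using m by (simp add: x_def field_simps)
    have "x powr (3 / 4) \<le> v powr (3 / 4)" using x0 xv by (intro powr_mono2) auto
    also have "\<dots> \<le> v powr 1" using v1 by (intro powr_mono) auto
    also have "\<dots> = v" using v1 by simp
    finally have xv': "x powr (3 / 4) \<le> v" .
    have "norm (Gamma (of_nat m + s k)) * v \<le> Gamma (real m)"
      using norm_Gamma_vertical_le[OF m, of y] by (simp add: v_def y_def mult.assoc)
    moreover have "norm (Gamma (of_nat m + s k)) * x powr (3 / 4) \<le> norm (Gamma (of_nat m + s k)) * v"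
      by (intro mult_left_mono xv') auto
    ultimately have "norm (Gamma (of_nat m + s k)) * x powr (3 / 4) \<le> Gamma (real m)" by linarith
    hence "norm (Gamma (of_nat m + s k)) \<le> x powr (- (3 / 4)) * Gamma (real m)"
      using x0 by (simp add: powr_minus field_simps)
    also have "x powr (- (3 / 4)) = \<kappa> powr (- (3 / 4)) * (K\<^sup>2) powr (- (3 / 4)) / real m powr (- (3 / 4))"
      using \<kappa> K m by (simp add: x_def powr_divide powr_mult)
    also have "(K\<^sup>2) powr (- (3 / 4)) = wt k"
      using K by (simp add: wt_def K_def[symmetric] powr_powr flip: powr_numeral)
    also have "\<kappa> powr (- (3 / 4)) * wt k / real m powr (- (3 / 4)) = \<kappa> powr (- (3 / 4)) * wt k * real m powr (3 / 4)"
      by (simp only: powr_minus divide_inverse inverse_inverse_eq)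
    finally show ?thesis .
  qed
  thus ?thesis using \<kappa> by (intro exI[of _ "\<kappa> powr (- (3 / 4))"]) auto
qed

lemma Gamma_div_fact_bound:
  "\<exists>C>0. \<forall>k j. norm (Gamma (of_nat (j + 1) + s k) / fact (j + 2)) \<le> C * (wt k * real (j + 1) powr (- 5 / 4))"
proof -
  obtain C where C: "C > 0" "\<And>k m. m > 0 \<Longrightarrow> norm (Gamma (of_nat m + s k)) \<le> C * wt k * real m powr (3 / 4) * Gamma (real m)"
    using norm_Gamma_shift_bound by auto
  have "norm (Gamma (of_nat (j + 1) + s k) / fact (j + 2)) \<le> C * (wt k * real (j + 1) powr (- 5 / 4))" for k j
  proof -
    define m where "m = real (j + 1)"
    have m: "m \<ge> 1" by (simp add: m_def)
    have "Gamma (real (j + 1)) = fact j" using Gamma_fact[of j] by (simp add: add.commute)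
    moreover have "(fact (j + 2) :: real) = (m + 1) * m * fact j" by (simp add: m_def algebra_simps)
    moreover have "fact j / ((m + 1) * m * fact j) = 1 / (m * (m + 1))" using m by (simp add: divide_simps)
    ultimately have G: "Gamma (real (j + 1)) / fact (j + 2) = 1 / (m * (m + 1))" by (simp only:)
    have "norm (Gamma (of_nat (j + 1) + s k) / fact (j + 2)) = norm (Gamma (of_nat (j + 1) + s k)) / fact (j + 2)"
      by (simp only: norm_divide norm_fact)
    also have "\<dots> \<le> (C * wt k * real (j + 1) powr (3 / 4) * Gamma (real (j + 1))) / fact (j + 2)"
      by (intro divide_right_mono C) auto
    also have "\<dots> = C * wt k * (m powr (3 / 4) * (Gamma (real (j + 1)) / fact (j + 2)))"
      by (simp add: m_def)
    also have "\<dots> \<le> C * wt k * (m powr (3 / 4) * (1 / m powr 2))"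
      unfolding G using m C(1) wt_pos[of k]
      by (intro mult_left_mono divide_left_mono) (auto simp: powr_numeral power2_eq_square)
    also have "m powr (3 / 4) * (1 / m powr 2) = m powr (- 5 / 4)"
      using m by (simp add: powr_diff[symmetric] del: powr_numeral)
    finally show ?thesis by (simp add: m_def mult_ac)
  qed
  thus ?thesis using C(1) by (intro exI[of _ C]) auto
qed

lemma GL_coefficient_bound:
  "\<exists>C>0. \<forall>k j. norm (ck k * ((1 - s k) * Gamma (of_nat (j + 1) + s k) / fact (j + 2))) \<le> C * (wt k * real (j + 1) powr (- 5 / 4))"
proof -
  obtain C1 where C1: "C1 > 0" "\<And>k. norm (ck k * (1 - s k)) \<le> C1" using norm_ck_1_minus_s by auto
  obtain C2 where C2: "C2 > 0" "\<And>k j. norm (Gamma (of_nat (j + 1) + s k) / fact (j + 2)) \<le> C2 * (wt k * real (j + 1) powr (- 5 / 4))"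
    using Gamma_div_fact_bound by auto
  have "norm (ck k * ((1 - s k) * Gamma (of_nat (j + 1) + s k) / fact (j + 2))) \<le> C1 * C2 * (wt k * real (j + 1) powr (- 5 / 4))" for k j
  proof -
    have "norm (ck k * (1 - s k)) * norm (Gamma (of_nat (j + 1) + s k) / fact (j + 2)) \<le> C1 * (C2 * (wt k * real (j + 1) powr (- 5 / 4)))"
      using C1(1) by (intro mult_mono C1 C2) auto
    thus ?thesis by (simp only: norm_mult[symmetric] mult.assoc times_divide_eq_right)
  qed
  thus ?thesis using C1(1) C2(1) by (intro exI[of _ "C1 * C2"]) auto
qed

lemma Gamma_s_bound:
  "\<exists>C>0. \<forall>k. k \<noteq> 0 \<longrightarrow> norm (Gamma (s k)) * exp (pi / 2 * (\<bar>real_of_int k\<bar> * c_tilde c)) \<le> C * (1 + \<bar>real_of_int k\<bar>) powr (- (1 / 2))"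
proof -
  define \<tau> where "\<tau> = c_tilde c"
  have \<tau>: "\<tau> > 0" using \<tau>_pos by (simp add: \<tau>_def)
  define E where "E = 1 - exp (- (2 * pi * \<tau>))"
  have E: "E > 0" using \<tau> by (simp add: E_def)
  define C where "C = sqrt (4 * pi / (\<tau> * E))"
  have C: "C > 0" using \<tau> E by (simp add: C_def)
  have "norm (Gamma (s k)) * exp (pi / 2 * (\<bar>real_of_int k\<bar> * \<tau>)) \<le> C * (1 + \<bar>real_of_int k\<bar>) powr (- (1 / 2))" if k: "k \<noteq> 0" for k
  proof -
    define K where "K = 1 + \<bar>real_of_int k\<bar>"
    have k1: "\<bar>real_of_int k\<bar> \<ge> 1" using k by linarith
    have K1: "K \<ge> 1" by (simp add: K_def)
    define y where "y = of_int k * \<tau>"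
    have ay: "\<bar>y\<bar> = \<bar>real_of_int k\<bar> * \<tau>" using \<tau> by (simp add: y_def abs_mult)
    have y\<tau>: "\<bar>y\<bar> \<ge> \<tau>" using k1 \<tau> by (simp add: ay)
    have y0: "y \<noteq> 0" using k \<tau> by (simp add: y_def)
    define G where "G = norm (Gamma (\<i> * of_real y))"
    define X where "X = G * exp (pi / 2 * \<bar>y\<bar>)"
    have X0: "X \<ge> 0" by (simp add: X_def G_def)
    have X2: "X\<^sup>2 = G\<^sup>2 * exp (pi * \<bar>y\<bar>)"
      by (simp add: X_def power_mult_distrib power2_eq_square flip: exp_add)
    have "exp (pi * \<bar>y\<bar>) * E \<le> exp (pi * \<bar>y\<bar>) - exp (- (pi * \<bar>y\<bar>))"
    proof -
      have "exp (- (pi * \<bar>y\<bar>)) = exp (pi * \<bar>y\<bar>) * exp (- (2 * pi * \<bar>y\<bar>))" by (simp flip: exp_add)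
      also have "\<dots> \<le> exp (pi * \<bar>y\<bar>) * exp (- (2 * pi * \<tau>))" using y\<tau> by (intro mult_left_mono) auto
      finally show ?thesis by (simp add: E_def right_diff_distrib)
    qed
    hence "G\<^sup>2 * (\<bar>y\<bar> * (exp (pi * \<bar>y\<bar>) * E)) \<le> G\<^sup>2 * (\<bar>y\<bar> * (exp (pi * \<bar>y\<bar>) - exp (- (pi * \<bar>y\<bar>))))"
      by (intro mult_left_mono) auto
    also have "\<dots> = 2 * pi" unfolding G_def by (rule norm_Gamma_imaginary[OF y0])
    finally have "X\<^sup>2 * (\<bar>y\<bar> * E) \<le> 2 * pi" by (simp add: X2 mult_ac)
    moreover have "X\<^sup>2 * (K * \<tau> / 2 * E) \<le> X\<^sup>2 * (\<bar>y\<bar> * E)"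
      using k1 \<tau> E by (intro mult_left_mono mult_right_mono) (auto simp: ay K_def field_simps)
    ultimately have "X\<^sup>2 * (K * \<tau> / 2 * E) \<le> 2 * pi" by linarith
    hence "X\<^sup>2 \<le> 4 * pi / (\<tau> * E) / K" using \<tau> E K1 by (simp add: field_simps)
    hence "X \<le> sqrt (4 * pi / (\<tau> * E) / K)" using real_le_rsqrt by blast
    also have "\<dots> = C / sqrt K" by (simp only: C_def real_sqrt_divide)
    also have "\<dots> = C * K powr (- (1 / 2))" proof -
      have "K powr (1 / 2) = sqrt K" using K1 by (intro powr_half_sqrt) simp
      hence "K powr (- (1 / 2)) = inverse (sqrt K)" by (simp only: powr_minus)
      thus ?thesis by (simp only: divide_inverse)
    qed
    finally have "X \<le> C * K powr (- (1 / 2))" .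
    thus ?thesis by (simp add: X_def G_def K_def y_def \<tau>_def ay[unfolded y_def \<tau>_def] mult.assoc)
  qed
  thus ?thesis using C unfolding \<tau>_def by blast
qed

lemma ck_Gamma_exp_bound:
  "\<exists>C>0. \<forall>k. k \<noteq> 0 \<longrightarrow> norm (ck k * Gamma (s k)) * exp (pi / 2 * (\<bar>real_of_int k\<bar> * c_tilde c)) \<le> C * wt k"
proof -
  obtain C1 where C1: "C1 > 0" "\<And>k. norm (ck k) \<le> C1 / (1 + \<bar>real_of_int k\<bar>)" using ck_bound by auto
  obtain C2 where C2: "C2 > 0" "\<And>k. k \<noteq> 0 \<Longrightarrow> norm (Gamma (s k)) * exp (pi / 2 * (\<bar>real_of_int k\<bar> * c_tilde c)) \<le> C2 * (1 + \<bar>real_of_int k\<bar>) powr (- (1 / 2))"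
    using Gamma_s_bound by auto
  have "norm (ck k * Gamma (s k)) * exp (pi / 2 * (\<bar>real_of_int k\<bar> * c_tilde c)) \<le> C1 * C2 * wt k" if "k \<noteq> 0" for k
  proof -
    have "norm (ck k) * (norm (Gamma (s k)) * exp (pi / 2 * (\<bar>real_of_int k\<bar> * c_tilde c))) \<le>
       C1 / (1 + \<bar>real_of_int k\<bar>) * (C2 * (1 + \<bar>real_of_int k\<bar>) powr (- (1 / 2)))"
      by (intro mult_mono C1 C2 that) (use C1(1) in auto)
    also have "\<dots> = C1 * C2 * ((1 + \<bar>real_of_int k\<bar>) powr (- (1 / 2)) / (1 + \<bar>real_of_int k\<bar>) powr 1)"
      by simp
    also have "\<dots> = C1 * C2 * wt k" unfolding wt_def powr_diff[symmetric] by simp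
    finally show ?thesis by (simp only: norm_mult mult.assoc)
  qed
  thus ?thesis using C1(1) C2(1) by (intro exI[of _ "C1 * C2"]) auto
qed

lemma ck_Gamma_bound: "\<exists>C>0. \<forall>k. k \<noteq> 0 \<longrightarrow> norm (ck k * ((1 - s k) * Gamma (s k))) \<le> C * wt k"
proof -
  define \<tau> where "\<tau> = c_tilde c"
  have \<tau>: "\<tau> > 0" using \<tau>_pos by (simp add: \<tau>_def)
  obtain C where C: "C > 0" "\<And>k. k \<noteq> 0 \<Longrightarrow> norm (ck k * Gamma (s k)) * exp (pi / 2 * (\<bar>real_of_int k\<bar> * \<tau>)) \<le> C * wt k"
    using ck_Gamma_exp_bound unfolding \<tau>_def by auto
  have "norm (ck k * ((1 - s k) * Gamma (s k))) \<le> (1 + 2 / pi) * C * wt k" if k: "k \<noteq> 0" for k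
  proof -
    have k1: "\<bar>real_of_int k\<bar> \<ge> 1" using k by linarith
    have "norm (1 - s k) \<le> 1 + \<bar>real_of_int k\<bar> * \<tau>"
      using norm_triangle_ineq4[of 1 "s k"] \<tau> by (simp add: norm_mult \<tau>_def)
    also have "\<dots> \<le> (1 + 2 / pi) * (1 + pi / 2 * (\<bar>real_of_int k\<bar> * \<tau>))"
    proof -
      have "(1 + 2 / pi) * (1 + pi / 2 * x) = 1 + 2 / pi + pi / 2 * x + x" for x by (simp add: field_simps)
      note this[of "\<bar>real_of_int k\<bar> * \<tau>"]
      moreover have "pi / 2 * (\<bar>real_of_int k\<bar> * \<tau>) \<ge> 0" "2 / pi \<ge> 0" using \<tau> by auto
      ultimately show ?thesis by linarith
    qed
    also have "\<dots> \<le> (1 + 2 / pi) * exp (pi / 2 * (\<bar>real_of_int k\<bar> * \<tau>))"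
      by (intro mult_left_mono exp_ge_add_one_self) auto
    finally have "norm (1 - s k) * norm (ck k * Gamma (s k)) \<le> (1 + 2 / pi) * exp (pi / 2 * (\<bar>real_of_int k\<bar> * \<tau>)) * norm (ck k * Gamma (s k))"
      by (intro mult_right_mono) auto
    also have "\<dots> = (1 + 2 / pi) * (norm (ck k * Gamma (s k)) * exp (pi / 2 * (\<bar>real_of_int k\<bar> * \<tau>)))"
      by (simp only: mult_ac)
    also have "\<dots> \<le> (1 + 2 / pi) * (C * wt k)"
      by (intro mult_left_mono C k) auto
    finally show ?thesis by (simp only: norm_mult mult_ac)
  qed
  thus ?thesis using C(1) by (intro exI[of _ "(1 + 2 / pi) * C"]) (auto intro!: mult_pos_pos add_pos_pos)
qed

end

subsection \<open>Mellin series of the elementary kernels\<close>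

lemma norm_exp_minus_1_minus_le:
  fixes w :: complex
  assumes "Re w \<le> 0"
  shows "norm (exp w - 1 - w) \<le> (norm w)\<^sup>2"
proof -
  define S where "S = {z. Re z \<le> 0} \<inter> cball 0 (norm w)"
  have "norm ((exp w - w) - (exp 0 - 0)) \<le> norm w * norm (w - 0)"
  proof (rule field_differentiable_bound[where S = S and f' = "\<lambda>z. exp z - 1"])
    show "convex S" unfolding S_def by (intro convex_Int convex_halfspace_Re_le convex_cball)
    show "((\<lambda>z. exp z - z) has_field_derivative exp z - 1) (at z within S)" for z
      by (auto intro!: derivative_eq_intros)
    show "norm (exp z - 1) \<le> norm w" if "z \<in> S" for z
      using norm_exp_diff_le[of z 0 0] that by (simp add: S_def)
  qed (use assms in \<open>auto simp: S_def\<close>)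
  thus ?thesis by (simp add: power2_eq_square algebra_simps)
qed

lemma min_1_square_le:
  fixes y :: real
  assumes y: "y > 0"
  shows "min 1 (y\<^sup>2) \<le> 6 * (1 - exp (- y) - y * exp (- y))"
proof -
  define B where "B = (\<lambda>y::real. 1 - exp (- y) - y * exp (- y))"
  have dB: "(B has_real_derivative t * exp (- t)) (at t)" for t
    unfolding B_def by (auto intro!: derivative_eq_intros simp: algebra_simps)
  have 1: "t\<^sup>2 / 6 \<le> B t" if t: "0 \<le> t" "t \<le> 1" for t
  proof -
    have "B 0 - 0\<^sup>2 / 6 \<le> B t - t\<^sup>2 / 6"
    proof (rule DERIV_nonneg_imp_nondecreasing[OF t(1)])
      fix x assume x: "0 \<le> x" "x \<le> t"
      have "exp (1::real) \<le> 3" by (rule exp_le)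
      hence "1 / 3 \<le> exp (- 1 :: real)" by (simp add: exp_minus field_simps)
      also have "\<dots> \<le> exp (- x)" using x t by simp
      finally have "x * (1 / 3) \<le> x * exp (- x)" using x by (intro mult_left_mono)
      moreover have "((\<lambda>t. B t - t\<^sup>2 / 6) has_real_derivative x * exp (- x) - x * (1 / 3)) (at x)"
        by (auto intro!: derivative_eq_intros dB)
      ultimately show "\<exists>d. ((\<lambda>t. B t - t\<^sup>2 / 6) has_real_derivative d) (at x) \<and> 0 \<le> d"
        by (intro exI conjI) auto
    qed
    thus ?thesis by (simp add: B_def)
  qed
  show ?thesis
  proof (cases "y \<le> 1")
    case True
    have "min 1 (y\<^sup>2) \<le> y\<^sup>2" by simp
    thus ?thesis using 1[of y] y True by (simp add: B_def)
  next
    case False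
    have "B 1 \<le> B y"
    proof (rule DERIV_nonneg_imp_nondecreasing[where f = B])
      fix x :: real assume "1 \<le> x" "x \<le> y"
      thus "\<exists>d. (B has_real_derivative d) (at x) \<and> 0 \<le> d"
        using dB[of x] by (intro exI conjI) auto
    qed (use False in simp)
    moreover have "min 1 (y\<^sup>2) \<le> 1" by simp
    ultimately show ?thesis using 1[of 1] by (simp add: B_def)
  qed
qed

lemma has_sum_dominated_limit:
  fixes f :: "nat \<Rightarrow> int \<Rightarrow> complex"
  assumes sum: "\<And>n. (f n has_sum S n) UNIV" and lim: "\<And>k. (\<lambda>n. f n k) \<longlonglongrightarrow> g k"
    and bd: "\<And>n k. norm (f n k) \<le> b k" and b: "b summable_on UNIV" and S: "S \<longlonglongrightarrow> T"
  shows "(g has_sum T) UNIV"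
proof -
  have b': "(\<lambda>k. norm (b k)) summable_on UNIV" using b by (rule iffD1[OF summable_on_iff_abs_summable_on_real])
  have fs: "(\<lambda>k. norm (f n k)) summable_on UNIV" for n
    by (rule Infinite_Sum.abs_summable_on_comparison_test[OF b']) (simp, rule order_trans[OF bd abs_ge_self])
  have gb: "norm (g k) \<le> b k" for k
    by (rule LIMSEQ_le_const2[OF tendsto_norm[OF lim[of k]]]) (use bd in auto)
  have gs: "(\<lambda>k. norm (g k)) summable_on UNIV"
    by (rule Infinite_Sum.abs_summable_on_comparison_test[OF b']) (simp, rule order_trans[OF gb abs_ge_self])
  have bs: "summable (\<lambda>n. b (int n) + b (- 1 - int n))"
    using has_sum_int_nat[OF b'] by (rule sums_summable)
  have "(\<lambda>m. \<Sum>n. f m (int n) + f m (- 1 - int n)) \<longlonglongrightarrow> (\<Sum>n. g (int n) + g (- 1 - int n))"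
  proof (rule tannerys_theorem[THEN conjunct2, THEN conjunct2, OF _ _ bs])
    show "(\<lambda>m. f m (int n) + f m (- 1 - int n)) \<longlonglongrightarrow> g (int n) + g (- 1 - int n)" for n
      by (intro tendsto_add lim)
    have "norm (f m (int n) + f m (- 1 - int n)) \<le> b (int n) + b (- 1 - int n)" for m n
      by (intro norm_triangle_le add_mono bd)
    thus "\<forall>\<^sub>F (n, m) in sequentially \<times>\<^sub>F sequentially. norm (f m (int n) + f m (- 1 - int n)) \<le> b (int n) + b (- 1 - int n)"
      by (intro always_eventually) auto
  qed auto
  moreover have "(\<Sum>n. f m (int n) + f m (- 1 - int n)) = S m" for m
    using has_sum_int_nat[OF fs[of m]] infsumI[OF sum[of m]] by (simp add: sums_iff)
  ultimately have "S \<longlonglongrightarrow> (\<Sum>n. g (int n) + g (- 1 - int n))" by simp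
  hence "(\<Sum>n. g (int n) + g (- 1 - int n)) = T" using S by (rule LIMSEQ_unique)
  hence "infsum g UNIV = T" using has_sum_int_nat[OF gs] by (simp add: sums_iff)
  thus ?thesis using has_sum_infsum[OF abs_summable_summable[OF gs]] by simp
qed

definition cpoisson :: "real \<Rightarrow> nat \<Rightarrow> real \<Rightarrow> complex" where
  "cpoisson q n y = exp (- (of_real q * of_real y)) * (of_real q * of_real y) ^ n / fact n"

lemma cpoisson_vector_derivative:
  "(cpoisson q (Suc n) has_vector_derivative of_real q * (cpoisson q n y - cpoisson q (Suc n) y)) (at y)"
  "(cpoisson q 0 has_vector_derivative - of_real q * cpoisson q 0 y) (at y)"
proof -
  have "((\<lambda>z. exp (- (of_real q * z)) * (of_real q * z) ^ Suc n / fact (Suc n)) has_field_derivative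
     of_real q * (cpoisson q n y - cpoisson q (Suc n) y)) (at (of_real y))"
  proof -
    define e X where "e = exp (- (of_real q * complex_of_real y))" and "X = of_real q * complex_of_real y"
    have 1: "((\<lambda>z. exp (- (of_real q * z)) * (of_real q * z) ^ Suc n) has_field_derivative
        (- of_real q * e * X ^ Suc n + e * (of_nat (Suc n) * X ^ n * of_real q))) (at (of_real y))"
      unfolding e_def X_def by (rule derivative_eq_intros refl | simp add: algebra_simps)+
    have "(- Q * e * Y + e * (N * Z * Q)) / (N * F) = Q * (e * Z / F - e * Y / (N * F))"
      if "N \<noteq> 0" "F \<noteq> 0" for Q Y N Z F :: complex
      using that by (simp add: field_simps)
    from this[OF of_nat_neq_0 fact_nonzero, of "of_real q" "X ^ Suc n" n "X ^ n" n]
    have 2: "(- of_real q * e * X ^ Suc n + e * (of_nat (Suc n) * X ^ n * of_real q)) / fact (Suc n) =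
        of_real q * (cpoisson q n y - cpoisson q (Suc n) y)"
      unfolding cpoisson_def e_def X_def fact_Suc by simp
    show ?thesis using DERIV_cdivide[OF 1, of "fact (Suc n)"] unfolding 2 .
  qed
  thus "(cpoisson q (Suc n) has_vector_derivative of_real q * (cpoisson q n y - cpoisson q (Suc n) y)) (at y)"
    unfolding cpoisson_def by (rule has_vector_derivative_real_field)
  have "((\<lambda>z. exp (- (of_real q * z)) * (of_real q * z) ^ 0 / fact 0) has_field_derivative
     - of_real q * cpoisson q 0 y) (at (of_real y))"
    unfolding cpoisson_def by (auto intro!: derivative_eq_intros)
  thus "(cpoisson q 0 has_vector_derivative - of_real q * cpoisson q 0 y) (at y)"
    unfolding cpoisson_def by (rule has_vector_derivative_real_field)
qed

lemma continuous_on_cpoisson [continuous_intros]: "continuous_on A (cpoisson q n)"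
  unfolding cpoisson_def by (intro continuous_intros) auto

lemma
  assumes q: "q > 0" and n: "n > 0" and z: "Re z \<ge> 0"
  shows cpoisson_mellin_integrable: "set_integrable lborel {0<..} (\<lambda>y. of_real y powr (z - 1) * cpoisson q n y)"
    and mellin_cpoisson: "mellin (cpoisson q n) z = Gamma (of_nat n + z) / fact n * of_real q powr (- z)"
proof -
  define K where "K = (\<lambda>y. of_real y powr (z + of_nat n - 1) * exp (- (of_real q * complex_of_real y)))"
  have zn: "Re (z + of_nat n) > 0" using z n by simp
  have K_int: "set_integrable lborel {0<..} K"
    unfolding K_def by (rule Gamma_kernel_integrable) (use zn q in auto)
  have eq: "of_real y powr (z - 1) * cpoisson q n y = of_real q ^ n / fact n * K y" if "y > 0" for y
  proof -
    have "complex_of_real y powr (z + of_nat n - 1) = of_real y powr (z - 1) * of_real y powr of_nat n"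
      by (subst powr_add[symmetric]) (simp add: algebra_simps)
    also have "complex_of_real y powr of_nat n = of_real y ^ n" using that by (simp add: powr_nat')
    finally show ?thesis by (simp add: K_def cpoisson_def power_mult_distrib)
  qed
  have "set_integrable lborel {0<..} (\<lambda>y. of_real q ^ n / fact n * K y)"
    using K_int by (rule set_integrable_mult_right)
  moreover have "set_integrable lborel {0<..} (\<lambda>y. of_real q ^ n / fact n * K y) \<longleftrightarrow>
      set_integrable lborel {0<..} (\<lambda>y. of_real y powr (z - 1) * cpoisson q n y)"
    by (rule set_integrable_cong) (auto simp: eq)
  ultimately show "set_integrable lborel {0<..} (\<lambda>y. of_real y powr (z - 1) * cpoisson q n y)" by blast
  have "mellin (cpoisson q n) z = (LINT y:{0<..}|lborel. of_real q ^ n / fact n * K y)"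
    unfolding mellin_def by (rule set_lebesgue_integral_cong) (auto simp: eq)
  also have "\<dots> = of_real q ^ n / fact n * (Gamma (z + of_nat n) * of_real q powr (- (z + of_nat n)))"
    unfolding K_def set_integral_mult_right by (subst Gamma_kernel_integral) (use zn q in auto)
  also have "complex_of_real q powr (- (z + of_nat n)) = of_real q powr (- z) / of_real q ^ n"
  proof -
    have "complex_of_real q powr (- (z + of_nat n)) = of_real q powr (- z) / of_real q powr of_nat n"
      by (subst powr_diff[symmetric]) simp
    thus ?thesis using q by (simp add: powr_nat')
  qed
  finally show "mellin (cpoisson q n) z = Gamma (of_nat n + z) / fact n * of_real q powr (- z)"
    using q by (simp add: add.commute)
qed

lemma cpoisson_div_integrable:
  assumes "q > 0" "n > 0"
  shows "set_integrable lborel {0<..} (\<lambda>y. cpoisson q n y / of_real y)"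
proof -
  have "set_integrable lborel {0<..} (\<lambda>y. of_real y powr (0 - 1) * cpoisson q n y) \<longleftrightarrow>
      set_integrable lborel {0<..} (\<lambda>y. cpoisson q n y / of_real y)"
    by (rule set_integrable_cong) (auto simp: powr_minus divide_inverse)
  thus ?thesis using cpoisson_mellin_integrable[OF assms, of 0] by simp
qed

lemma mellin_cmult: "mellin (\<lambda>y. a * g y) z = a * mellin g z"
  unfolding mellin_def by (simp add: mult.left_commute)

lemma mellin_add:
  assumes "set_integrable lborel {0<..} (\<lambda>y. of_real y powr (z - 1) * f y)"
    "set_integrable lborel {0<..} (\<lambda>y. of_real y powr (z - 1) * g y)"
  shows "mellin (\<lambda>y. f y + g y) z = mellin f z + mellin g z"
  unfolding mellin_def using assms by (simp only: distrib_left set_integral_add)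

lemma mellin_diff:
  assumes "set_integrable lborel {0<..} (\<lambda>y. of_real y powr (z - 1) * f y)"
    "set_integrable lborel {0<..} (\<lambda>y. of_real y powr (z - 1) * g y)"
  shows "mellin (\<lambda>y. f y - g y) z = mellin f z - mellin g z"
  unfolding mellin_def using assms by (simp only: right_diff_distrib set_integral_diff)

definition cpoisson_defect :: "real \<Rightarrow> real \<Rightarrow> complex" where "cpoisson_defect q y = cpoisson q 0 y + cpoisson q 1 y - 1"

context zolotarev_data
begin

lemma Re_s [simp]: "Re (s k) = 0" by simp

lemma summable_wt_bound:
  fixes f :: "int \<Rightarrow> complex"
  assumes "\<And>k. norm (f k) \<le> C * wt k"
  shows "(\<lambda>k. norm (f k)) summable_on UNIV"
proof -
  have "(\<lambda>k. C * wt k) summable_on UNIV" using wt_summable by (rule summable_on_cmult_right)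
  hence "(\<lambda>k. norm (C * wt k)) summable_on UNIV" by (rule iffD1[OF summable_on_iff_abs_summable_on_real])
  thus ?thesis
  proof (rule Infinite_Sum.abs_summable_on_comparison_test)
    fix k
    have "norm (f k) \<le> \<bar>C * wt k\<bar>" using assms[of k] abs_ge_self[of "C * wt k"] by (rule order_trans)
    thus "norm (f k) \<le> norm (C * wt k)" unfolding real_norm_def .
  qed
qed

lemma norm_real_powr_s [simp]: "q > 0 \<Longrightarrow> norm (of_real q powr (- s k)) = 1" "q > 0 \<Longrightarrow> norm (of_real q powr (s k)) = 1"
  by (simp_all add: norm_powr_real_powr)

definition GL_weight :: "real \<Rightarrow> int \<Rightarrow> nat \<Rightarrow> complex" where
  "GL_weight q k j = of_real q * of_real q powr (- s k) * ((1 - s k) * Gamma (of_nat (j + 1) + s k) / fact (j + 2))"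

lemma norm_GL_weight_bound:
  assumes "q > 0"
  shows "\<exists>C>0. \<forall>k j. norm (ck k * GL_weight q k j) \<le> C * (wt k * real (j + 1) powr (- 5 / 4))"
proof -
  obtain C where C: "C > 0" "\<And>k j. norm (ck k * ((1 - s k) * Gamma (of_nat (j + 1) + s k) / fact (j + 2))) \<le> C * (wt k * real (j + 1) powr (- 5 / 4))"
    using GL_coefficient_bound by auto
  have "norm (ck k * GL_weight q k j) \<le> q * C * (wt k * real (j + 1) powr (- 5 / 4))" for k j
  proof -
    have "norm (ck k * GL_weight q k j) = q * norm (ck k * ((1 - s k) * Gamma (of_nat (j + 1) + s k) / fact (j + 2)))"
      using assms unfolding GL_weight_def norm_mult norm_real_powr_s[OF assms] by simp
    also have "\<dots> \<le> q * (C * (wt k * real (j + 1) powr (- 5 / 4)))"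
      by (intro mult_left_mono C) (use assms in auto)
    finally show ?thesis by (simp only: mult.assoc)
  qed
  thus ?thesis using C(1) assms by (intro exI[of _ "q * C"]) auto
qed

lemma
  assumes q: "q > 0"
  shows cpoisson_\<phi>_integrable: "integrable \<phi> (cpoisson q (j + 2))"
    and cpoisson_\<phi>_has_sum: "((\<lambda>k. ck k * GL_weight q k j) has_sum integral\<^sup>L \<phi> (cpoisson q (j + 2))) UNIV"
proof -
  define g where "g = (\<lambda>y. of_real q * (cpoisson q (Suc j) y - cpoisson q (Suc (Suc j)) y))"
  have d: "(cpoisson q (j + 2) has_vector_derivative g y) (at y)" for y
    using cpoisson_vector_derivative(1)[of q "Suc j" y] by (simp add: g_def)
  have c: "continuous_on UNIV g" unfolding g_def by (intro continuous_intros)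
  have z: "cpoisson q (j + 2) 0 = 0" by (simp add: cpoisson_def)
  have i: "set_integrable lborel {0<..} (\<lambda>w. g w / of_real w)"
  proof -
    have "set_integrable lborel {0<..} (\<lambda>w. of_real q * (cpoisson q (Suc j) w / of_real w - cpoisson q (Suc (Suc j)) w / of_real w))"
      by (intro set_integrable_mult_right set_integral_diff(1) cpoisson_div_integrable q) auto
    thus ?thesis by (simp only: g_def diff_divide_distrib times_divide_eq_right[symmetric])
  qed
  have m: "mellin g (s k) = GL_weight q k j" for k
  proof -
    have "mellin g (s k) = of_real q * (Gamma (of_nat (Suc j) + s k) / fact (Suc j) * of_real q powr (- s k)
        - Gamma (of_nat (Suc (Suc j)) + s k) / fact (Suc (Suc j)) * of_real q powr (- s k))"
      unfolding g_def mellin_cmult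
      by (subst mellin_diff) (auto intro!: cpoisson_mellin_integrable q simp: mellin_cpoisson[OF q] simp del: of_nat_Suc)
    also have "Gamma (of_nat (Suc (Suc j)) + s k) = (of_nat (Suc j) + s k) * Gamma (of_nat (Suc j) + s k)"
    proof -
      have "of_nat (Suc j) + s k \<notin> \<int>\<^sub>\<le>\<^sub>0" by (auto elim!: nonpos_Ints_cases simp: complex_eq_iff)
      from Gamma_plus1[OF this] show ?thesis by (simp add: add_ac)
    qed
    also have "of_real q * (Gamma (of_nat (Suc j) + s k) / fact (Suc j) * of_real q powr (- s k)
        - (of_nat (Suc j) + s k) * Gamma (of_nat (Suc j) + s k) / fact (Suc (Suc j)) * of_real q powr (- s k)) =
       of_real q * of_real q powr (- s k) * ((of_nat (Suc (Suc j)) - (of_nat (Suc j) + s k)) * Gamma (of_nat (Suc j) + s k) / fact (Suc (Suc j)))"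
    proof -
      have "Q * (G / F * P - X * G / (N * F) * P) = Q * P * ((N - X) * G / (N * F))" if "N \<noteq> 0" "F \<noteq> 0" for Q G F P X N :: complex
        using that by (simp add: field_simps)
      moreover have "of_nat (Suc (Suc j)) \<noteq> (0 :: complex)" using of_nat_neq_0 .
      moreover have "fact (Suc (Suc j)) = of_nat (Suc (Suc j)) * (fact (Suc j) :: complex)" by (rule fact_Suc)
      ultimately show ?thesis using fact_nonzero by metis
    qed
    also have "of_nat (Suc (Suc j)) - (of_nat (Suc j) + s k) = 1 - s k" by simp
    finally show ?thesis unfolding GL_weight_def by simp
  qed
  show "integrable \<phi> (cpoisson q (j + 2))" by (rule \<phi>_integrable_tail[OF d c z i])
  obtain C where C: "\<And>k j. norm (ck k * GL_weight q k j) \<le> C * (wt k * real (j + 1) powr (- 5 / 4))"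
    using norm_GL_weight_bound[OF q] by auto
  have "(\<lambda>k. norm (ck k * GL_weight q k j)) summable_on UNIV"
    by (rule summable_wt_bound[where C = "C * real (j + 1) powr (- 5 / 4)"]) (use C[of _ j] in \<open>simp add: mult_ac\<close>)
  thus "((\<lambda>k. ck k * GL_weight q k j) has_sum integral\<^sup>L \<phi> (cpoisson q (j + 2))) UNIV"
    using \<phi>_integral_mellin_series[OF d c z i] by (simp only: m)
qed

lemma ck_Gamma_1_bound: "\<exists>C>0. \<forall>k. norm (ck k * Gamma (1 + s k)) \<le> C * wt k"
proof -
  obtain C1 where C1: "C1 > 0" "\<And>k. norm (ck k) \<le> C1 / (1 + \<bar>real_of_int k\<bar>)" using ck_bound by auto
  obtain C2 where C2: "C2 > 0" "\<And>k m. m > 0 \<Longrightarrow> norm (Gamma (of_nat m + s k)) \<le> C2 * wt k * real m powr (3 / 4) * Gamma (real m)"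
    using norm_Gamma_shift_bound by auto
  have "norm (ck k * Gamma (1 + s k)) \<le> C1 * C2 * wt k" for k
  proof -
    have "C1 / (1 + \<bar>real_of_int k\<bar>) \<le> C1 / 1" using C1(1) by (intro divide_left_mono) auto
    hence "norm (ck k) \<le> C1" using C1(2)[of k] by simp
    moreover have "norm (Gamma (1 + s k)) \<le> C2 * wt k" using C2(2)[of 1 k] by simp
    ultimately have "norm (ck k) * norm (Gamma (1 + s k)) \<le> C1 * (C2 * wt k)"
      using C1(1) by (intro mult_mono) auto
    thus ?thesis by (simp only: norm_mult mult.assoc)
  qed
  thus ?thesis using C1(1) C2(1) by (intro exI[of _ "C1 * C2"]) auto
qed

lemma
  assumes q: "q > 0"
  shows cpoisson_defect_\<phi>_integrable: "integrable \<phi> (cpoisson_defect q)"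
    and cpoisson_defect_\<phi>_has_sum: "((\<lambda>k. ck k * (- of_real q * of_real q powr (- s k) * Gamma (1 + s k))) has_sum integral\<^sup>L \<phi> (cpoisson_defect q)) UNIV"
proof -
  define g where "g = (\<lambda>y. - of_real q * cpoisson q 1 y)"
  have d: "(cpoisson_defect q has_vector_derivative g y) (at y)" for y
  proof -
    have "((\<lambda>y. cpoisson q 0 y + cpoisson q (Suc 0) y - 1) has_vector_derivative
       - of_real q * cpoisson q 0 y + of_real q * (cpoisson q 0 y - cpoisson q (Suc 0) y) - 0) (at y)"
      by (intro has_vector_derivative_add has_vector_derivative_diff cpoisson_vector_derivative has_vector_derivative_const)
    thus ?thesis by (simp add: cpoisson_defect_def[abs_def] g_def algebra_simps)
  qed
  have c: "continuous_on UNIV g" unfolding g_def by (intro continuous_intros)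
  have z: "cpoisson_defect q 0 = 0" by (simp add: cpoisson_defect_def cpoisson_def)
  have i: "set_integrable lborel {0<..} (\<lambda>w. g w / of_real w)"
    using set_integrable_mult_right[OF cpoisson_div_integrable[OF q, of 1], of "- of_real q"] by (simp add: g_def)
  have m: "mellin g (s k) = - of_real q * of_real q powr (- s k) * Gamma (1 + s k)" for k
    unfolding g_def mellin_cmult using mellin_cpoisson[OF q, of 1 "s k"] by simp
  show "integrable \<phi> (cpoisson_defect q)" by (rule \<phi>_integrable_tail[OF d c z i])
  obtain C where C: "\<And>k. norm (ck k * Gamma (1 + s k)) \<le> C * wt k" using ck_Gamma_1_bound by auto
  have "(\<lambda>k. norm (ck k * (- of_real q * of_real q powr (- s k) * Gamma (1 + s k)))) summable_on UNIV"
  proof (rule summable_wt_bound[where C = "q * C"])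
    fix k
    have "norm (ck k * (- of_real q * of_real q powr (- s k) * Gamma (1 + s k))) = q * norm (ck k * Gamma (1 + s k))"
      unfolding norm_mult norm_real_powr_s[OF q] norm_minus_cancel using q by simp
    also have "\<dots> \<le> q * (C * wt k)" by (intro mult_left_mono C) (use q in auto)
    finally show "norm (ck k * (- of_real q * of_real q powr (- s k) * Gamma (1 + s k))) \<le> q * C * wt k" by (simp only: mult.assoc)
  qed
  thus "((\<lambda>k. ck k * (- of_real q * of_real q powr (- s k) * Gamma (1 + s k))) has_sum integral\<^sup>L \<phi> (cpoisson_defect q)) UNIV"
    using \<phi>_integral_mellin_series[OF d c z i] by (simp only: m)
qed

lemma min_1_square_\<phi>_integrable: "integrable \<phi> (\<lambda>y. min 1 (y\<^sup>2))"
proof (rule Bochner_Integration.integrable_bound)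
  show "integrable \<phi> (\<lambda>y. 6 * norm (cpoisson_defect 1 y))" by (intro integrable_mult_right integrable_norm cpoisson_defect_\<phi>_integrable) simp
  show "(\<lambda>y. min 1 (y\<^sup>2)) \<in> borel_measurable \<phi>" by (rule \<phi>_measurable) measurable
  have "norm (min 1 (y\<^sup>2)) \<le> norm (6 * norm (cpoisson_defect 1 y))" if "y > 0" for y :: real
  proof -
    have "cpoisson_defect 1 y = - of_real (1 - exp (- y) - y * exp (- y))"
      by (simp add: cpoisson_defect_def cpoisson_def mult.commute flip: exp_of_real)
    hence "norm (cpoisson_defect 1 y) = \<bar>1 - exp (- y) - y * exp (- y)\<bar>" by (simp only: norm_minus_cancel norm_of_real)
    moreover have "norm (min 1 (y\<^sup>2)) = min 1 (y\<^sup>2)" by simp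
    moreover have "6 * (1 - exp (- y) - y * exp (- y)) \<le> 6 * \<bar>1 - exp (- y) - y * exp (- y)\<bar>" by (intro mult_left_mono abs_ge_self) simp
    moreover have "6 * \<bar>1 - exp (- y) - y * exp (- y)\<bar> \<le> norm (6 * \<bar>1 - exp (- y) - y * exp (- y)\<bar>)"
      unfolding real_norm_def by (rule abs_ge_self)
    ultimately show ?thesis using min_1_square_le[OF that] by (metis order_trans)
  qed
  thus "AE y in \<phi>. norm (min 1 (y\<^sup>2)) \<le> norm (6 * norm (cpoisson_defect 1 y))" by (intro AE_I2) (simp add: space_\<phi>)
qed

lemma \<phi>_integrable_min_1_square:
  fixes F :: "real \<Rightarrow> complex"
  assumes "F \<in> borel_measurable borel" "\<And>y. y > 0 \<Longrightarrow> norm (F y) \<le> C * min 1 (y\<^sup>2)"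
  shows "integrable \<phi> F"
proof (rule Bochner_Integration.integrable_bound)
  show "integrable \<phi> (\<lambda>y. C * min 1 (y\<^sup>2))" by (intro integrable_mult_right min_1_square_\<phi>_integrable)
  show "F \<in> borel_measurable \<phi>" by (rule \<phi>_measurable[OF assms(1)])
  show "AE y in \<phi>. norm (F y) \<le> norm (C * min 1 (y\<^sup>2))"
    by (intro AE_I2) (use assms(2) in \<open>auto simp: space_\<phi> intro: order_trans[OF _ abs_ge_self]\<close>)
qed

lemma \<phi>_dominated_limit:
  fixes F :: "nat \<Rightarrow> real \<Rightarrow> complex"
  assumes F: "\<And>n. F n \<in> borel_measurable borel" and G: "G \<in> borel_measurable borel"
    and bd: "\<And>n y. y > 0 \<Longrightarrow> norm (F n y) \<le> C * min 1 (y\<^sup>2)"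
    and lim: "\<And>y. y > 0 \<Longrightarrow> (\<lambda>n. F n y) \<longlonglongrightarrow> G y"
  shows "(\<lambda>n. integral\<^sup>L \<phi> (F n)) \<longlonglongrightarrow> integral\<^sup>L \<phi> G"
proof (rule integral_dominated_convergence)
  show "integrable \<phi> (\<lambda>y. C * min 1 (y\<^sup>2))" by (intro integrable_mult_right min_1_square_\<phi>_integrable)
qed (use \<phi>_measurable[OF F] \<phi>_measurable[OF G] bd lim in \<open>auto simp: space_\<phi>\<close>)

end

lemma norm_powr_minus_imaginary_le:
  fixes p :: complex
  assumes p: "Re p \<ge> 0" "p \<noteq> 0"
  shows "norm (p powr (- (\<i> * of_real t))) \<le> exp (pi / 2 * \<bar>t\<bar>)"
proof -
  have "norm (p powr (- (\<i> * of_real t))) = exp (t * Im (Ln p))"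
    using p by (simp add: powr_def norm_exp_eq_Re)
  also have "t * Im (Ln p) \<le> \<bar>t\<bar> * (pi / 2)"
  proof -
    have "\<bar>Im (Ln p)\<bar> \<le> pi / 2" using Re_Ln_pos_le[OF p(2)] p(1) by simp
    hence "\<bar>t * Im (Ln p)\<bar> \<le> \<bar>t\<bar> * (pi / 2)" unfolding abs_mult by (intro mult_left_mono) auto
    thus ?thesis by linarith
  qed
  finally show ?thesis by (simp add: mult.commute)
qed

definition exp_kernel :: "real \<Rightarrow> complex \<Rightarrow> real \<Rightarrow> complex" where
  "exp_kernel q p y = 1 - exp (- (p * of_real y)) - p * (of_real y * exp (- (of_real q * of_real y)))"

lemma exp_kernel_bound:
  assumes q: "q > 0" and p: "Re p \<ge> 0" "norm p \<le> 2" and y: "y > 0"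
  shows "norm (exp_kernel q p y) \<le> (4 + 2 * q + 2 / q) * min 1 (y\<^sup>2)"
proof -
  define e where "e = exp (- (of_real q * complex_of_real y))"
  have e_eq: "e = of_real (exp (- (q * y)))" by (simp add: e_def flip: exp_of_real)
  have ne: "norm e \<le> 1" "norm (1 - e) \<le> q * y"
  proof -
    show "norm e \<le> 1" unfolding e_eq norm_of_real using q y by simp
    have "norm (1 - e) = \<bar>1 - exp (- (q * y))\<bar>" unfolding e_eq by (metis norm_of_real of_real_1 of_real_diff)
    also have "\<dots> \<le> q * y" using exp_ge_add_one_self[of "- (q * y)"] q y by simp
    finally show "norm (1 - e) \<le> q * y" .
  qed
  show ?thesis
  proof (cases "y \<le> 1")
    case True
    have "exp_kernel q p y = - (exp (- (p * of_real y)) - 1 - (- (p * of_real y))) + p * of_real y * (1 - e)"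
      by (simp add: exp_kernel_def e_def algebra_simps)
    also have "norm \<dots> \<le> norm (exp (- (p * of_real y)) - 1 - (- (p * of_real y))) + norm (p * of_real y * (1 - e))"
      by (rule order_trans[OF norm_triangle_ineq]) (simp only: norm_minus_cancel order_refl)
    also have "\<dots> \<le> (norm (- (p * of_real y)))\<^sup>2 + norm (p * of_real y * (1 - e))"
      using p y by (intro add_right_mono norm_exp_minus_1_minus_le) simp
    also have "\<dots> \<le> 4 * y\<^sup>2 + 2 * y * (q * y)"
    proof (rule add_mono)
      have "(norm (- (p * of_real y)))\<^sup>2 = (norm p)\<^sup>2 * y\<^sup>2" using y by (simp add: norm_mult power_mult_distrib)
      also have "\<dots> \<le> 2\<^sup>2 * y\<^sup>2" using p by (intro mult_right_mono power_mono) auto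
      finally show "(norm (- (p * of_real y)))\<^sup>2 \<le> 4 * y\<^sup>2" by simp
      have "norm (p * of_real y * (1 - e)) = norm p * y * norm (1 - e)" using y by (simp add: norm_mult)
      also have "\<dots> \<le> 2 * y * (q * y)" using p y ne by (intro mult_mono) auto
      finally show "norm (p * of_real y * (1 - e)) \<le> 2 * y * (q * y)" .
    qed
    also have "\<dots> = (4 + 2 * q) * y\<^sup>2" by (simp add: power2_eq_square algebra_simps)
    also have "\<dots> \<le> (4 + 2 * q + 2 / q) * y\<^sup>2" using q by (intro mult_right_mono) auto
    also have "y\<^sup>2 = min 1 (y\<^sup>2)" using True y power_le_one[of y 2] by simp
    finally show ?thesis .
  next
    case False
    have "norm (exp_kernel q p y) \<le> norm (1 - exp (- (p * of_real y))) + norm (p * (of_real y * e))"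
      unfolding exp_kernel_def e_def by (rule norm_triangle_ineq4)
    also have "\<dots> \<le> 2 + 2 * (1 / q)"
    proof (rule add_mono)
      have "norm (exp (- (p * of_real y))) \<le> 1" using p y by (simp add: norm_exp_eq_Re)
      thus "norm (1 - exp (- (p * of_real y))) \<le> 2"
        using norm_triangle_ineq4[of 1 "exp (- (p * of_real y))"] unfolding norm_one by linarith
      have "q * y * exp (- (q * y)) \<le> 1"
      proof -
        have "q * y \<le> exp (q * y)" using exp_ge_add_one_self[of "q * y"] by linarith
        hence "q * y * exp (- (q * y)) \<le> exp (q * y) * exp (- (q * y))" by (intro mult_right_mono) auto
        thus ?thesis by (simp flip: exp_add)
      qed
      hence "y * exp (- (q * y)) \<le> 1 / q" using q by (simp add: field_simps)
      hence "norm (of_real y * e) \<le> 1 / q" unfolding e_eq norm_mult norm_of_real using y by simp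
      thus "norm (p * (of_real y * e)) \<le> 2 * (1 / q)"
        unfolding norm_mult[of p] using p q by (intro mult_mono) auto
    qed
    also have "\<dots> \<le> 4 + 2 * q + 2 / q" using q by simp
    also have "\<dots> = (4 + 2 * q + 2 / q) * min 1 (y\<^sup>2)" using False y one_le_power[of y 2] by simp
    finally show ?thesis .
  qed
qed

definition sine_kernel :: "real \<Rightarrow> real \<Rightarrow> complex" where
  "sine_kernel q y = of_real (sin y) - of_real y * exp (- (of_real q * of_real y))"

context zolotarev_data
begin

definition exp_kernel_mellin :: "real \<Rightarrow> complex \<Rightarrow> int \<Rightarrow> complex" where
  "exp_kernel_mellin q p k = (if k = 0 then p * (of_real (ln q) - Ln p + 1)
     else p * Gamma (s k) * (p powr (- s k) - (1 - s k) * of_real q powr (- s k)))"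

lemma norm_exp_kernel_mellin_bound:
  assumes q: "q > 0"
  shows "\<exists>C>0. \<forall>k p. k \<noteq> 0 \<longrightarrow> Re p \<ge> 0 \<longrightarrow> p \<noteq> 0 \<longrightarrow> norm p \<le> 2 \<longrightarrow> norm (ck k * exp_kernel_mellin q p k) \<le> C * wt k"
proof -
  obtain C1 where C1: "C1 > 0" "\<And>k. k \<noteq> 0 \<Longrightarrow> norm (ck k * Gamma (s k)) * exp (pi / 2 * (\<bar>real_of_int k\<bar> * c_tilde c)) \<le> C1 * wt k"
    using ck_Gamma_exp_bound by auto
  obtain C2 where C2: "C2 > 0" "\<And>k. k \<noteq> 0 \<Longrightarrow> norm (ck k * ((1 - s k) * Gamma (s k))) \<le> C2 * wt k"
    using ck_Gamma_bound by auto
  have "norm (ck k * exp_kernel_mellin q p k) \<le> 2 * (C1 + C2) * wt k" if k: "k \<noteq> 0" and p: "Re p \<ge> 0" "p \<noteq> 0" "norm p \<le> 2" for k p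
  proof -
    have s: "s k = \<i> * of_real (of_int k * c_tilde c)" by simp
    have "ck k * exp_kernel_mellin q p k = p * (ck k * Gamma (s k) * p powr (- s k) - ck k * ((1 - s k) * Gamma (s k)) * of_real q powr (- s k))"
      using k by (simp add: exp_kernel_mellin_def algebra_simps)
    also have "norm \<dots> \<le> 2 * (norm (ck k * Gamma (s k) * p powr (- s k)) + norm (ck k * ((1 - s k) * Gamma (s k)) * of_real q powr (- s k)))"
      unfolding norm_mult[of p] by (intro mult_mono norm_triangle_ineq4 p) auto
    also have "norm (ck k * Gamma (s k) * p powr (- s k)) \<le> C1 * wt k"
    proof -
      have "norm (ck k * Gamma (s k) * p powr (- s k)) = norm (ck k * Gamma (s k)) * norm (p powr (- s k))" by (rule norm_mult)
      also have "\<dots> \<le> norm (ck k * Gamma (s k)) * exp (pi / 2 * \<bar>of_int k * c_tilde c\<bar>)"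
        unfolding s by (intro mult_left_mono norm_powr_minus_imaginary_le p) auto
      also have "\<bar>of_int k * c_tilde c\<bar> = \<bar>real_of_int k\<bar> * c_tilde c" using \<tau>_pos by (simp add: abs_mult)
      also have "norm (ck k * Gamma (s k)) * exp (pi / 2 * (\<bar>real_of_int k\<bar> * c_tilde c)) \<le> C1 * wt k" by (rule C1(2)[OF k])
      finally show ?thesis .
    qed
    also have "norm (ck k * ((1 - s k) * Gamma (s k)) * of_real q powr (- s k)) \<le> C2 * wt k"
    proof -
      have "norm (ck k * ((1 - s k) * Gamma (s k)) * of_real q powr (- s k)) = norm (ck k * ((1 - s k) * Gamma (s k)))"
        unfolding norm_mult[of _ "of_real q powr (- s k)"] norm_real_powr_s[OF q] by simp
      thus ?thesis using C2(2)[OF k] by simp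
    qed
    finally show ?thesis by (simp add: algebra_simps)
  qed
  thus ?thesis using C1(1) C2(1) by (intro exI[of _ "2 * (C1 + C2)"]) auto
qed

lemma exp_kernel_\<phi>_has_sum_Re_pos:
  assumes q: "q > 0" and p: "Re p > 0" "norm p \<le> 2"
  shows "((\<lambda>k. ck k * exp_kernel_mellin q p k) has_sum integral\<^sup>L \<phi> (exp_kernel q p)) UNIV"
proof -
  have p0: "p \<noteq> 0" using p by auto
  have rq: "Re (of_real q) > 0" using q by simp
  define E where "E = (\<lambda>y::real. exp (- (p * of_real y)) - exp (- (of_real q * of_real y)))"
  define g where "g = (\<lambda>y. p * (E y + cpoisson q 1 y))"
  have d: "(exp_kernel q p has_vector_derivative g y) (at y)" for y
  proof -
    have "((\<lambda>z. 1 - exp (- (p * z)) - p * (z * exp (- (of_real q * z)))) has_field_derivative g y) (at (of_real y))"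
      unfolding g_def cpoisson_def E_def by (auto intro!: derivative_eq_intros simp: algebra_simps)
    thus ?thesis unfolding exp_kernel_def[abs_def] by (rule has_vector_derivative_real_field)
  qed
  have c: "continuous_on UNIV g" unfolding g_def E_def by (intro continuous_intros)
  have z: "exp_kernel q p 0 = 0" by (simp add: exp_kernel_def)
  have E_int: "set_integrable lborel {0<..} (\<lambda>y. of_real y powr (z - 1) * E y)" if "Re z = 0" for z
    unfolding E_def by (rule exp_diff_kernel_integrable[OF that p(1) rq])
  have i: "set_integrable lborel {0<..} (\<lambda>w. g w / of_real w)"
  proof -
    have "set_integrable lborel {0<..} (\<lambda>y. p * (of_real y powr (0 - 1) * E y + of_real y powr (0 - 1) * cpoisson q 1 y))"
      by (intro set_integrable_mult_right set_integral_add(1) E_int cpoisson_mellin_integrable q) auto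
    moreover have "set_integrable lborel {0<..} (\<lambda>y. p * (of_real y powr (0 - 1) * E y + of_real y powr (0 - 1) * cpoisson q 1 y))
       \<longleftrightarrow> set_integrable lborel {0<..} (\<lambda>w. g w / of_real w)"
      by (rule set_integrable_cong) (auto simp: powr_minus g_def field_simps)
    ultimately show ?thesis by blast
  qed
  have m: "mellin g (s k) = exp_kernel_mellin q p k" for k
  proof -
    have "mellin g (s k) = p * (mellin E (s k) + mellin (cpoisson q 1) (s k))"
      unfolding g_def mellin_cmult by (subst mellin_add) (auto intro!: E_int cpoisson_mellin_integrable q)
    also have "mellin (cpoisson q 1) (s k) = Gamma (1 + s k) * of_real q powr (- s k)"
      using mellin_cpoisson[OF q, of 1 "s k"] by simp
    also have "mellin E (s k) = (if s k = 0 then Ln (of_real q) - Ln p else Gamma (s k) * (p powr (- s k) - of_real q powr (- s k)))"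
      unfolding mellin_def E_def by (rule exp_diff_kernel_integral[OF Re_s p(1) rq])
    finally have eq: "mellin g (s k) = p * ((if s k = 0 then Ln (of_real q) - Ln p else Gamma (s k) * (p powr (- s k) - of_real q powr (- s k))) +
        Gamma (1 + s k) * of_real q powr (- s k))" .
    show ?thesis
    proof (cases "k = 0")
      case True
      thus ?thesis using q unfolding eq by (simp add: exp_kernel_mellin_def Ln_of_real)
    next
      case False
      hence sk: "s k \<noteq> 0" using \<tau>_pos by simp
      have "s k \<notin> \<int>\<^sub>\<le>\<^sub>0" using sk by (auto elim!: nonpos_Ints_cases simp: complex_eq_iff)
      hence "Gamma (1 + s k) = s k * Gamma (s k)" using Gamma_plus1[of "s k"] by (simp add: add.commute)
      hence "mellin g (s k) = p * (Gamma (s k) * (p powr (- s k) - of_real q powr (- s k)) + s k * Gamma (s k) * of_real q powr (- s k))"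
        unfolding eq using sk by simp
      also have "\<dots> = p * Gamma (s k) * (p powr (- s k) - (1 - s k) * of_real q powr (- s k))"
        by (simp only: algebra_simps mult_1_left)
      finally show ?thesis using False unfolding exp_kernel_mellin_def by simp
    qed
  qed
  obtain C where C: "C > 0" "\<And>k. k \<noteq> 0 \<Longrightarrow> norm (ck k * exp_kernel_mellin q p k) \<le> C * wt k"
    using norm_exp_kernel_mellin_bound[OF q] p p0 by (metis less_imp_le)
  have "(\<lambda>k. norm (ck k * exp_kernel_mellin q p k)) summable_on UNIV"
  proof (rule summable_wt_bound[where C = "C + norm (ck 0 * exp_kernel_mellin q p 0)"])
    fix k
    show "norm (ck k * exp_kernel_mellin q p k) \<le> (C + norm (ck 0 * exp_kernel_mellin q p 0)) * wt k"
    proof (cases "k = 0")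
      case True
      have "wt 0 = 1" by (simp add: wt_def)
      thus ?thesis using C(1) True by simp
    next
      case False
      have "norm (ck k * exp_kernel_mellin q p k) \<le> C * wt k" by (rule C(2)[OF False])
      also have "\<dots> \<le> (C + norm (ck 0 * exp_kernel_mellin q p 0)) * wt k"
        by (intro mult_right_mono) (use wt_pos[of k] in auto)
      finally show ?thesis .
    qed
  qed
  thus ?thesis using \<phi>_integral_mellin_series[OF d c z i] by (simp only: m)
qed

text \<open>
  The points \<open>p = \<plusminus>\<i>\<close> carry the sine of the Zolotarev integrand.  There the derivative divided by \<open>y\<close>
  is not absolutely integrable, so they are reached as limits from the right half-plane.
\<close>
lemma exp_kernel_\<phi>_has_sum:
  assumes q: "q > 0" and p: "p = \<i> \<or> p = - \<i>"
  shows "((\<lambda>k. ck k * exp_kernel_mellin q p k) has_sum integral\<^sup>L \<phi> (exp_kernel q p)) UNIV"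
proof -
  define P where "P = (\<lambda>n. p + of_real (inverse (real (Suc n))))"
  have np: "norm p = 1" "Re p = 0" "p \<notin> \<real>\<^sub>\<le>\<^sub>0" using p by (auto simp: complex_nonpos_Reals_iff)
  have inv: "inverse (real (Suc n)) > 0" "inverse (real (Suc n)) \<le> 1" for n by (auto simp: inverse_le_1_iff)
  have RP: "Re (P n) > 0" for n using np inv[of n] by (simp add: P_def)
  have nP: "norm (P n) \<le> 2" for n
  proof -
    have "norm (P n) \<le> norm p + norm (complex_of_real (inverse (real (Suc n))))" unfolding P_def by (rule norm_triangle_ineq)
    also have "\<dots> \<le> 2" unfolding norm_of_real np using inv[of n] by simp
    finally show ?thesis .
  qed
  have P0: "P n \<noteq> 0" for n using RP[of n] by auto
  have Plim: "P \<longlonglongrightarrow> p"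
    unfolding P_def using tendsto_add[OF tendsto_const tendsto_of_real[OF LIMSEQ_inverse_real_of_nat], of p] by simp
  have Lnlim: "(\<lambda>n. Ln (P n)) \<longlonglongrightarrow> Ln p" by (intro tendsto_Ln Plim np)
  have p0: "p \<noteq> 0" using np by auto
  have lim: "(\<lambda>n. ck k * exp_kernel_mellin q (P n) k) \<longlonglongrightarrow> ck k * exp_kernel_mellin q p k" for k
  proof (cases "k = 0")
    case True
    have "(\<lambda>n. ck 0 * (P n * (of_real (ln q) - Ln (P n) + 1))) \<longlonglongrightarrow> ck 0 * (p * (of_real (ln q) - Ln p + 1))"
      by (intro tendsto_intros Plim Lnlim)
    thus ?thesis using True by (simp add: exp_kernel_mellin_def)
  next
    case False
    have "(\<lambda>n. ck k * (P n * Gamma (s k) * (exp (- s k * Ln (P n)) - (1 - s k) * of_real q powr (- s k)))) \<longlonglongrightarrow>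
       ck k * (p * Gamma (s k) * (exp (- s k * Ln p) - (1 - s k) * of_real q powr (- s k)))"
      by (intro tendsto_intros Plim Lnlim)
    moreover have "P n powr (- s k) = exp (- s k * Ln (P n))" for n using P0 by (simp add: powr_def)
    moreover have "p powr (- s k) = exp (- s k * Ln p)" using p0 by (simp add: powr_def)
    ultimately show ?thesis using False unfolding exp_kernel_mellin_def by (simp only: if_False)
  qed
  obtain C where C: "C > 0" "\<And>k p. k \<noteq> 0 \<Longrightarrow> Re p \<ge> 0 \<Longrightarrow> p \<noteq> 0 \<Longrightarrow> norm p \<le> 2 \<Longrightarrow> norm (ck k * exp_kernel_mellin q p k) \<le> C * wt k"
    using norm_exp_kernel_mellin_bound[OF q] by metis
  have "Bseq (\<lambda>n. ck 0 * exp_kernel_mellin q (P n) 0)" by (rule convergent_imp_Bseq) (use lim[of 0] in \<open>auto simp: convergent_def\<close>)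
  then obtain B where B: "B > 0" "\<And>n. norm (ck 0 * exp_kernel_mellin q (P n) 0) \<le> B" unfolding Bseq_def by blast
  have bd: "norm (ck k * exp_kernel_mellin q (P n) k) \<le> (B + C) * wt k" for n k
  proof (cases "k = 0")
    case True
    have "wt 0 = 1" by (simp add: wt_def)
    thus ?thesis using B(2)[of n] C(1) True by simp
  next
    case False
    have "norm (ck k * exp_kernel_mellin q (P n) k) \<le> C * wt k" using RP[of n] by (intro C False P0 nP) simp
    also have "\<dots> \<le> (B + C) * wt k" by (intro mult_right_mono) (use wt_pos[of k] B in auto)
    finally show ?thesis .
  qed
  show ?thesis
  proof (rule has_sum_dominated_limit[OF exp_kernel_\<phi>_has_sum_Re_pos[OF q RP nP] lim bd])
    show "(\<lambda>k. (B + C) * wt k) summable_on UNIV" by (rule summable_on_cmult_right[OF wt_summable])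
    show "(\<lambda>n. integral\<^sup>L \<phi> (exp_kernel q (P n))) \<longlonglongrightarrow> integral\<^sup>L \<phi> (exp_kernel q p)"
    proof (rule \<phi>_dominated_limit)
      show "norm (exp_kernel q (P n) y) \<le> (4 + 2 * q + 2 / q) * min 1 (y\<^sup>2)" if "y > 0" for n y
        using RP[of n] by (intro exp_kernel_bound q nP that) simp
      show "(\<lambda>n. exp_kernel q (P n) y) \<longlonglongrightarrow> exp_kernel q p y" for y
        unfolding exp_kernel_def by (intro tendsto_intros Plim)
    qed (auto simp: exp_kernel_def[abs_def])
  qed
qed

definition sine_mellin :: "real \<Rightarrow> int \<Rightarrow> complex" where
  "sine_mellin q k = (if k = 0 then 1 + of_real (ln q)
     else Gamma (s k) * cos (of_real (pi / 2) * s k) - (1 - s k) * Gamma (s k) * of_real q powr (- s k))"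

lemma
  assumes q: "q > 0"
  shows sine_kernel_\<phi>_integrable: "integrable \<phi> (sine_kernel q)"
    and sine_kernel_\<phi>_has_sum: "((\<lambda>k. ck k * sine_mellin q k) has_sum integral\<^sup>L \<phi> (sine_kernel q)) UNIV"
proof -
  have k_eq: "sine_kernel q y = (exp_kernel q \<i> y - exp_kernel q (- \<i>) y) / (2 * \<i>)" for y
    by (simp add: sine_kernel_def exp_kernel_def sin_exp_eq field_simps sin_of_real[symmetric])
  have int: "integrable \<phi> (exp_kernel q p)" if "p = \<i> \<or> p = - \<i>" for p
    by (rule \<phi>_integrable_min_1_square[OF _ exp_kernel_bound[OF q]]) (use that in \<open>auto simp: exp_kernel_def[abs_def]\<close>)
  show "integrable \<phi> (sine_kernel q)" unfolding k_eq[abs_def] by (intro integrable_divide Bochner_Integration.integrable_diff int) auto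
  have I: "integral\<^sup>L \<phi> (sine_kernel q) = (integral\<^sup>L \<phi> (exp_kernel q \<i>) - integral\<^sup>L \<phi> (exp_kernel q (- \<i>))) / (2 * \<i>)"
    unfolding k_eq[abs_def] by (simp add: int)
  have "((\<lambda>k. (ck k * exp_kernel_mellin q \<i> k - ck k * exp_kernel_mellin q (- \<i>) k) / (2 * \<i>)) has_sum integral\<^sup>L \<phi> (sine_kernel q)) UNIV"
  proof -
    have "((\<lambda>k. ck k * exp_kernel_mellin q \<i> k + - (ck k * exp_kernel_mellin q (- \<i>) k)) has_sum integral\<^sup>L \<phi> (exp_kernel q \<i>) + - integral\<^sup>L \<phi> (exp_kernel q (- \<i>))) UNIV"
      by (intro has_sum_add has_sum_uminusI exp_kernel_\<phi>_has_sum q) auto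
    from has_sum_divide_const[OF this, of "2 * \<i>"] show ?thesis
      unfolding I by (simp only: add_uminus_conv_diff)
  qed
  moreover have "(ck k * exp_kernel_mellin q \<i> k - ck k * exp_kernel_mellin q (- \<i>) k) / (2 * \<i>) = ck k * sine_mellin q k" for k
  proof (cases "k = 0")
    case True
    have "Ln \<i> = \<i> * of_real pi / 2" "Ln (- \<i>) = - (\<i> * of_real pi / 2)" by simp_all
    thus ?thesis using True by (simp add: exp_kernel_mellin_def sine_mellin_def field_simps)
  next
    case False
    have P: "\<i> powr (- s k) = exp (- (\<i> * (of_real (pi / 2) * s k)))" "(- \<i>) powr (- s k) = exp (\<i> * (of_real (pi / 2) * s k))"
      by (simp_all add: powr_def field_simps)
    have "cos (of_real (pi / 2) * s k) = (exp (\<i> * (of_real (pi / 2) * s k)) + exp (- (\<i> * (of_real (pi / 2) * s k)))) / 2"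
      by (rule cos_exp_eq)
    moreover have "(C * (\<i> * G * (A - B)) - C * (- \<i> * G * (A' - B))) / (2 * \<i>) = C * (G * ((A' + A) / 2) - B * G)" for A A' B C G
      by (simp add: field_simps)
    ultimately show ?thesis using False unfolding exp_kernel_mellin_def sine_mellin_def P
      by (simp only: if_False) (simp only: mult_ac)
  qed
  ultimately show "((\<lambda>k. ck k * sine_mellin q k) has_sum integral\<^sup>L \<phi> (sine_kernel q)) UNIV" by (simp only:)
qed

end

subsection \<open>Poisson averages of a bounded function\<close>

definition poisson :: "real \<Rightarrow> nat \<Rightarrow> real" where "poisson t n = exp (- t) * t ^ n / fact n"

lemma poisson_nonneg: "t \<ge> 0 \<Longrightarrow> poisson t n \<ge> 0" by (simp add: poisson_def)

lemma cpoisson_eq_poisson: "cpoisson q n y = of_real (poisson (q * y) n)"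
  by (simp add: cpoisson_def poisson_def flip: exp_of_real)

lemma poisson_sums: "poisson t sums 1"
proof -
  have "(\<lambda>n. exp (- t) * (t ^ n /\<^sub>R fact n)) sums (exp (- t) * exp t)"
    by (intro sums_mult exp_converges)
  moreover have "exp (- t) * exp t = 1" by (simp flip: exp_add)
  moreover have "(\<lambda>n. exp (- t) * (t ^ n /\<^sub>R fact n)) = poisson t"
    by (simp add: poisson_def fun_eq_iff divide_inverse mult_ac)
  ultimately show ?thesis by (simp only:)
qed

lemma poisson_Suc: "real (Suc n) * poisson t (Suc n) = t * poisson t n"
  by (simp add: poisson_def divide_simps del: of_nat_Suc)

lemma poisson_sums_mean: "(\<lambda>n. real n * poisson t n) sums t"
proof -
  have "(\<lambda>n. real (Suc n) * poisson t (Suc n)) sums (t * 1)" unfolding poisson_Suc by (intro sums_mult poisson_sums)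
  hence "(\<lambda>n. real n * poisson t n) sums (t * 1 + real 0 * poisson t 0)" by (rule sums_Suc)
  thus ?thesis by simp
qed

lemma poisson_sums_factorial2: "(\<lambda>n. real (n + 2) * real (n + 1) * poisson t (n + 2)) sums t\<^sup>2"
proof -
  have "real (n + 2) * real (n + 1) * poisson t (n + 2) = t * (t * poisson t n)" for n
    using poisson_Suc[of "Suc n" t] poisson_Suc[of n t] by (simp add: algebra_simps del: of_nat_Suc)
  moreover have "(\<lambda>n. t * (t * poisson t n)) sums (t * (t * 1))" by (intro sums_mult poisson_sums)
  ultimately show ?thesis by (simp add: power2_eq_square)
qed

lemma poisson_sums_square: "(\<lambda>n. (real n)\<^sup>2 * poisson t n) sums (t\<^sup>2 + t)"
proof -
  have "(\<lambda>n. real n * (real n - 1) * poisson t n) sums (t\<^sup>2 + (\<Sum>n<2. real n * (real n - 1) * poisson t n))"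
    by (rule sums_iff_shift[THEN iffD1]) (use poisson_sums_factorial2[of t] in \<open>simp add: algebra_simps\<close>)
  hence "(\<lambda>n. real n * (real n - 1) * poisson t n) sums t\<^sup>2" by (simp add: numeral_2_eq_2)
  from sums_add[OF this poisson_sums_mean[of t]] show ?thesis by (simp add: algebra_simps power2_eq_square)
qed

lemma norm_le_of_sums:
  fixes f :: "nat \<Rightarrow> complex"
  assumes "f sums a" "g sums b" "\<And>n. norm (f n) \<le> g n"
  shows "norm a \<le> b"
proof (rule tendsto_le[OF sequentially_bot])
  show "(\<lambda>n. \<Sum>i<n. g i) \<longlonglongrightarrow> b" using assms(2) by (simp add: sums_def)
  show "(\<lambda>n. norm (\<Sum>i<n. f i)) \<longlonglongrightarrow> norm a" using assms(1) by (intro tendsto_norm) (simp add: sums_def)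
  show "\<forall>\<^sub>F n in sequentially. norm (\<Sum>i<n. f i) \<le> (\<Sum>i<n. g i)"
    by (intro always_eventually allI sum_norm_le assms)
qed

lemma abs_sin_minus_le: "\<bar>sin y - y\<bar> \<le> y\<^sup>2" for y :: real
proof -
  have "\<bar>Im (exp (\<i> * of_real y) - 1 - \<i> * of_real y)\<bar> \<le> norm (exp (\<i> * of_real y) - 1 - \<i> * of_real y)"
    by (rule abs_Im_le_cmod)
  also have "\<dots> \<le> (norm (\<i> * complex_of_real y))\<^sup>2" by (rule norm_exp_minus_1_minus_le) simp
  finally show ?thesis by (simp add: norm_mult Im_exp)
qed

lemma y_exp_bound:
  fixes h y :: real
  assumes "h > 0" "y > 0"
  shows "y * exp (- (1 / h * y)) \<le> h" "0 \<le> y * exp (- (1 / h * y))"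
proof -
  have "y / h \<le> exp (1 / h * y)" using exp_ge_add_one_self[of "1 / h * y"] by (simp only: times_divide_eq_left mult_1_left)
  hence "y / h * exp (- (1 / h * y)) \<le> exp (1 / h * y) * exp (- (1 / h * y))" by (intro mult_right_mono) auto
  hence "y / h * exp (- (1 / h * y)) \<le> 1" by (simp flip: exp_add)
  thus "y * exp (- (1 / h * y)) \<le> h" using assms by (simp add: field_simps)
qed (use assms in simp)

locale bounded_C2 =
  fixes f f' f'' :: "real \<Rightarrow> complex" and B M :: real
  assumes f_bd: "norm (f x) \<le> B" and f''_bd: "norm (f'' x) \<le> M"
    and d1: "(f has_vector_derivative f' x) (at x)" and d2: "(f' has_vector_derivative f'' x) (at x)"
begin

lemma B_nonneg: "B \<ge> 0" using f_bd[of 0] norm_ge_zero order_trans by blast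

lemma M_nonneg: "M \<ge> 0" using f''_bd[of 0] norm_ge_zero order_trans by blast

lemma f'_lipschitz: "norm (f' a - f' b) \<le> M * \<bar>a - b\<bar>"
proof -
  have "norm (f' a - f' b) \<le> M * norm (a - b)"
  proof (rule differentiable_bound[where S = UNIV and f' = "\<lambda>x h. h *\<^sub>R f'' x"])
    show "(f' has_derivative (\<lambda>h. h *\<^sub>R f'' x)) (at x within UNIV)" for x
      using d2[of x] by (simp add: has_vector_derivative_def)
    show "onorm (\<lambda>h. h *\<^sub>R f'' x) \<le> M" for x
      by (rule onorm_le) (use f''_bd[of x] in \<open>simp add: mult.commute[of M] mult_left_mono\<close>)
  qed auto
  thus ?thesis by simp
qed

lemma taylor_le: "norm (f b - f a - of_real (b - a) * f' a) \<le> M * (b - a)\<^sup>2"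
proof -
  have "norm (f b - f a - (b - a) *\<^sub>R f' a) \<le> norm (b - a) * (M * \<bar>b - a\<bar>)"
  proof (rule vector_differentiable_bound_linearization[where S = "closed_segment a b"])
    show "(f has_vector_derivative f' x) (at x within closed_segment a b)" for x
      using d1 by (rule has_vector_derivative_at_within)
    show "norm (f' x - f' a) \<le> M * \<bar>b - a\<bar>" if "x \<in> closed_segment a b" for x
    proof -
      have "\<bar>x - a\<bar> \<le> \<bar>b - a\<bar>" using segment_bound1[OF that] by (simp add: abs_minus_commute)
      hence "M * \<bar>x - a\<bar> \<le> M * \<bar>b - a\<bar>" using M_nonneg by (rule mult_left_mono)
      thus ?thesis using f'_lipschitz[of x a] by linarith
    qed
  qed auto
  thus ?thesis by (simp add: scaleR_conv_of_real power2_eq_square mult_ac)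
qed

lemma f_pois_summable: "summable (\<lambda>j. norm (f (a j) * cpoisson q (j + n) y))" if "q * y \<ge> 0"
proof (rule summable_comparison_test_ev[OF always_eventually])
  show "summable (\<lambda>j. B * poisson (q * y) (j + n))"
    using summable_iff_shift[of "poisson (q * y)" n] sums_summable[OF poisson_sums[of "q * y"]] by (intro summable_mult) simp
  show "\<forall>j. norm (norm (f (a j) * cpoisson q (j + n) y)) \<le> B * poisson (q * y) (j + n)"
    using f_bd poisson_nonneg[OF that] by (auto simp: cpoisson_eq_poisson norm_mult intro!: mult_right_mono)
qed

lemma poisson_average_le:
  assumes h: "h > 0" and y: "y > 0"
  shows "norm ((\<Sum>j. f (x - real j * h) * cpoisson (1 / h) j y) - f (x - y)) \<le> M * (h * y)"
proof -
  define t where "t = 1 / h * y"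
  have t: "t > 0" "h * t = y" using h y by (auto simp: t_def)
  have p: "cpoisson (1 / h) j y = of_real (poisson t j)" for j by (simp add: cpoisson_eq_poisson t_def)
  have s1: "(\<lambda>j. f (x - real j * h) * of_real (poisson t j)) sums (\<Sum>j. f (x - real j * h) * of_real (poisson t j))"
  proof -
    have "summable (\<lambda>j. norm (f (x - real j * h) * cpoisson (1 / h) (j + 0) y))"
      by (rule f_pois_summable) (use h y in simp)
    hence "summable (\<lambda>j. f (x - real j * h) * of_real (poisson t j))"
      unfolding p add_0_right by (rule summable_norm_cancel)
    thus ?thesis by (rule summable_sums)
  qed
  have s0: "(\<lambda>j. complex_of_real (poisson t j)) sums of_real 1" by (intro sums_of_real poisson_sums)
  have sm: "(\<lambda>j. complex_of_real (real j * poisson t j)) sums of_real t" by (intro sums_of_real poisson_sums_mean)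
  have "(\<lambda>j. f (x - real j * h) * of_real (poisson t j) - f (x - y) * of_real (poisson t j)
      + (of_real h * f' (x - y) * of_real (real j * poisson t j) - of_real y * f' (x - y) * of_real (poisson t j))) sums
      ((\<Sum>j. f (x - real j * h) * of_real (poisson t j)) - f (x - y) * of_real 1
      + (of_real h * f' (x - y) * of_real t - of_real y * f' (x - y) * of_real 1))"
    by (intro sums_add sums_diff sums_mult s0 sm s1)
  moreover have "of_real h * f' (x - y) * of_real t = of_real y * f' (x - y)"
    by (simp add: t(2)[symmetric])
  ultimately have A: "(\<lambda>j. f (x - real j * h) * of_real (poisson t j) - f (x - y) * of_real (poisson t j)
      + (of_real h * f' (x - y) * of_real (real j * poisson t j) - of_real y * f' (x - y) * of_real (poisson t j))) sums
      ((\<Sum>j. f (x - real j * h) * of_real (poisson t j)) - f (x - y))" by simp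
  have "(\<lambda>j. M * (h\<^sup>2 * ((real j)\<^sup>2 * poisson t j) - 2 * h * y * (real j * poisson t j) + y\<^sup>2 * poisson t j)) sums
      (M * (h\<^sup>2 * (t\<^sup>2 + t) - 2 * h * y * t + y\<^sup>2 * 1))"
    by (intro sums_mult sums_add sums_diff poisson_sums poisson_sums_mean poisson_sums_square)
  moreover have "h\<^sup>2 * (t\<^sup>2 + t) - 2 * h * y * t + y\<^sup>2 * 1 = h * y"
    by (simp add: t(2)[symmetric] power2_eq_square algebra_simps)
  ultimately have C: "(\<lambda>j. M * (h\<^sup>2 * ((real j)\<^sup>2 * poisson t j) - 2 * h * y * (real j * poisson t j) + y\<^sup>2 * poisson t j)) sums (M * (h * y))"
    by (simp only:)
  have "norm ((\<Sum>j. f (x - real j * h) * of_real (poisson t j)) - f (x - y)) \<le> M * (h * y)"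
  proof (rule norm_le_of_sums[OF A C])
    fix j
    have "f (x - real j * h) * of_real (poisson t j) - f (x - y) * of_real (poisson t j)
      + (of_real h * f' (x - y) * of_real (real j * poisson t j) - of_real y * f' (x - y) * of_real (poisson t j)) =
      (f (x - real j * h) - f (x - y) - of_real ((x - real j * h) - (x - y)) * f' (x - y)) * of_real (poisson t j)"
      by (simp add: algebra_simps)
    also have "norm \<dots> \<le> M * ((x - real j * h) - (x - y))\<^sup>2 * poisson t j"
      unfolding norm_mult[of _ "of_real (poisson t j)"] norm_of_real abs_of_nonneg[OF poisson_nonneg[OF less_imp_le[OF t(1)]]]
      by (intro mult_right_mono taylor_le poisson_nonneg) (use t in simp)
    also have "\<dots> = M * (h\<^sup>2 * ((real j)\<^sup>2 * poisson t j) - 2 * h * y * (real j * poisson t j) + y\<^sup>2 * poisson t j)"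
      by (simp add: power2_eq_square algebra_simps)
    finally show "norm (f (x - real j * h) * of_real (poisson t j) - f (x - y) * of_real (poisson t j)
      + (of_real h * f' (x - y) * of_real (real j * poisson t j) - of_real y * f' (x - y) * of_real (poisson t j)))
      \<le> M * (h\<^sup>2 * ((real j)\<^sup>2 * poisson t j) - 2 * h * y * (real j * poisson t j) + y\<^sup>2 * poisson t j)" .
  qed
  thus ?thesis by (simp only: p)
qed

definition GL_kernel :: "real \<Rightarrow> real \<Rightarrow> real \<Rightarrow> complex" where
  "GL_kernel x h y = (\<Sum>j. f (x - real (j + 2) * h) * cpoisson (1 / h) (j + 2) y) + f x * cpoisson_defect (1 / h) y + f' x * sine_kernel (1 / h) y"

lemma GL_kernel_bound:
  assumes h: "0 < h" "h \<le> H" and y: "y > 0"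
  shows "norm (GL_kernel x h y) \<le> (2 * M + norm (f' x) * (2 + H) + 2 * B) * min 1 (y\<^sup>2)"
proof -
  define t where "t = 1 / h * y"
  have t: "t > 0" "h * t = y" using h y by (auto simp: t_def)
  define S where "S = (\<Sum>j. f (x - real (j + 2) * h) * of_real (poisson t (j + 2)))"
  have p: "cpoisson (1 / h) j y = of_real (poisson t j)" for j by (simp add: cpoisson_eq_poisson t_def)
  have K: "GL_kernel x h y = S + f x * cpoisson_defect (1 / h) y + f' x * sine_kernel (1 / h) y"
    unfolding GL_kernel_def S_def p ..
  have s1: "(\<lambda>j. f (x - real (j + 2) * h) * of_real (poisson t (j + 2))) sums S"
  proof -
    have "summable (\<lambda>j. norm (f (x - real (j + 2) * h) * cpoisson (1 / h) (j + 2) y))"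
      by (rule f_pois_summable) (use h y in simp)
    hence "summable (\<lambda>j. f (x - real (j + 2) * h) * of_real (poisson t (j + 2)))"
      unfolding p by (rule summable_norm_cancel)
    thus ?thesis unfolding S_def by (rule summable_sums)
  qed
  have pr0: "poisson t 0 = exp (- t)" "poisson t 1 = t * exp (- t)" by (simp_all add: poisson_def)
  have s0r: "(\<lambda>j. poisson t (j + 2)) sums (1 - poisson t 0 - poisson t 1)"
    using sums_split_initial_segment[OF poisson_sums[of t], of 2] by (simp add: numeral_2_eq_2 algebra_simps)
  have U_eq: "cpoisson_defect (1 / h) y = - of_real (1 - poisson t 0 - poisson t 1)" by (simp add: cpoisson_defect_def p)
  have Y0: "y * exp (- t) = h * poisson t 1" unfolding pr0(2) t(2)[symmetric] by (rule mult.assoc)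
  have sine: "sine_kernel (1 / h) y = of_real (sin y) - of_real (y * exp (- t))"
    by (simp add: sine_kernel_def t_def flip: exp_of_real)
  have C0: "2 * M + norm (f' x) * (2 + H) + 2 * B \<ge> 0" using M_nonneg B_nonneg h by simp
  show ?thesis
  proof (cases "y \<le> 1")
    case True
    have "(\<lambda>j. real (j + 2) * poisson t (j + 2)) sums (t - poisson t 1)"
      using sums_split_initial_segment[OF poisson_sums_mean[of t], of 2] by (simp add: numeral_2_eq_2)
    hence sm: "(\<lambda>j. complex_of_real (real (j + 2) * poisson t (j + 2))) sums of_real (t - poisson t 1)" by (intro sums_of_real)
    have s0: "(\<lambda>j. complex_of_real (poisson t (j + 2))) sums of_real (1 - poisson t 0 - poisson t 1)" by (intro sums_of_real s0r)
    have A: "(\<lambda>j. f (x - real (j + 2) * h) * of_real (poisson t (j + 2)) - f x * of_real (poisson t (j + 2))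
        + of_real h * f' x * of_real (real (j + 2) * poisson t (j + 2))) sums
        (S - f x * of_real (1 - poisson t 0 - poisson t 1) + of_real h * f' x * of_real (t - poisson t 1))"
      by (intro sums_add sums_diff sums_mult s1 s0 sm)
    define R where "R = S - f x * of_real (1 - poisson t 0 - poisson t 1) + of_real h * f' x * of_real (t - poisson t 1)"
    have "of_real h * f' x * of_real (t - poisson t 1) = f' x * of_real (h * t - h * poisson t 1)"
      by (simp add: algebra_simps)
    hence Q: "of_real h * f' x * of_real (t - poisson t 1) = f' x * (of_real y - of_real (h * poisson t 1))"
      by (simp only: t(2) of_real_diff)
    have R_eq: "R = S + f x * cpoisson_defect (1 / h) y + f' x * (of_real y - of_real (y * exp (- t)))"
      unfolding R_def U_eq Y0 Q by (simp only: mult_minus_right add_uminus_conv_diff)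
    have GK: "GL_kernel x h y = R + f' x * of_real (sin y - y)"
      unfolding K R_eq sine by (simp add: algebra_simps)
    have C: "(\<lambda>j. 2 * M * h\<^sup>2 * (real (j + 2) * real (j + 1) * poisson t (j + 2))) sums (2 * M * h\<^sup>2 * t\<^sup>2)"
      by (intro sums_mult poisson_sums_factorial2)
    have "norm R \<le> 2 * M * h\<^sup>2 * t\<^sup>2"
    proof (rule norm_le_of_sums[OF A[folded R_def] C])
      fix j
      have "f (x - real (j + 2) * h) * of_real (poisson t (j + 2)) - f x * of_real (poisson t (j + 2))
        + of_real h * f' x * of_real (real (j + 2) * poisson t (j + 2)) =
        (f (x - real (j + 2) * h) - f x - of_real (x - real (j + 2) * h - x) * f' x) * of_real (poisson t (j + 2))"
        by (simp add: algebra_simps)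
      also have "norm \<dots> \<le> M * (x - real (j + 2) * h - x)\<^sup>2 * poisson t (j + 2)"
        unfolding norm_mult[of _ "of_real (poisson t (j + 2))"] norm_of_real abs_of_nonneg[OF poisson_nonneg[OF less_imp_le[OF t(1)]]]
        by (intro mult_right_mono taylor_le poisson_nonneg) (use t in simp)
      also have "\<dots> = M * h\<^sup>2 * ((real (j + 2))\<^sup>2 * poisson t (j + 2))"
        by (simp add: power2_eq_square algebra_simps)
      also have "\<dots> \<le> M * h\<^sup>2 * (2 * real (j + 2) * real (j + 1) * poisson t (j + 2))"
        using M_nonneg poisson_nonneg[of t "j + 2"] t
        by (intro mult_left_mono mult_right_mono) (auto simp: power2_eq_square algebra_simps)
      finally show "norm (f (x - real (j + 2) * h) * of_real (poisson t (j + 2)) - f x * of_real (poisson t (j + 2))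
        + of_real h * f' x * of_real (real (j + 2) * poisson t (j + 2))) \<le> 2 * M * h\<^sup>2 * (real (j + 2) * real (j + 1) * poisson t (j + 2))"
        by (simp only: mult_ac)
    qed
    also have "2 * M * h\<^sup>2 * t\<^sup>2 = 2 * M * y\<^sup>2" by (simp add: t(2)[symmetric] power_mult_distrib)
    finally have R_le: "norm R \<le> 2 * M * y\<^sup>2" .
    have "norm (GL_kernel x h y) \<le> norm R + norm (f' x * of_real (sin y - y))" unfolding GK by (rule norm_triangle_ineq)
    also have "\<dots> \<le> 2 * M * y\<^sup>2 + norm (f' x) * y\<^sup>2"
      unfolding norm_mult norm_of_real by (intro add_mono R_le mult_left_mono abs_sin_minus_le) auto
    also have "\<dots> = (2 * M + norm (f' x)) * y\<^sup>2" by (simp add: algebra_simps)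
    also have "\<dots> \<le> (2 * M + norm (f' x) * (2 + H) + 2 * B) * y\<^sup>2"
    proof (intro mult_right_mono)
      have "norm (f' x) * 1 \<le> norm (f' x) * (2 + H)" using h by (intro mult_left_mono) auto
      thus "2 * M + norm (f' x) \<le> 2 * M + norm (f' x) * (2 + H) + 2 * B" using B_nonneg by simp
    qed simp
    also have "y\<^sup>2 = min 1 (y\<^sup>2)" using True y power_le_one[of y 2] by simp
    finally show ?thesis .
  next
    case False
    have tot: "1 - poisson t 0 - poisson t 1 \<le> 1" "0 \<le> 1 - poisson t 0 - poisson t 1"
    proof -
      show "1 - poisson t 0 - poisson t 1 \<le> 1" using poisson_nonneg[of t 0] poisson_nonneg[of t 1] t by simp
      show "0 \<le> 1 - poisson t 0 - poisson t 1"
        using sums_le[OF _ sums_zero s0r] poisson_nonneg t by simp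
    qed
    have "norm S \<le> B * (1 - poisson t 0 - poisson t 1)"
    proof (rule norm_le_of_sums[OF s1 sums_mult[OF s0r]])
      show "norm (f (x - real (j + 2) * h) * of_real (poisson t (j + 2))) \<le> B * poisson t (j + 2)" for j
        using f_bd poisson_nonneg[of t "j + 2"] t by (simp add: norm_mult mult_right_mono)
    qed
    also have "\<dots> \<le> B * 1" by (intro mult_left_mono tot B_nonneg)
    finally have 1: "norm S \<le> B" by simp
    have 2: "norm (f x * cpoisson_defect (1 / h) y) \<le> B * 1"
      unfolding norm_mult U_eq norm_minus_cancel norm_of_real using tot f_bd B_nonneg
      by (intro mult_mono) auto
    have 3: "norm (sine_kernel (1 / h) y) \<le> 1 + H"
    proof -
      have "norm (sine_kernel (1 / h) y) \<le> \<bar>sin y\<bar> + \<bar>y * exp (- t)\<bar>"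
        unfolding sine by (rule order_trans[OF norm_triangle_ineq4]) (simp only: norm_of_real order_refl)
      also have "\<bar>y * exp (- t)\<bar> \<le> h" using y_exp_bound[OF h(1) y] by (simp add: t_def)
      finally show ?thesis using abs_sin_le_one[of y] h by linarith
    qed
    have "norm (GL_kernel x h y) \<le> norm S + norm (f x * cpoisson_defect (1 / h) y) + norm (f' x * sine_kernel (1 / h) y)"
      unfolding K by (rule order_trans[OF norm_triangle_ineq add_right_mono[OF norm_triangle_ineq]])
    also have "\<dots> \<le> B + B * 1 + norm (f' x) * (1 + H)"
      unfolding norm_mult[of "f' x"] by (intro add_mono 1 2 mult_left_mono 3) auto
    also have "\<dots> \<le> 2 * M + norm (f' x) * (2 + H) + 2 * B"
      using M_nonneg by (simp add: algebra_simps)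
    also have "\<dots> = (2 * M + norm (f' x) * (2 + H) + 2 * B) * min 1 (y\<^sup>2)"
      using False one_le_power[of y 2] by simp
    finally show ?thesis .
  qed
qed

lemma GL_kernel_tendsto:
  fixes X :: "nat \<Rightarrow> real"
  assumes X: "\<And>n. X n > 0" "X \<longlonglongrightarrow> 0" and y: "y > 0"
  shows "(\<lambda>n. GL_kernel x (X n) y) \<longlonglongrightarrow> f (x - y) - f x + f' x * of_real (sin y)"
proof -
  have lim_t: "filterlim (\<lambda>n. 1 / X n * y) at_top sequentially"
  proof -
    have "filterlim (\<lambda>n. inverse (X n)) at_top sequentially"
      by (rule filterlim_inverse_at_top[OF X(2)]) (use X(1) in auto)
    hence "filterlim (\<lambda>n. y * inverse (X n)) at_top sequentially"
      by (rule filterlim_tendsto_pos_mult_at_top[OF tendsto_const y])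
    thus ?thesis by (simp add: divide_inverse mult.commute)
  qed
  have pr1: "(\<lambda>n. poisson (1 / X n * y) 1) \<longlonglongrightarrow> 0"
  proof -
    have "((\<lambda>t::real. t ^ 1 / exp t) \<longlongrightarrow> 0) at_top" by (rule tendsto_power_div_exp_0)
    from filterlim_compose[OF this lim_t] show ?thesis by (simp add: poisson_def exp_minus field_simps)
  qed
  have ye: "(\<lambda>n. y * exp (- (1 / X n * y))) \<longlonglongrightarrow> 0"
    by (rule tendsto_sandwich[OF _ _ tendsto_const X(2)])
       (use y_exp_bound[OF X(1) y] in \<open>auto intro!: always_eventually\<close>)
  define T where "T = (\<lambda>n. \<Sum>j. f (x - real j * X n) * cpoisson (1 / X n) j y)"
  have T: "T \<longlonglongrightarrow> f (x - y)"
  proof -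
    have 1: "(\<lambda>n. M * (X n * y)) \<longlonglongrightarrow> 0"
      using tendsto_mult_right_zero[OF tendsto_mult_left_zero[OF X(2)], of M y] .
    have "norm (T n - f (x - y)) \<le> M * (X n * y)" for n
      unfolding T_def by (rule poisson_average_le[OF X(1) y])
    hence "(\<lambda>n. T n - f (x - y)) \<longlonglongrightarrow> 0"
      by (intro Lim_null_comparison[OF always_eventually 1] allI)
    thus ?thesis by (rule LIM_zero_cancel)
  qed
  have D: "(\<lambda>n. of_real (poisson (1 / X n * y) 1) * (f x - f (x - X n))) \<longlonglongrightarrow> 0"
  proof (rule Lim_null_comparison)
    have "norm (of_real (poisson (1 / X n * y) 1) * (f x - f (x - X n))) \<le> poisson (1 / X n * y) 1 * (2 * B)" for n
    proof -
      have "poisson (1 / X n * y) 1 \<ge> 0" using X(1)[of n] y by (intro poisson_nonneg) simp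
      moreover have "norm (f x - f (x - X n)) \<le> 2 * B"
        using norm_triangle_ineq4[of "f x" "f (x - X n)"] f_bd[of x] f_bd[of "x - X n"] by linarith
      ultimately show ?thesis unfolding norm_mult norm_of_real by (simp only: abs_of_nonneg mult_left_mono)
    qed
    thus "\<forall>\<^sub>F n in sequentially. norm (of_real (poisson (1 / X n * y) 1) * (f x - f (x - X n))) \<le> poisson (1 / X n * y) 1 * (2 * B)"
      by (intro always_eventually allI)
    show "(\<lambda>n. poisson (1 / X n * y) 1 * (2 * B)) \<longlonglongrightarrow> 0" by (rule tendsto_mult_left_zero[OF pr1])
  qed
  have eq: "GL_kernel x (X n) y = T n - f x + of_real (poisson (1 / X n * y) 1) * (f x - f (x - X n))
      + f' x * (of_real (sin y) - of_real (y * exp (- (1 / X n * y))))" for n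
  proof -
    have "summable (\<lambda>j. f (x - real j * X n) * cpoisson (1 / X n) j y)"
    proof (rule summable_norm_cancel)
      have "summable (\<lambda>j. norm (f (x - real j * X n) * cpoisson (1 / X n) (j + 0) y))"
        by (rule f_pois_summable) (use X(1)[of n] y in simp)
      thus "summable (\<lambda>j. norm (f (x - real j * X n) * cpoisson (1 / X n) j y))" unfolding add_0_right .
    qed
    from suminf_split_initial_segment[OF this, of 2]
    have "T n = (\<Sum>j. f (x - real (j + 2) * X n) * cpoisson (1 / X n) (j + 2) y) + f x * cpoisson (1 / X n) 0 y + f (x - X n) * cpoisson (1 / X n) 1 y"
      unfolding T_def by (simp add: numeral_2_eq_2)
    hence "GL_kernel x (X n) y = T n - f x + cpoisson (1 / X n) 1 y * (f x - f (x - X n)) + f' x * sine_kernel (1 / X n) y"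
      unfolding GL_kernel_def cpoisson_defect_def by (simp add: algebra_simps)
    moreover have "sine_kernel (1 / X n) y = of_real (sin y) - of_real (y * exp (- (1 / X n * y)))"
      by (simp add: sine_kernel_def flip: exp_of_real)
    ultimately show ?thesis by (simp only: cpoisson_eq_poisson)
  qed
  have "(\<lambda>n. T n - f x + of_real (poisson (1 / X n * y) 1) * (f x - f (x - X n))
      + f' x * (of_real (sin y) - of_real (y * exp (- (1 / X n * y))))) \<longlonglongrightarrow>
      f (x - y) - f x + 0 + f' x * (of_real (sin y) - of_real 0)"
    by (intro tendsto_intros T D ye)
  thus ?thesis unfolding eq by simp
qed

end

subsection \<open>The logarithmic series\<close>

lemma harm_floor_tendsto:
  fixes X :: "nat \<Rightarrow> real"
  assumes X: "\<And>n. X n > 0" "X \<longlonglongrightarrow> 0"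
  shows "(\<lambda>n. harm (nat \<lfloor>1 / X n\<rfloor>) - ln (1 / X n)) \<longlonglongrightarrow> euler_mascheroni"
proof -
  define q where "q = (\<lambda>n. 1 / X n)"
  define N where "N = (\<lambda>n. nat \<lfloor>q n\<rfloor>)"
  have q: "filterlim q at_top sequentially"
  proof -
    have "filterlim (\<lambda>n. inverse (X n)) at_top sequentially"
      by (rule filterlim_inverse_at_top[OF X(2)]) (use X(1) in auto)
    thus ?thesis by (simp add: q_def divide_inverse)
  qed
  have N: "filterlim N at_top sequentially"
    unfolding N_def
    by (rule filterlim_compose[OF filterlim_nat_sequentially filterlim_compose[OF filterlim_floor_sequentially q]])
  have 1: "(\<lambda>n. harm (N n) - ln (real (N n))) \<longlonglongrightarrow> euler_mascheroni"
    by (rule filterlim_compose[OF euler_mascheroni_LIMSEQ N])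
  have invN: "(\<lambda>n. inverse (real (N n))) \<longlonglongrightarrow> 0"
    by (rule filterlim_compose[OF lim_inverse_n N])
  have "eventually (\<lambda>n. q n \<ge> 1) sequentially" using q by (simp add: filterlim_at_top)
  hence ev: "eventually (\<lambda>n. norm (ln (q n) - ln (real (N n))) \<le> inverse (real (N n))) sequentially"
  proof eventually_elim
    case (elim n)
    have N1: "real (N n) \<ge> 1" "real (N n) \<le> q n" "q n < real (N n) + 1"
    proof -
      have "1 \<le> \<lfloor>q n\<rfloor>" using elim by (simp add: le_floor_iff)
      hence "real (N n) = of_int \<lfloor>q n\<rfloor>" "1 \<le> real_of_int \<lfloor>q n\<rfloor>" by (simp_all add: N_def)
      thus "real (N n) \<ge> 1" "real (N n) \<le> q n" "q n < real (N n) + 1" by linarith+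
    qed
    have "ln (q n) - ln (real (N n)) \<le> (q n - real (N n)) / real (N n)"
      by (rule ln_diff_le) (use N1 in auto)
    also have "\<dots> \<le> 1 / real (N n)" by (rule divide_right_mono) (use N1 in linarith)+
    also have "1 / real (N n) = inverse (real (N n))" by (simp add: divide_inverse)
    finally have "ln (q n) - ln (real (N n)) \<le> inverse (real (N n))" .
    moreover have "ln (q n) - ln (real (N n)) \<ge> 0" using N1 by simp
    ultimately show ?case by simp
  qed
  have "(\<lambda>n. ln (q n) - ln (real (N n))) \<longlonglongrightarrow> 0" by (rule Lim_null_comparison[OF ev invN])
  from tendsto_diff[OF 1 this] show ?thesis by (simp add: q_def N_def)
qed

lemma sums_summation_by_parts:
  fixes b :: "nat \<Rightarrow> complex"
  assumes b: "\<And>j. norm (b j) \<le> B"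
    and S: "(\<lambda>j. b (j + 2) / of_nat ((j + 1) * (j + 2))) sums S"
  shows "(\<lambda>j. (b (j + 2) - b (j + 1)) / of_nat (j + 1)) sums (S - b 1)"
proof -
  have eq: "(\<Sum>j<n. (b (j + 2) - b (j + 1)) / of_nat (j + 1)) =
      (\<Sum>j<n. b (j + 2) / of_nat ((j + 1) * (j + 2))) - b 1 + b (n + 1) / of_nat (n + 1)" for n
  proof (induction n)
    case (Suc n)
    have "(v - u) / x + u / x = v / (x * y) + v / y" if "x \<noteq> 0" "y \<noteq> 0" "y = x + 1" for u v x y :: complex
      using that by (simp add: divide_simps) (simp add: algebra_simps)
    from this[of "of_nat (n + 1)" "of_nat (n + 2)" "b (n + 2)" "b (n + 1)"]
    have step: "(b (n + 2) - b (n + 1)) / of_nat (n + 1) + b (n + 1) / of_nat (n + 1) =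
       b (n + 2) / of_nat ((n + 1) * (n + 2)) + b (n + 2) / of_nat (n + 2)"
      unfolding of_nat_mult using of_nat_neq_0[of n, where 'a = complex] of_nat_neq_0[of "Suc n", where 'a = complex] by simp
    have gen: "A - b1 + p + d = A + e - b1 + r" if "d + p = e + r" for A b1 p d e r :: complex
      using that by (simp add: algebra_simps)
    have last: "b (Suc n + 1) / of_nat (Suc n + 1) = b (n + 2) / of_nat (n + 2)" by simp
    show ?case unfolding sum.lessThan_Suc Suc.IH last by (rule gen[OF step])
  qed simp
  have "(\<lambda>n. b (n + 1) / of_nat (n + 1)) \<longlonglongrightarrow> 0"
  proof (rule Lim_null_comparison)
    show "\<forall>\<^sub>F n in sequentially. norm (b (n + 1) / of_nat (n + 1)) \<le> B * inverse (real (Suc n))"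
    proof (intro always_eventually allI)
      fix n
      have "norm (b (n + 1) / of_nat (n + 1)) = norm (b (n + 1)) * inverse (real (Suc n))"
        unfolding norm_divide norm_of_nat by (simp only: divide_inverse Suc_eq_plus1)
      also have "\<dots> \<le> B * inverse (real (Suc n))" by (intro mult_right_mono b) simp
      finally show "norm (b (n + 1) / of_nat (n + 1)) \<le> B * inverse (real (Suc n))" .
    qed
    show "(\<lambda>n. B * inverse (real (Suc n))) \<longlonglongrightarrow> 0"
      by (rule tendsto_mult_right_zero[OF LIMSEQ_inverse_real_of_nat])
  qed
  from tendsto_add[OF tendsto_diff[OF S[unfolded sums_def] tendsto_const[of "b 1"]] this]
  show ?thesis unfolding sums_def eq by simp
qed

lemma le_interpolate:
  fixes E a b :: real
  assumes "0 \<le> E" "E \<le> a" "E \<le> b" "0 < l" "l < 1"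
  shows "E \<le> a powr (1 - l) * b powr l"
proof (cases "E = 0")
  case False
  hence E: "E > 0" using assms by simp
  have "E = E powr (1 - l) * E powr l" using E by (simp flip: powr_add)
  also have "\<dots> \<le> a powr (1 - l) * b powr l" using assms E by (intro mult_mono powr_mono2) auto
  finally show ?thesis .
qed simp

lemma bigo_at_bot_decay:
  fixes g :: "real \<Rightarrow> complex"
  assumes cont: "continuous_on UNIV g" and \<beta>: "\<beta> > 0"
    and O: "g \<in> O[at_bot](\<lambda>y. complex_of_real (\<bar>y\<bar> powr (- \<beta>)))"
  shows "\<exists>K>0. \<forall>y>0. norm (g (x - y)) \<le> K * y powr (- \<beta>)"
proof -
  obtain C where C: "C > 0" "eventually (\<lambda>y. norm (g y) \<le> C * norm (complex_of_real (\<bar>y\<bar> powr (- \<beta>)))) at_bot"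
    using landau_o.bigE[OF O] by blast
  then obtain N where N: "\<And>y. y \<le> N \<Longrightarrow> norm (g y) \<le> C * \<bar>y\<bar> powr (- \<beta>)"
    unfolding eventually_at_bot_linorder by auto
  define y0 where "y0 = max 1 (max (2 * \<bar>x\<bar>) (x - N))"
  have y0: "y0 \<ge> 1" "y0 \<ge> 2 * \<bar>x\<bar>" "y0 \<ge> x - N" by (auto simp: y0_def)
  have "compact (g ` {x - y0..x})"
    by (intro compact_continuous_image continuous_on_subset[OF cont]) auto
  from compact_imp_bounded[OF this] obtain G where G: "\<And>y. y \<in> {x - y0..x} \<Longrightarrow> norm (g y) \<le> G"
    unfolding bounded_iff by blast
  have "norm (g x) \<le> G" using y0 by (intro G) simp
  hence G0: "G \<ge> 0" by (rule order_trans[OF norm_ge_zero])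
  define K where "K = C * 2 powr \<beta> + G * y0 powr \<beta>"
  have Kpos: "K > 0" using C(1) G0 by (simp add: K_def add_pos_nonneg)
  have "norm (g (x - y)) \<le> K * y powr (- \<beta>)" if y: "y > 0" for y
  proof (cases "y \<le> y0")
    case True
    have "norm (g (x - y)) \<le> G * 1" using G[of "x - y"] True y by simp
    also have "1 = y powr \<beta> * y powr (- \<beta>)" using y by (simp flip: powr_add)
    also have "G * (y powr \<beta> * y powr (- \<beta>)) \<le> G * (y0 powr \<beta> * y powr (- \<beta>))"
      using True y \<beta> G0 by (intro mult_left_mono mult_right_mono powr_mono2) auto
    also have "\<dots> \<le> K * y powr (- \<beta>)"
      unfolding K_def using C(1) by (simp add: algebra_simps)
    finally show ?thesis .
  next
    case False
    have "x - y \<le> N" using False y0 by simp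
    hence "norm (g (x - y)) \<le> C * \<bar>x - y\<bar> powr (- \<beta>)" by (rule N)
    also have "\<bar>x - y\<bar> powr (- \<beta>) \<le> (y / 2) powr (- \<beta>)"
    proof (rule powr_mono2')
      show "y / 2 \<le> \<bar>x - y\<bar>" using False y0 by linarith
    qed (use y \<beta> in auto)
    also have "(y / 2) powr (- \<beta>) = 2 powr \<beta> * y powr (- \<beta>)"
      using y by (simp add: powr_divide powr_minus field_simps)
    finally have "norm (g (x - y)) \<le> C * (2 powr \<beta> * y powr (- \<beta>))" using C(1) by simp
    also have "\<dots> \<le> K * y powr (- \<beta>)" unfolding K_def using G0 by (simp add: algebra_simps)
    finally show ?thesis .
  qed
  thus ?thesis using Kpos by blast
qed

context bounded_C2
begin

lemma vector_derivative_f [simp]: "vector_derivative f (at x) = f' x"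
  using d1 by (rule vector_derivative_at)

lemma difference_quotient_error: "norm (f' x + (f (x - h) - f x) / of_real h) \<le> M * h" if h: "h > 0"
proof -
  have "f' x + (f (x - h) - f x) / of_real h = (f (x - h) - f x - of_real (x - h - x) * f' x) / of_real h"
    using h by (simp add: field_simps)
  also have "norm \<dots> \<le> M * (x - h - x)\<^sup>2 / h"
    unfolding norm_divide norm_of_real abs_of_pos[OF h] by (intro divide_right_mono taylor_le) (use h in simp)
  also have "\<dots> = M * h" using h by (simp add: power2_eq_square)
  finally show ?thesis .
qed

definition inner_sum :: "real \<Rightarrow> real \<Rightarrow> complex" where
  "inner_sum x h = (\<Sum>j. f (x - real (j + 2) * h) / of_nat ((j + 1) * (j + 2)))"

lemma inner_sum_sums: "(\<lambda>j. f (x - real (j + 2) * h) / of_nat ((j + 1) * (j + 2))) sums inner_sum x h"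
proof -
  have "summable (\<lambda>n. inverse ((real n)\<^sup>2))" by (rule inverse_power_summable) simp
  hence "summable (\<lambda>n. inverse ((real (n + 1))\<^sup>2))" by (subst summable_iff_shift)
  hence s: "summable (\<lambda>n. B * inverse ((real (n + 1))\<^sup>2))" by (rule summable_mult)
  have "summable (\<lambda>j. f (x - real (j + 2) * h) / of_nat ((j + 1) * (j + 2)))"
  proof (rule summable_comparison_test_ev[OF always_eventually s], rule allI)
    fix j
    have "norm (f (x - real (j + 2) * h) / of_nat ((j + 1) * (j + 2))) = norm (f (x - real (j + 2) * h)) * inverse (real (j + 1) * real (j + 2))"
      unfolding norm_divide norm_of_nat by (simp only: divide_inverse of_nat_mult)
    also have "\<dots> \<le> B * inverse ((real (j + 1))\<^sup>2)"
      by (intro mult_mono f_bd le_imp_inverse_le) (auto simp: power2_eq_square B_nonneg)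
    finally show "norm (f (x - real (j + 2) * h) / of_nat ((j + 1) * (j + 2))) \<le> B * inverse ((real (j + 1))\<^sup>2)" .
  qed
  thus ?thesis unfolding inner_sum_def by (rule summable_sums)
qed

context
  fixes x \<beta> K :: real
  assumes \<beta>: "\<beta> > 0" and K: "K > 0" and decay: "\<And>y. y > 0 \<Longrightarrow> norm (f' (x - y)) \<le> K * y powr (- \<beta>)"
begin

lemma f'_div_summable:
  assumes h: "h > 0"
  shows "summable (\<lambda>j. f' (x - real (j + 1) * h) / of_nat (j + 1))"
proof (rule summable_comparison_test_ev[OF always_eventually])
  have "summable (\<lambda>n. real n powr (- \<beta> - 1))" using \<beta> by (simp add: summable_real_powr_iff)
  hence "summable (\<lambda>n. real (n + 1) powr (- \<beta> - 1))" by (subst summable_iff_shift)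
  thus "summable (\<lambda>n. K * h powr (- \<beta>) * real (n + 1) powr (- \<beta> - 1))" by (rule summable_mult)
  show "\<forall>j. norm (f' (x - real (j + 1) * h) / of_nat (j + 1)) \<le> K * h powr (- \<beta>) * real (j + 1) powr (- \<beta> - 1)"
  proof
    fix j
    have "norm (f' (x - real (j + 1) * h) / of_nat (j + 1)) = norm (f' (x - real (j + 1) * h)) / real (j + 1)"
      by (simp only: norm_divide norm_of_nat)
    also have "\<dots> \<le> K * (real (j + 1) * h) powr (- \<beta>) / real (j + 1)"
      by (intro divide_right_mono decay) (use h in auto)
    also have "\<dots> = K * h powr (- \<beta>) * (real (j + 1) powr (- \<beta>) / real (j + 1) powr 1)"
      using h by (simp add: powr_mult)
    also have "\<dots> = K * h powr (- \<beta>) * real (j + 1) powr (- \<beta> - 1)" by (simp only: powr_diff)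
    finally show "norm (f' (x - real (j + 1) * h) / of_nat (j + 1)) \<le> K * h powr (- \<beta>) * real (j + 1) powr (- \<beta> - 1)" .
  qed
qed

lemma log_term_sums:
  assumes h: "h > 0"
  shows "(\<lambda>j. log_term f x h (Suc j)) sums
    (f' x * of_real (harm (nat \<lfloor>1 / h\<rfloor>)) - (\<Sum>j. f' (x - real (j + 1) * h) / of_nat (j + 1)))"
proof -
  define N where "N = nat \<lfloor>1 / h\<rfloor>"
  have N: "real (Suc j) \<le> 1 / h \<longleftrightarrow> j < N" for j
  proof -
    have "real (Suc j) \<le> 1 / h \<longleftrightarrow> int (Suc j) \<le> \<lfloor>1 / h\<rfloor>" by (simp add: le_floor_iff)
    also have "\<dots> \<longleftrightarrow> j < N" using h by (auto simp: N_def)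
    finally show ?thesis .
  qed
  have "(\<lambda>j. if j < N then f' x * of_real (inverse (real (Suc j))) else 0) sums (\<Sum>j<N. f' x * of_real (inverse (real (Suc j))))"
    using sums_If_finite_set[OF finite_lessThan[of N], of "\<lambda>j. f' x * of_real (inverse (real (Suc j)))"]
    by (simp only: lessThan_iff)
  also have "(\<Sum>j<N. f' x * of_real (inverse (real (Suc j)))) = f' x * of_real (harm N)"
    by (simp add: harm_def sum_distrib_left sum.atLeast1_atMost_eq del: of_nat_Suc)
  finally have "(\<lambda>j. (if j < N then f' x * of_real (inverse (real (Suc j))) else 0) - f' (x - real (j + 1) * h) / of_nat (j + 1)) sums
     (f' x * of_real (harm N) - (\<Sum>j. f' (x - real (j + 1) * h) / of_nat (j + 1)))"
    by (rule sums_diff[OF _ summable_sums[OF f'_div_summable[OF h]]])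
  moreover have "(if j < N then f' x * of_real (inverse (real (Suc j))) else 0) - f' (x - real (j + 1) * h) / of_nat (j + 1) = log_term f x h (Suc j)" for j
  proof -
    have "indicator {0..inverse h} (real (Suc j)) = (if j < N then 1 else (0::complex))"
      using N[of j] by (auto simp: indicator_def inverse_eq_divide)
    thus ?thesis unfolding log_term_def vector_derivative_f by (simp add: divide_inverse algebra_simps del: of_nat_Suc)
  qed
  ultimately show ?thesis unfolding N_def by simp
qed

text \<open>
  Each numerator is both \<open>O(h)\<close> and \<open>O((j h) powr (- \<beta>))\<close>; interpolating geometrically between the
  two bounds gives a factor \<open>sqrt h\<close> and keeps a summable power of \<open>j\<close>.
\<close>
lemma difference_sum_tendsto:
  assumes X: "\<And>n. X n > 0" "X \<longlonglongrightarrow> 0"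
  shows "(\<lambda>n. \<Sum>j. (f' (x - real (j + 1) * X n) + (f (x - real (j + 2) * X n) - f (x - real (j + 1) * X n)) / of_real (X n)) / of_nat (j + 1)) \<longlonglongrightarrow> 0"
proof -
  define l where "l = 1 / (2 * (1 + \<beta>))"
  have l: "0 < l" "l < 1" using \<beta> by (auto simp: l_def field_simps)
  have l\<beta>: "1 - l - \<beta> * l = 1 / 2"
  proof -
    have "l * (1 + \<beta>) = 1 / 2" using \<beta> by (simp add: l_def)
    thus ?thesis by (simp add: algebra_simps)
  qed
  define Q where "Q = M powr (1 - l) * (2 * K) powr l"
  define E where "E = (\<lambda>h j. f' (x - real (j + 1) * h) + (f (x - real (j + 2) * h) - f (x - real (j + 1) * h)) / of_real h)"
  have E_bd: "norm (E h j / of_nat (j + 1)) \<le> Q * sqrt h * real (j + 1) powr (- \<beta> * l - 1)" if h: "h > 0" for h j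
  proof -
    define u where "u = real (j + 1) * h"
    have u: "u > 0" using h by (simp add: u_def)
    have E_eq: "E h j = f' (x - u) + (f (x - u - h) - f (x - u)) / of_real h"
      by (simp add: E_def u_def algebra_simps)
    have 1: "norm (E h j) \<le> M * h" unfolding E_eq by (rule difference_quotient_error[OF h])
    have "norm (f (x - u - h) - f (x - u)) \<le> K * u powr (- \<beta>) * norm (x - u - h - (x - u))"
    proof (rule differentiable_bound[where S = "{x - u - h..x - u}" and f' = "\<lambda>x h. h *\<^sub>R f' x"])
      show "(f has_derivative (\<lambda>h. h *\<^sub>R f' y)) (at y within {x - u - h..x - u})" for y
        using has_vector_derivative_at_within[OF d1[of y]] by (simp add: has_vector_derivative_def)
      fix y assume y: "y \<in> {x - u - h..x - u}"
      have "norm (f' (x - (x - y))) \<le> K * (x - y) powr (- \<beta>)" using y u by (intro decay) auto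
      also have "\<dots> \<le> K * u powr (- \<beta>)" using y u K \<beta> by (intro mult_left_mono powr_mono2') auto
      finally have le: "norm (f' y) \<le> K * u powr (- \<beta>)" by simp
      show "onorm (\<lambda>h. h *\<^sub>R f' y) \<le> K * u powr (- \<beta>)"
      proof (rule onorm_le)
        fix z :: real
        have "norm (z *\<^sub>R f' y) = \<bar>z\<bar> * norm (f' y)" by simp
        also have "\<dots> \<le> \<bar>z\<bar> * (K * u powr (- \<beta>))" by (intro mult_left_mono le) simp
        finally show "norm (z *\<^sub>R f' y) \<le> K * u powr (- \<beta>) * norm z" by (simp add: mult.commute)
      qed
    qed (use h in auto)
    hence "norm ((f (x - u - h) - f (x - u)) / of_real h) \<le> K * u powr (- \<beta>)"
      using h by (simp add: norm_divide divide_le_eq)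
    moreover have "norm (f' (x - u)) \<le> K * u powr (- \<beta>)" by (rule decay[OF u])
    ultimately have 2: "norm (E h j) \<le> 2 * K * u powr (- \<beta>)"
      unfolding E_eq using norm_triangle_ineq[of "f' (x - u)" "(f (x - u - h) - f (x - u)) / of_real h"] by linarith
    have "norm (E h j) \<le> (M * h) powr (1 - l) * (2 * K * u powr (- \<beta>)) powr l"
      by (rule le_interpolate[OF norm_ge_zero 1 2 l])
    also have "\<dots> = Q * (h powr (1 - l) * h powr (- (\<beta> * l))) * real (j + 1) powr (- (\<beta> * l))"
      using h K M_nonneg by (simp add: Q_def u_def powr_mult powr_powr mult_ac)
    also have "h powr (1 - l) * h powr (- (\<beta> * l)) = sqrt h"
    proof -
      have "h powr (1 - l) * h powr (- (\<beta> * l)) = h powr (1 - l - \<beta> * l)" by (simp flip: powr_add)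
      thus ?thesis unfolding l\<beta> using powr_half_sqrt[of h] h by (simp only: less_imp_le)
    qed
    finally have "norm (E h j) / real (j + 1) \<le> Q * sqrt h * real (j + 1) powr (- (\<beta> * l)) / real (j + 1)"
      by (rule divide_right_mono) simp
    also have "\<dots> = Q * sqrt h * (real (j + 1) powr (- (\<beta> * l)) / real (j + 1) powr 1)" by simp
    also have "\<dots> = Q * sqrt h * real (j + 1) powr (- \<beta> * l - 1)" by (simp only: powr_diff mult_minus_left)
    finally show ?thesis by (simp only: norm_divide norm_of_nat)
  qed
  have "summable (\<lambda>n. real n powr (- \<beta> * l - 1))" using \<beta> l by (simp add: summable_real_powr_iff)
  hence w: "summable (\<lambda>j. real (j + 1) powr (- \<beta> * l - 1))" by (subst summable_iff_shift)
  define W where "W = (\<Sum>j. real (j + 1) powr (- \<beta> * l - 1))"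
  have sE: "summable (\<lambda>j. E h j / of_nat (j + 1))" if h: "h > 0" for h
    by (rule summable_comparison_test_ev[OF always_eventually summable_mult[OF w, of "Q * sqrt h"]]) (use E_bd[OF h] in blast)
  have le: "norm (\<Sum>j. E (X n) j / of_nat (j + 1)) \<le> Q * sqrt (X n) * W" for n
    by (rule norm_le_of_sums[OF summable_sums[OF sE[OF X(1)]] sums_mult[OF summable_sums[OF w], folded W_def] E_bd[OF X(1)]])
  have "(\<lambda>n. \<Sum>j. E (X n) j / of_nat (j + 1)) \<longlonglongrightarrow> 0"
  proof (rule Lim_null_comparison)
    show "\<forall>\<^sub>F n in sequentially. norm (\<Sum>j. E (X n) j / of_nat (j + 1)) \<le> Q * sqrt (X n) * W"
      by (intro always_eventually allI le)
    have "(\<lambda>n. sqrt (X n)) \<longlonglongrightarrow> sqrt 0" by (rule tendsto_real_sqrt[OF X(2)])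
    hence "(\<lambda>n. sqrt (X n)) \<longlonglongrightarrow> 0" by simp
    thus "(\<lambda>n. Q * sqrt (X n) * W) \<longlonglongrightarrow> 0" by (intro tendsto_mult_left_zero tendsto_mult_right_zero)
  qed
  thus "(\<lambda>n. \<Sum>j. (f' (x - real (j + 1) * X n) + (f (x - real (j + 2) * X n) - f (x - real (j + 1) * X n)) / of_real (X n)) / of_nat (j + 1)) \<longlonglongrightarrow> 0"
    unfolding E_def .
qed

lemma log_part_tendsto:
  assumes X: "\<And>n. X n > 0" "X \<longlonglongrightarrow> 0"
  shows "(\<lambda>n. (\<Sum>j. log_term f x (X n) (Suc j)) - euler_mascheroni * f' x
      - (inner_sum x (X n) / of_real (X n) - f x / of_real (X n) + f' x * (1 + of_real (ln (1 / X n))))) \<longlonglongrightarrow> 0"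
proof -
  define S where "S = (\<lambda>n. \<Sum>j. (f' (x - real (j + 1) * X n) + (f (x - real (j + 2) * X n) - f (x - real (j + 1) * X n)) / of_real (X n)) / of_nat (j + 1))"
  define e where "e = (\<lambda>n. f' x + (f (x - X n) - f x) / of_real (X n))"
  have eq: "(\<Sum>j. log_term f x (X n) (Suc j)) - euler_mascheroni * f' x
      - (inner_sum x (X n) / of_real (X n) - f x / of_real (X n) + f' x * (1 + of_real (ln (1 / X n)))) =
     f' x * (of_real (harm (nat \<lfloor>1 / X n\<rfloor>) - ln (1 / X n)) - of_real euler_mascheroni) - e n - S n" for n
  proof -
    define h where "h = X n"
    have h: "h > 0" using X(1) by (simp add: h_def)
    define A where "A = (\<Sum>j. f' (x - real (j + 1) * h) / of_nat (j + 1))"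
    have 1: "(\<Sum>j. log_term f x h (Suc j)) = f' x * of_real (harm (nat \<lfloor>1 / h\<rfloor>)) - A"
      using log_term_sums[OF h] unfolding A_def by (rule sums_unique[symmetric])
    have "(\<lambda>j. (f (x - real (j + 2) * h) - f (x - real (j + 1) * h)) / of_nat (j + 1)) sums (inner_sum x h - f (x - real 1 * h))"
      by (rule sums_summation_by_parts[of "\<lambda>j. f (x - real j * h)", OF f_bd inner_sum_sums])
    hence "(\<lambda>j. (f (x - real (j + 2) * h) - f (x - real (j + 1) * h)) / of_nat (j + 1) / of_real h) sums ((inner_sum x h - f (x - real 1 * h)) / of_real h)"
      by (rule sums_divide)
    from sums_add[OF summable_sums[OF f'_div_summable[OF h]] this]
    have "(\<lambda>j. (f' (x - real (j + 1) * h) + (f (x - real (j + 2) * h) - f (x - real (j + 1) * h)) / of_real h) / of_nat (j + 1)) sums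
       (A + (inner_sum x h - f (x - h)) / of_real h)"
      unfolding A_def by (simp add: add_divide_distrib mult.commute)
    hence 2: "S n = A + (inner_sum x h - f (x - h)) / of_real h" unfolding S_def h_def by (rule sums_unique[symmetric])
    show ?thesis unfolding 2 e_def h_def[symmetric] 1 by (simp add: algebra_simps diff_divide_distrib)
  qed
  have e: "e \<longlonglongrightarrow> 0"
  proof (rule Lim_null_comparison)
    show "\<forall>\<^sub>F n in sequentially. norm (e n) \<le> M * X n"
      unfolding e_def by (intro always_eventually allI difference_quotient_error X)
    show "(\<lambda>n. M * X n) \<longlonglongrightarrow> 0" by (rule tendsto_mult_right_zero[OF X(2)])
  qed
  have S: "S \<longlonglongrightarrow> 0" unfolding S_def by (rule difference_sum_tendsto[OF X])
  have "(\<lambda>n. f' x * (of_real (harm (nat \<lfloor>1 / X n\<rfloor>) - ln (1 / X n)) - of_real euler_mascheroni) - e n - S n) \<longlonglongrightarrow>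
     f' x * (of_real euler_mascheroni - of_real euler_mascheroni) - 0 - 0"
    by (intro tendsto_intros harm_floor_tendsto X e S)
  thus ?thesis unfolding eq by simp
qed

end

end

subsection \<open>The limit\<close>

locale zolotarev_GL = zolotarev_data c \<theta> \<phi> + bounded_C2 f f' f'' B M
  for c :: real and \<theta> :: "real \<Rightarrow> real" and \<phi> :: "real measure"
    and f f' f'' :: "real \<Rightarrow> complex" and B M :: real
begin

definition weight2 :: "nat \<Rightarrow> real" where "weight2 j = real (j + 1) powr (- 5 / 4)"

lemma weight2_pos: "weight2 j > 0" by (simp add: weight2_def)

lemma weight2_summable: "summable weight2" unfolding weight2_def by (rule nat_weight_summable)

lemma weight_prod_summable: "(\<lambda>(k, j). wt k * weight2 j) summable_on (UNIV \<times> UNIV)"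
proof (rule summable_on_SigmaI)
  have "(weight2 has_sum suminf weight2) UNIV"
    using weight2_pos weight2_summable
    by (intro norm_summable_imp_has_sum summable_sums) (simp_all add: abs_of_pos)
  thus "((\<lambda>j. case (k, j) of (k, j) \<Rightarrow> wt k * weight2 j) has_sum wt k * suminf weight2) UNIV" for k
    by (simp add: has_sum_cmult_right)
  show "(\<lambda>k. wt k * suminf weight2) summable_on UNIV" by (rule summable_on_cmult_left[OF wt_summable])
qed (use wt_pos weight2_pos in \<open>auto intro: less_imp_le\<close>)

abbreviation GL_tail :: "real \<Rightarrow> real \<Rightarrow> int \<Rightarrow> complex" where
  "GL_tail x h k \<equiv> (\<Sum>j. f (x - real (j + 2) * h) * GL_weight (1 / h) k j)"

definition base_term :: "real \<Rightarrow> real \<Rightarrow> int \<Rightarrow> complex" where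
  "base_term x h k = ck k * GL_tail x h k
     + f x * (ck k * (- of_real (1 / h) * of_real (1 / h) powr (- s k) * Gamma (1 + s k)))
     + f' x * (ck k * sine_mellin (1 / h) k)"

lemma f_GL_weight_summable:
  assumes h: "h > 0"
  shows "summable (\<lambda>j. f (x - real (j + 2) * h) * GL_weight (1 / h) k j)"
proof -
  obtain C where C: "C > 0" "\<And>k j. norm (Gamma (of_nat (j + 1) + s k) / fact (j + 2)) \<le> C * (wt k * real (j + 1) powr (- 5 / 4))"
    using Gamma_div_fact_bound by auto
  have q: "1 / h > 0" using h by simp
  have "norm (f (x - real (j + 2) * h) * GL_weight (1 / h) k j) \<le> B * (1 / h * norm (1 - s k) * (C * wt k)) * weight2 j" for j
  proof -
    have "norm (GL_weight (1 / h) k j) = 1 / h * (norm (1 - s k) * norm (Gamma (of_nat (j + 1) + s k) / fact (j + 2)))"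
      unfolding GL_weight_def norm_mult norm_real_powr_s[OF q] times_divide_eq_right[symmetric] norm_of_real using h by simp
    also have "\<dots> \<le> 1 / h * (norm (1 - s k) * (C * (wt k * real (j + 1) powr (- 5 / 4))))"
      by (intro mult_left_mono C) (use h in auto)
    also have "\<dots> = 1 / h * norm (1 - s k) * (C * wt k) * weight2 j" by (simp only: weight2_def mult.assoc)
    finally have "norm (f (x - real (j + 2) * h)) * norm (GL_weight (1 / h) k j) \<le> B * (1 / h * norm (1 - s k) * (C * wt k) * weight2 j)"
      by (intro mult_mono f_bd B_nonneg norm_ge_zero)
    thus ?thesis by (simp only: norm_mult mult.assoc)
  qed
  thus ?thesis by (rule summable_comparison_test_ev[OF always_eventually[OF allI] summable_mult[OF weight2_summable]])
qed

lemma series_part_has_sum: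
  assumes h: "h > 0"
  shows "((\<lambda>k. ck k * GL_tail x h k) has_sum
      (LINT y|\<phi>. (\<Sum>j. f (x - real (j + 2) * h) * cpoisson (1 / h) (j + 2) y))) UNIV"
    and "integrable \<phi> (\<lambda>y. \<Sum>j. f (x - real (j + 2) * h) * cpoisson (1 / h) (j + 2) y)"
proof -
  define q where "q = 1 / h"
  have q: "q > 0" using h by (simp add: q_def)
  define a where "a = (\<lambda>j. f (x - real (j + 2) * h))"
  have a: "norm (a j) \<le> B" for j unfolding a_def by (rule f_bd)
  obtain C where C: "C > 0" "\<And>k j. norm (ck k * GL_weight q k j) \<le> C * (wt k * weight2 j)"
    using norm_GL_weight_bound[OF q] unfolding weight2_def by auto
  define F where "F = (\<lambda>(k, j). a j * (ck k * GL_weight q k j))"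
  have F_le: "norm (F (k, j)) \<le> B * C * (wt k * weight2 j)" for k j
  proof -
    have "norm (a j) * norm (ck k * GL_weight q k j) \<le> B * (C * (wt k * weight2 j))"
      by (intro mult_mono a C B_nonneg norm_ge_zero)
    thus ?thesis unfolding F_def by (simp only: prod.case norm_mult mult.assoc)
  qed
  have F_sum: "F summable_on (UNIV \<times> UNIV)"
  proof (rule abs_summable_summable, rule summable_on_comparison_test)
    show "(\<lambda>p. B * C * (case p of (k, j) \<Rightarrow> wt k * weight2 j)) summable_on (UNIV \<times> UNIV)"
      by (rule summable_on_cmult_right[OF weight_prod_summable])
    show "norm (F p) \<le> B * C * (case p of (k, j) \<Rightarrow> wt k * weight2 j)" for p
      using F_le by (cases p) simp
  qed auto
  define S where "S = infsum F (UNIV \<times> UNIV)"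
  have S: "(F has_sum S) (UNIV \<times> UNIV)" unfolding S_def by (rule has_sum_infsum[OF F_sum])
  have row: "((\<lambda>j. F (k, j)) has_sum ck k * (\<Sum>j. a j * GL_weight q k j)) UNIV" for k
  proof (rule norm_summable_imp_has_sum)
    show "summable (\<lambda>j. norm (F (k, j)))"
    proof (rule summable_comparison_test_ev[OF always_eventually])
      show "summable (\<lambda>j. B * C * wt k * weight2 j)" by (rule summable_mult[OF weight2_summable])
      show "\<forall>j. norm (norm (F (k, j))) \<le> B * C * wt k * weight2 j" using F_le by (simp add: mult.assoc)
    qed
    have "(\<lambda>j. ck k * (a j * GL_weight q k j)) sums (ck k * (\<Sum>j. a j * GL_weight q k j))"
      unfolding a_def q_def by (intro sums_mult summable_sums f_GL_weight_summable h)
    thus "(\<lambda>j. F (k, j)) sums (ck k * (\<Sum>j. a j * GL_weight q k j))"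
      unfolding F_def by (simp add: mult_ac)
  qed
  have R: "((\<lambda>k. ck k * (\<Sum>j. a j * GL_weight q k j)) has_sum S) UNIV"
    by (rule has_sum_SigmaD[OF S row])
  have col: "((\<lambda>k. (case (j, k) of (j, k) \<Rightarrow> F (k, j))) has_sum a j * integral\<^sup>L \<phi> (cpoisson q (j + 2))) UNIV" for j
    using has_sum_cmult_right[OF cpoisson_\<phi>_has_sum[OF q, of j], of "a j"] by (simp add: F_def)
  have "((\<lambda>(j, k). F (k, j)) has_sum S) (UNIV \<times> UNIV)" using S by (subst (asm) has_sum_swap)
  hence colsum: "((\<lambda>j. a j * integral\<^sup>L \<phi> (cpoisson q (j + 2))) has_sum S) UNIV"
    by (rule has_sum_SigmaD[OF _ col])
  have int: "integrable \<phi> (\<lambda>y. a j * cpoisson q (j + 2) y)" for j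
    by (intro integrable_mult_right cpoisson_\<phi>_integrable q)
  have nint: "(LINT y|\<phi>. norm (a j * cpoisson q (j + 2) y)) \<le> B * (C * infsum wt UNIV) * weight2 j" for j
  proof -
    have nn: "norm (cpoisson q n y) = poisson (q * y) n" if "y > 0" for n y
      unfolding cpoisson_eq_poisson norm_of_real using poisson_nonneg[of "q * y" n] q that by simp
    have "norm (integral\<^sup>L \<phi> (cpoisson q (j + 2))) \<le> C * (infsum wt UNIV * weight2 j)"
      by (rule norm_infsum_le[OF cpoisson_\<phi>_has_sum[OF q] has_sum_cmult_right[OF has_sum_cmult_left[OF has_sum_infsum[OF wt_summable]]] C(2)])
    moreover have "integral\<^sup>L \<phi> (cpoisson q (j + 2)) = of_real (LINT y|\<phi>. norm (cpoisson q (j + 2) y))"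
    proof -
      have "integral\<^sup>L \<phi> (cpoisson q (j + 2)) = (LINT y|\<phi>. complex_of_real (norm (cpoisson q (j + 2) y)))"
        by (rule Bochner_Integration.integral_cong) (simp, simp add: space_\<phi> nn del: add_2_eq_Suc', rule cpoisson_eq_poisson)
      also have "\<dots> = of_real (LINT y|\<phi>. norm (cpoisson q (j + 2) y))" by (rule integral_complex_of_real)
      finally show ?thesis .
    qed
    ultimately have le: "(LINT y|\<phi>. norm (cpoisson q (j + 2) y)) \<le> C * (infsum wt UNIV * weight2 j)"
      by (simp only: norm_of_real)
    have "(LINT y|\<phi>. norm (a j * cpoisson q (j + 2) y)) = norm (a j) * (LINT y|\<phi>. norm (cpoisson q (j + 2) y))"
      by (simp add: norm_mult)
    also have "\<dots> \<le> B * (C * (infsum wt UNIV * weight2 j))"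
      by (intro mult_mono a le B_nonneg) simp
    finally show ?thesis by (simp only: mult.assoc)
  qed
  have sn: "summable (\<lambda>j. LINT y|\<phi>. norm (a j * cpoisson q (j + 2) y))"
    by (rule summable_comparison_test_ev[OF always_eventually summable_mult[OF weight2_summable, of "B * (C * infsum wt UNIV)"]])
       (use nint in simp)
  have ae: "AE y in \<phi>. summable (\<lambda>j. norm (a j * cpoisson q (j + 2) y))"
  proof (rule AE_I2)
    fix y assume "y \<in> space \<phi>"
    hence "q * y \<ge> 0" using q by (simp add: space_\<phi>)
    thus "summable (\<lambda>j. norm (a j * cpoisson q (j + 2) y))" unfolding a_def by (rule f_pois_summable)
  qed
  have "(\<lambda>j. LINT y|\<phi>. a j * cpoisson q (j + 2) y) sums (LINT y|\<phi>. (\<Sum>j. a j * cpoisson q (j + 2) y))"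
    by (rule sums_integral[OF int ae sn])
  moreover have "(\<lambda>j. LINT y|\<phi>. a j * cpoisson q (j + 2) y) sums S"
    using has_sum_imp_sums[OF colsum] by simp
  ultimately have S_eq: "S = (LINT y|\<phi>. (\<Sum>j. a j * cpoisson q (j + 2) y))" by (rule sums_unique2[symmetric])
  show "((\<lambda>k. ck k * GL_tail x h k) has_sum
      (LINT y|\<phi>. (\<Sum>j. f (x - real (j + 2) * h) * cpoisson (1 / h) (j + 2) y))) UNIV"
    using R unfolding S_eq a_def q_def .
  show "integrable \<phi> (\<lambda>y. \<Sum>j. f (x - real (j + 2) * h) * cpoisson (1 / h) (j + 2) y)"
    using integrable_suminf[OF int ae sn] unfolding a_def q_def .
qed

lemma base_term_has_sum:
  assumes h: "h > 0"
  shows "(base_term x h has_sum integral\<^sup>L \<phi> (GL_kernel x h)) UNIV"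
proof -
  have q: "1 / h > 0" using h by simp
  have "integral\<^sup>L \<phi> (GL_kernel x h) = (LINT y|\<phi>. (\<Sum>j. f (x - real (j + 2) * h) * cpoisson (1 / h) (j + 2) y))
      + f x * integral\<^sup>L \<phi> (cpoisson_defect (1 / h)) + f' x * integral\<^sup>L \<phi> (sine_kernel (1 / h))"
    unfolding GL_kernel_def
    using series_part_has_sum(2)[OF h] cpoisson_defect_\<phi>_integrable[OF q] sine_kernel_\<phi>_integrable[OF q] by simp
  moreover have "(base_term x h has_sum (LINT y|\<phi>. (\<Sum>j. f (x - real (j + 2) * h) * cpoisson (1 / h) (j + 2) y))
      + f x * integral\<^sup>L \<phi> (cpoisson_defect (1 / h)) + f' x * integral\<^sup>L \<phi> (sine_kernel (1 / h))) UNIV"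
    unfolding base_term_def
    by (intro has_sum_add has_sum_cmult_right series_part_has_sum(1) cpoisson_defect_\<phi>_has_sum sine_kernel_\<phi>_has_sum h q)
  ultimately show ?thesis by simp
qed

lemma base_term_0: "base_term x h 0 = ck 0 * (inner_sum x h / of_real h - f x / of_real h + f' x * (1 + of_real (ln (1 / h))))"
  if h: "h > 0"
proof -
  have w: "GL_weight (1 / h) 0 j = of_real (1 / h) / of_nat ((j + 1) * (j + 2))" for j
  proof -
    have 1: "Gamma (of_nat (j + 1) :: complex) = fact j" using Gamma_fact[of j, where 'a = complex] by (simp add: add.commute)
    have 2: "(fact (j + 2) :: complex) = of_nat ((j + 1) * (j + 2)) * fact j" by (simp add: algebra_simps)
    have "GL_weight (1 / h) 0 j = of_real (1 / h) * (Gamma (of_nat (j + 1)) / fact (j + 2))"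
      using h by (simp add: GL_weight_def)
    also have "\<dots> = of_real (1 / h) * (fact j / (of_nat ((j + 1) * (j + 2)) * fact j))" by (simp only: 1 2)
    also have "\<dots> = of_real (1 / h) * (1 / of_nat ((j + 1) * (j + 2)))"
      by (simp only: nonzero_divide_mult_cancel_right[OF fact_nonzero])
    finally show ?thesis by simp
  qed
  have "(\<lambda>j. f (x - real (j + 2) * h) / of_nat ((j + 1) * (j + 2)) * of_real (1 / h)) sums (inner_sum x h * of_real (1 / h))"
    by (rule sums_mult2[OF inner_sum_sums])
  hence "(\<Sum>j. f (x - real (j + 2) * h) * GL_weight (1 / h) 0 j) = inner_sum x h * of_real (1 / h)"
    unfolding w by (simp only: times_divide_eq_left times_divide_eq_right sums_iff)
  thus ?thesis using h unfolding base_term_def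
    by (simp only: sine_mellin_def if_True) (simp add: algebra_simps)
qed

lemma GL_coeff:
  assumes k: "k \<noteq> 0"
  shows "Gamma (s k) * (((1 - s k) gchoose (j + 2)) * (- 1) ^ (j + 2)) = - ((1 - s k) * Gamma (of_nat (j + 1) + s k) / fact (j + 2))"
proof -
  have sn: "s k \<notin> \<int>\<^sub>\<le>\<^sub>0" using k \<tau>_pos by (auto elim!: nonpos_Ints_cases simp: complex_eq_iff)
  have "((1 - s k) gchoose (j + 2)) * (- 1) ^ (j + 2) = ((- 1) ^ (j + 2) * (- 1) ^ (j + 2)) * pochhammer (s k - 1) (j + 2) / fact (j + 2)"
    unfolding gbinomial_pochhammer by (simp add: mult_ac)
  also have "(- 1) ^ (j + 2) * (- 1) ^ (j + 2) = (1 :: complex)" by (simp flip: power_mult_distrib)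
  also have "pochhammer (s k - 1) (j + 2) = (s k - 1) * pochhammer (s k) (j + 1)"
    using pochhammer_rec[of "s k - 1" "j + 1"] by simp
  finally have 1: "((1 - s k) gchoose (j + 2)) * (- 1) ^ (j + 2) = 1 * ((s k - 1) * pochhammer (s k) (j + 1)) / fact (j + 2)" .
  have 2: "Gamma (of_nat (j + 1) + s k) = Gamma (s k) * pochhammer (s k) (j + 1)"
    using pochhammer_Gamma[OF sn, of "j + 1"] sn by (simp add: Gamma_eq_zero_iff add.commute)
  show ?thesis unfolding 1 2 by (simp add: algebra_simps minus_divide_left)
qed

lemma powr_inverse_h: "h > 0 \<Longrightarrow> complex_of_real (1 / h) powr (- z) = of_real h powr z"
proof -
  assume h: "h > 0"
  hence "Ln (complex_of_real (1 / h)) = - Ln (of_real h)" by (subst (1 2) Ln_of_real) (auto simp: ln_div)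
  moreover have "complex_of_real (1 / h) \<noteq> 0" "complex_of_real h \<noteq> 0" using h by auto
  ultimately show ?thesis by (simp only: powr_def if_False minus_mult_minus)
qed

lemma GL_term_sums:
  assumes h: "h > 0" and k: "k \<noteq> 0"
  shows "GL_term c f x h k sums (f x - (1 - s k) * f (x - h) + (\<Sum>j. GL_term c f x h k (j + 2)))"
    and "of_real (1 / h) * of_real (1 / h) powr (- s k) * Gamma (s k) * (\<Sum>j. GL_term c f x h k (j + 2)) =
      - GL_tail x h k"
proof -
  define P where "P = of_real (1 / h) * of_real (1 / h) powr (- s k) * Gamma (s k)"
  have sn: "s k \<notin> \<int>\<^sub>\<le>\<^sub>0" using k \<tau>_pos by (auto elim!: nonpos_Ints_cases simp: complex_eq_iff)
  have P0: "P \<noteq> 0" using h sn by (simp add: P_def Gamma_eq_zero_iff)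
  have eq: "P * GL_term c f x h k (j + 2) = - (f (x - real (j + 2) * h) * GL_weight (1 / h) k j)" for j
  proof -
    have "P * GL_term c f x h k (j + 2) = of_real (1 / h) * of_real (1 / h) powr (- s k) *
        (Gamma (s k) * (((1 - s k) gchoose (j + 2)) * (- 1) ^ (j + 2))) * f (x - real (j + 2) * h)"
      unfolding P_def GL_term_def by (simp only: mult.assoc)
    thus ?thesis unfolding GL_coeff[OF k] GL_weight_def by (simp only: mult_ac mult_minus_left mult_minus_right)
  qed
  have "(\<lambda>j. - (f (x - real (j + 2) * h) * GL_weight (1 / h) k j)) sums - GL_tail x h k"
    by (intro sums_minus summable_sums f_GL_weight_summable h)
  hence s: "(\<lambda>j. P * GL_term c f x h k (j + 2)) sums - GL_tail x h k"
    unfolding eq .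
  hence "summable (\<lambda>j. P * GL_term c f x h k (j + 2))" by (rule sums_summable)
  hence sm: "summable (\<lambda>j. GL_term c f x h k (j + 2))" by (rule summable_mult_D[OF _ P0])
  show "of_real (1 / h) * of_real (1 / h) powr (- s k) * Gamma (s k) * (\<Sum>j. GL_term c f x h k (j + 2)) =
      - GL_tail x h k"
    unfolding P_def[symmetric] suminf_mult[OF sm, symmetric] using s by (rule sums_unique[symmetric])
  have "GL_term c f x h k sums ((\<Sum>j. GL_term c f x h k (j + 2)) + (\<Sum>j<2. GL_term c f x h k j))"
    using summable_sums[OF sm] by (simp only: sums_iff_shift)
  moreover have "(\<Sum>j<2. GL_term c f x h k j) = f x - (1 - s k) * f (x - h)"
    by (simp add: GL_term_def numeral_2_eq_2 algebra_simps)
  ultimately show "GL_term c f x h k sums (f x - (1 - s k) * f (x - h) + (\<Sum>j. GL_term c f x h k (j + 2)))"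
    by (simp only: add.commute)
qed

lemma GL_term_summable:
  assumes h: "h > 0"
  shows "summable (GL_term c f x h k)"
proof (cases "k = 0")
  case True
  have "(1 gchoose j :: complex) = 0" if "j \<notin> {..1}" for j
  proof -
    have "(1 gchoose j :: complex) = of_nat (1 choose j)" using binomial_gbinomial[of 1 j, where 'a = complex] by simp
    thus ?thesis using that by (simp add: binomial_eq_0)
  qed
  hence "GL_term c f x h 0 j = 0" if "j \<notin> {..1}" for j using that by (simp add: GL_term_def)
  thus ?thesis unfolding True by (intro summable_finite[of "{..1}"]) auto
next
  case False
  show ?thesis using GL_term_sums(1)[OF h False] by (rule sums_summable)
qed

definition error_term :: "real \<Rightarrow> real \<Rightarrow> int \<Rightarrow> complex" where
  "error_term x h k = (if k = 0 then 0 else ck k * ((1 - s k) * Gamma (s k)) * of_real h powr (s k))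
     * (f' x + (f (x - h) - f x) / of_real h)"

lemma semi_term_eq:
  assumes h: "h > 0"
  shows "semi_term c \<theta> f x h k = base_term x h k + error_term x h k - (if k = 0 then base_term x h 0 else 0)"
proof (cases "k = 0")
  case True
  thus ?thesis by (simp add: semi_term_def omega1_def omega2_def error_term_def)
next
  case False
  define P where "P = complex_of_real h powr (s k)"
  define G where "G = Gamma (s k)"
  define q where "q = complex_of_real (1 / h)"
  define T where "T = (\<Sum>j. GL_term c f x h k (j + 2))"
  define co where "co = cos (of_real (pi / 2) * s k)"
  have sn: "s k \<notin> \<int>\<^sub>\<le>\<^sub>0" using False \<tau>_pos by (auto elim!: nonpos_Ints_cases simp: complex_eq_iff)
  have G1: "Gamma (1 + s k) = s k * G" using Gamma_plus1[OF sn] by (simp add: G_def add.commute)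
  have P': "q powr (- s k) = P" unfolding P_def q_def by (rule powr_inverse_h[OF h])
  have hp: "complex_of_real h powr (s k - 1) = q * P" using h by (simp add: P_def q_def powr_diff)
  have GLsum: "(\<Sum>j. GL_term c f x h k j) = f x - (1 - s k) * f (x - h) + T"
    unfolding T_def using GL_term_sums(1)[OF h False] by (rule sums_unique[symmetric])
  have tail: "GL_tail x h k = - (q * P * G * T)"
    using GL_term_sums(2)[OF h False, of x] unfolding q_def[symmetric] P' G_def[symmetric] T_def[symmetric] by simp
  have om2: "omega2 c \<theta> k = ck k * G * co"
    using False by (simp add: omega2_def G_def co_def mult.assoc)
  have om1: "omega1 c \<theta> k = - ck k * G" using False by (simp add: omega1_def G_def)
  have "semi_term c \<theta> f x h k = - ck k * G * (q * P) * (f x - (1 - s k) * f (x - h) + T) + ck k * G * co * f' x"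
    unfolding semi_term_def om1 om2 hp GLsum vector_derivative_f ..
  also have "\<dots> = (ck k * - (q * P * G * T) + f x * (ck k * (- q * P * (s k * G))) + f' x * (ck k * (G * co - (1 - s k) * G * P)))
     + ck k * ((1 - s k) * G) * P * (f' x + (f (x - h) - f x) * q)"
  proof -
    have "- C * G * (q * P) * (a - (1 - z) * b + T) + C * G * co * d =
      (C * - (q * P * G * T) + a * (C * (- q * P * (z * G))) + d * (C * (G * co - (1 - z) * G * P)))
       + C * ((1 - z) * G) * P * (d + (b - a) * q)" for C a b d z
      by (simp add: algebra_simps)
    thus ?thesis .
  qed
  also have "(f (x - h) - f x) * q = (f (x - h) - f x) / of_real h" by (simp add: q_def divide_inverse)
  finally show ?thesis
    using False unfolding base_term_def error_term_def tail q_def[symmetric] P' G1 sine_mellin_def P_def[symmetric] G_def[symmetric] co_def[symmetric]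
    by (simp only: if_False diff_zero)
qed

lemma error_term_has_sum_bound:
  "\<exists>C. \<forall>x h. h > 0 \<longrightarrow> (\<exists>S. (error_term x h has_sum S) UNIV \<and> norm S \<le> C * h)"
proof -
  obtain C where C: "C > 0" "\<And>k. k \<noteq> 0 \<Longrightarrow> norm (ck k * ((1 - s k) * Gamma (s k))) \<le> C * wt k"
    using ck_Gamma_bound by auto
  have "\<exists>S. (error_term x h has_sum S) UNIV \<and> norm S \<le> C * M * infsum wt UNIV * h" if h: "h > 0" for x h
  proof -
    have le: "norm (error_term x h k) \<le> C * M * h * wt k" for k
    proof -
      have "norm (if k = 0 then 0 else ck k * ((1 - s k) * Gamma (s k)) * of_real h powr (s k)) \<le> C * wt k"
      proof (cases "k = 0")
        case True
        thus ?thesis using C(1) wt_pos[of k] by simp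
      next
        case False
        thus ?thesis using C(2)[OF False] h
          by (simp only: if_False norm_mult[of _ "of_real h powr s k"] norm_real_powr_s mult_1_right)
      qed
      hence "norm (error_term x h k) \<le> C * wt k * (M * h)"
        unfolding error_term_def norm_mult[of _ "f' x + (f (x - h) - f x) / of_real h"]
        by (intro mult_mono difference_quotient_error h) (use C(1) wt_pos[of k] in auto)
      thus ?thesis by (simp only: mult_ac)
    qed
    have S: "(error_term x h has_sum infsum (error_term x h) UNIV) UNIV"
      by (rule has_sum_infsum[OF abs_summable_summable[OF summable_wt_bound[OF le]]])
    have "norm (infsum (error_term x h) UNIV) \<le> C * M * h * infsum wt UNIV"
      by (rule norm_infsum_le[OF S has_sum_cmult_right[OF has_sum_infsum[OF wt_summable]] le])
    hence "norm (infsum (error_term x h) UNIV) \<le> C * M * infsum wt UNIV * h" by (simp only: mult_ac)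
    with S show ?thesis by blast
  qed
  thus ?thesis by blast
qed

lemma semi_term_has_sum:
  assumes h: "h > 0" and S: "(error_term x h has_sum S) UNIV"
  shows "(semi_term c \<theta> f x h has_sum integral\<^sup>L \<phi> (GL_kernel x h) + S - base_term x h 0) UNIV"
proof -
  have "((\<lambda>k. if k = 0 then base_term x h 0 else 0) has_sum base_term x h 0) (UNIV :: int set)"
    by (rule has_sum_finite_neutralI[of "{0}"]) auto
  hence "((\<lambda>k. base_term x h k + error_term x h k + - (if k = 0 then base_term x h 0 else 0)) has_sum
      integral\<^sup>L \<phi> (GL_kernel x h) + S + - base_term x h 0) UNIV"
    by (intro has_sum_add has_sum_uminusI base_term_has_sum h S)
  moreover have "semi_term c \<theta> f x h = (\<lambda>k. base_term x h k + error_term x h k + - (if k = 0 then base_term x h 0 else 0))"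
    by (rule ext) (simp only: semi_term_eq[OF h] add_uminus_conv_diff)
  ultimately show ?thesis by (simp only: add_uminus_conv_diff)
qed

lemma zolotarev_integrand_eq: "zolotarev_integrand f x = (\<lambda>y. f (x - y) - f x + f' x * of_real (sin y))"
  by (simp add: zolotarev_integrand_def fun_eq_iff)

lemma f_continuous: "continuous_on A f"
  using d1 by (meson continuous_at_imp_continuous_on has_vector_derivative_continuous)

lemma zolotarev_integrand_measurable: "zolotarev_integrand f x \<in> borel_measurable borel"
proof -
  have "continuous_on UNIV (\<lambda>y. f (x - y))"
    by (rule continuous_on_compose2[OF f_continuous[of UNIV]]) (auto intro!: continuous_intros)
  hence "continuous_on UNIV (zolotarev_integrand f x)"
    unfolding zolotarev_integrand_eq by (intro continuous_intros)
  thus ?thesis by (rule borel_measurable_continuous_onI)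
qed

lemma GL_kernel_measurable: "GL_kernel x h \<in> borel_measurable borel"
proof -
  have [measurable]: "cpoisson q n \<in> borel_measurable borel" for q n
    by (rule borel_measurable_continuous_onI[OF continuous_on_cpoisson])
  have [measurable]: "sine_kernel q \<in> borel_measurable borel" "cpoisson_defect q \<in> borel_measurable borel" for q
    unfolding sine_kernel_def[abs_def] cpoisson_defect_def[abs_def] by measurable
  show ?thesis unfolding GL_kernel_def[abs_def] by measurable
qed

lemma zolotarev_integrable: "integrable \<phi> (zolotarev_integrand f x)"
proof (rule \<phi>_integrable_min_1_square[OF zolotarev_integrand_measurable])
  fix y :: real assume y: "y > 0"
  define X where "X = (\<lambda>n. inverse (real (Suc n)))"
  have X: "X n > 0" "X n \<le> 1" for n by (auto simp: X_def inverse_le_1_iff)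
  have "X \<longlonglongrightarrow> 0" unfolding X_def by (rule LIMSEQ_inverse_real_of_nat)
  from GL_kernel_tendsto[OF X(1) this y]
  have "(\<lambda>n. norm (GL_kernel x (X n) y)) \<longlonglongrightarrow> norm (zolotarev_integrand f x y)"
    unfolding zolotarev_integrand_eq by (rule tendsto_norm)
  thus "norm (zolotarev_integrand f x y) \<le> (2 * M + norm (f' x) * (2 + 1) + 2 * B) * min 1 (y\<^sup>2)"
    by (rule LIMSEQ_le_const2) (use GL_kernel_bound[OF X y] in blast)
qed

lemma GL_kernel_integral_tendsto:
  assumes X: "\<And>n. X n > 0" "X \<longlonglongrightarrow> 0"
  shows "(\<lambda>n. integral\<^sup>L \<phi> (GL_kernel x (X n))) \<longlonglongrightarrow> zolotarev_deriv \<phi> f x"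
proof -
  have "Bseq X" by (rule convergent_imp_Bseq) (use X(2) in \<open>auto simp: convergent_def\<close>)
  then obtain H where H: "\<And>n. norm (X n) \<le> H" unfolding Bseq_def by blast
  have XH: "X n \<le> H" for n using H[of n] by simp
  show ?thesis unfolding zolotarev_deriv_def
  proof (rule \<phi>_dominated_limit[OF GL_kernel_measurable zolotarev_integrand_measurable])
    show "norm (GL_kernel x (X n) y) \<le> (2 * M + norm (f' x) * (2 + H) + 2 * B) * min 1 (y\<^sup>2)" if "y > 0" for n y
      by (rule GL_kernel_bound[OF X(1) XH that])
    show "(\<lambda>n. GL_kernel x (X n) y) \<longlonglongrightarrow> zolotarev_integrand f x y" if "y > 0" for y
      unfolding zolotarev_integrand_eq by (rule GL_kernel_tendsto[OF X that])
  qed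
qed

theorem GL_approximation:
  assumes \<beta>: "\<beta> > 0" and O: "f' \<in> O[at_bot](\<lambda>y. complex_of_real (\<bar>y\<bar> powr (- \<beta>)))"
  shows "integrable \<phi> (zolotarev_integrand f x)"
    and "h > 0 \<Longrightarrow> summable (GL_term c f x h k)"
    and "h > 0 \<Longrightarrow> semi_term c \<theta> f x h summable_on UNIV"
    and "h > 0 \<Longrightarrow> summable (\<lambda>j. log_term f x h (Suc j))"
    and "((\<lambda>h. (\<Sum>\<^sub>\<infinity>k\<in>UNIV. semi_term c \<theta> f x h k) - ck 0 * euler_mascheroni * f' x
          + ck 0 * (\<Sum>j. log_term f x h (Suc j))) \<longlongrightarrow> zolotarev_deriv \<phi> f x) (at_right 0)"
proof -
  have "continuous_on UNIV f'"
    using d2 by (meson continuous_at_imp_continuous_on has_vector_derivative_continuous)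
  then obtain K where K: "K > 0" "\<And>y. y > 0 \<Longrightarrow> norm (f' (x - y)) \<le> K * y powr (- \<beta>)"
    using bigo_at_bot_decay[OF _ \<beta> O, of x] by blast
  obtain C where C: "\<And>x h. h > 0 \<Longrightarrow> \<exists>S. (error_term x h has_sum S) UNIV \<and> norm S \<le> C * h"
    using error_term_has_sum_bound by blast
  define S where "S = (\<lambda>h. infsum (error_term x h) UNIV)"
  have S: "(error_term x h has_sum S h) UNIV" "norm (S h) \<le> C * h" if "h > 0" for h
    using C[OF that, of x] infsumI unfolding S_def by blast+
  show "integrable \<phi> (zolotarev_integrand f x)" by (rule zolotarev_integrable)
  show "summable (GL_term c f x h k)" if "h > 0" by (rule GL_term_summable[OF that])
  show "semi_term c \<theta> f x h summable_on UNIV" if "h > 0"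
    by (rule has_sum_imp_summable[OF semi_term_has_sum[OF that S(1)[OF that]]])
  show "summable (\<lambda>j. log_term f x h (Suc j))" if "h > 0"
    by (rule sums_summable[OF log_term_sums[OF \<beta> K that]])
  show "((\<lambda>h. (\<Sum>\<^sub>\<infinity>k\<in>UNIV. semi_term c \<theta> f x h k) - ck 0 * euler_mascheroni * f' x
          + ck 0 * (\<Sum>j. log_term f x h (Suc j))) \<longlongrightarrow> zolotarev_deriv \<phi> f x) (at_right 0)"
    unfolding tendsto_at_iff_sequentially o_def
  proof (intro allI impI)
    fix X :: "nat \<Rightarrow> real" assume "\<forall>i. X i \<in> {0<..} - {0}" and X0: "X \<longlonglongrightarrow> 0"
    hence X: "\<And>n. X n > 0" by auto
    define R where "R = (\<lambda>n. (\<Sum>j. log_term f x (X n) (Suc j)) - euler_mascheroni * f' x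
      - (inner_sum x (X n) / of_real (X n) - f x / of_real (X n) + f' x * (1 + of_real (ln (1 / X n)))))"
    have R: "R \<longlonglongrightarrow> 0" unfolding R_def by (rule log_part_tendsto[OF \<beta> K X X0])
    have SX: "(\<lambda>n. S (X n)) \<longlonglongrightarrow> 0"
      by (rule Lim_null_comparison[OF always_eventually tendsto_mult_right_zero[OF X0]]) (use S(2)[OF X] in blast)
    have "(\<Sum>\<^sub>\<infinity>k\<in>UNIV. semi_term c \<theta> f x (X n) k) - ck 0 * euler_mascheroni * f' x
          + ck 0 * (\<Sum>j. log_term f x (X n) (Suc j)) = integral\<^sup>L \<phi> (GL_kernel x (X n)) + S (X n) + ck 0 * R n" for n
      unfolding infsumI[OF semi_term_has_sum[OF X S(1)[OF X]]] base_term_0[OF X] R_def by (simp add: algebra_simps)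
    moreover have "(\<lambda>n. integral\<^sup>L \<phi> (GL_kernel x (X n)) + S (X n) + ck 0 * R n) \<longlonglongrightarrow> zolotarev_deriv \<phi> f x + 0 + ck 0 * 0"
      by (intro tendsto_intros GL_kernel_integral_tendsto X X0 SX R)
    ultimately show "(\<lambda>n. (\<Sum>\<^sub>\<infinity>k\<in>UNIV. semi_term c \<theta> f x (X n) k) - ck 0 * euler_mascheroni * f' x
          + ck 0 * (\<Sum>j. log_term f x (X n) (Suc j))) \<longlonglongrightarrow> zolotarev_deriv \<phi> f x" by simp
  qed
qed

end

lemma bounded_of_integrable_derivative:
  fixes g g' :: "real \<Rightarrow> complex"
  assumes d: "\<And>x. (g has_vector_derivative g' x) (at x)" and int: "integrable lborel g'"
  shows "norm (g x) \<le> norm (g 0) + (LINT x|lborel. norm (g' x))"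
proof -
  have le: "norm (g b - g a) \<le> (LINT x|lborel. norm (g' x))" if "a \<le> b" for a b
  proof -
    have s: "set_integrable lborel {a..b} g'"
      unfolding set_integrable_def by (rule integrable_mult_indicator[OF _ int]) simp
    have "(g' has_integral (g b - g a)) {a..b}"
      by (rule fundamental_theorem_of_calculus[OF that]) (rule has_vector_derivative_at_within[OF d])
    hence "(LINT x:{a..b}|lborel. g' x) = g b - g a"
      unfolding set_borel_integral_eq_integral(2)[OF s] by (rule integral_unique)
    moreover have "norm (LINT x:{a..b}|lborel. g' x) \<le> (LINT x:{a..b}|lborel. norm (g' x))"
      by (rule set_integral_norm_bound[OF s])
    moreover have "(LINT x:{a..b}|lborel. norm (g' x)) \<le> (LINT x|lborel. norm (g' x))"
      unfolding set_lebesgue_integral_def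
    proof (rule integral_mono)
      show "integrable lborel (\<lambda>x. indicator {a..b} x *\<^sub>R norm (g' x))"
        by (rule integrable_mult_indicator[OF _ integrable_norm[OF int]]) simp
      show "integrable lborel (\<lambda>x. norm (g' x))" by (rule integrable_norm[OF int])
    qed (simp add: indicator_def)
    ultimately show ?thesis by simp
  qed
  have "norm (g x - g 0) \<le> (LINT x|lborel. norm (g' x))"
    using le[of 0 x] le[of x 0] by (cases "0 \<le> x") (auto simp: norm_minus_commute)
  thus ?thesis using norm_triangle_ineq[of "g 0" "g x - g 0"] by simp
qed

theorem theorem4p12:
  fixes c \<beta> :: real and \<theta> :: "real \<Rightarrow> real" and \<phi> :: "real measure"
    and f f' f'' f''' :: "real \<Rightarrow> complex"
  assumes "c > 1"
    and "smooth_admissable c 1 \<theta>"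
    and "zolotarev_measure \<theta> \<phi>"
    and "integrable lborel f"
    and "bounded (range f)"
    and "\<And>x. (f has_vector_derivative f' x) (at x)"
    and "\<beta> > 0"
    and "f' \<in> O[at_bot](\<lambda>y. complex_of_real (\<bar>y\<bar> powr (- \<beta>)))"
    and "\<And>x. (f' has_vector_derivative f'' x) (at x)"
    and "\<And>x. (f'' has_vector_derivative f''' x) (at x)"
    and "integrable lborel f'''"
  shows "AE x in lborel.
    integrable \<phi> (zolotarev_integrand f x) \<and>
    (\<forall>h>0. (\<forall>k. summable (GL_term c f x h k)) \<and>
           semi_term c \<theta> f x h summable_on UNIV \<and>
           summable (\<lambda>j. log_term f x h (Suc j))) \<and>
    ((\<lambda>h. (\<Sum>\<^sub>\<infinity>k\<in>UNIV. semi_term c \<theta> f x h k)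
          - fourier_coeff c \<theta> 0 * euler_mascheroni * f' x
          + fourier_coeff c \<theta> 0 * (\<Sum>j. log_term f x h (Suc j)))
       \<longlongrightarrow> zolotarev_deriv \<phi> f x) (at_right 0)"
proof (rule AE_I2)
  fix x :: real
  obtain B where B: "\<And>x. norm (f x) \<le> B"
    using assms(5) unfolding bounded_iff by blast
  interpret zolotarev_GL c \<theta> \<phi> f f' f'' B "norm (f'' 0) + (LINT x|lborel. norm (f''' x))"
  proof
    show "c > 1" "smooth_admissable c 1 \<theta>" "zolotarev_measure \<theta> \<phi>" by fact+
    show "norm (f x) \<le> B" for x by (rule B)
    show "norm (f'' x) \<le> norm (f'' 0) + (LINT x|lborel. norm (f''' x))" for x
      by (rule bounded_of_integrable_derivative[OF assms(10,11)])
  qed (rule assms(6) assms(9))+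
  show "integrable \<phi> (zolotarev_integrand f x) \<and>
    (\<forall>h>0. (\<forall>k. summable (GL_term c f x h k)) \<and>
           semi_term c \<theta> f x h summable_on UNIV \<and>
           summable (\<lambda>j. log_term f x h (Suc j))) \<and>
    ((\<lambda>h. (\<Sum>\<^sub>\<infinity>k\<in>UNIV. semi_term c \<theta> f x h k)
          - fourier_coeff c \<theta> 0 * euler_mascheroni * f' x
          + fourier_coeff c \<theta> 0 * (\<Sum>j. log_term f x h (Suc j)))
       \<longlongrightarrow> zolotarev_deriv \<phi> f x) (at_right 0)"
    by (intro conjI allI impI GL_approximation[OF assms(7,8)])
qed

end
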